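(* Let $k=(k_1,k_2)$ be a root multiplicity and $\ell,\ell'\in2\mathbb{Z}\times\mathbb{Z}$. (i) The algebra $\mathbb{S}_{\mathrm{ns}}(0,k)$ is generated by the Cherednik operator $D_k$. (ii) The (right) $\mathbb{S}_{\mathrm{ns}}(0,k)$-module $\mathbb{S}_{\mathrm{ns}}(\ell,k)$ is of rank one and freely generated by $\mathcal{G}(\ell,k)$. (iii) The generators satisfy the relations $$\mathcal{G}(\ell+\ell',k)=\mathcal{G}(\ell',k+\ell)\,\mathcal{G}(\ell,k)=\mathcal{G}(\ell,k+\ell')\,\mathcal{G}(\ell',k)$$ whenever $\mathrm{sign}(\ell_1)=\mathrm{sign}(\ell_1')$ and $\mathrm{sign}(\frac12\ell_1+\ell_2)=\mathrm{sign}(\frac12\ell_1'+\ell_2')$.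
   Context: A root multiplicity for the root system $\{\pm\epsilon,\pm2\epsilon\}$ of type $BC_1$ is a complex-valued Weyl group invariant function on the roots, represented by the pair $k=(k_1,k_2)$ of its values on $\epsilon$ and $2\epsilon$. Let $s(f)(z)=f(z^{-1})$ on $\mathbb{C}[z^{\pm1}]$, $\mathbb{Z}_2=\langle s\rangle$, $\rho(k)=\frac12(k_1+2k_2)$, and let $$D_k=z\partial_z+k_1\frac{1}{1-z^{-1}}(1-s)+2k_2\frac{1}{1-z^{-2}}(1-s)-\rho(k)$$ be the Cherednik operator. Let $\mathbb{C}_\Delta[z^\pm]$ be the localization of $\mathbb{C}[z^{\pm1}]$ at $\Delta=z-z^{-1}$. For $\ell=(\ell_1,\ell_2)\in2\mathbb{Z}\times\mathbb{Z}$, $\mathbb{S}_{\mathrm{ns}}(\ell,k)$ is the space of non-symmetric shift operators with shift $\ell$, i.e. of elements $\mathcal{S}(k)\in\mathbb{C}_\Delta[z^\pm]\otimes\mathbb{C}[z\partial_z]\otimes\mathbb{C}[\mathbb{Z}_2]$ such that $\mathcal{S}(k)D_k=D_{k+\ell}\mathcal{S}(k)$ and $\mathcal{S}(k)$ acts as a differential-reflection operator on $\mathbb{C}[z^{\pm1}]$ (in particular maps it to itself). Composition makes $\mathbb{S}_{\mathrm{ns}}(0,k)$ an algebra and $\mathbb{S}_{\mathrm{ns}}(\ell,k)$ a right $\mathbb{S}_{\mathrm{ns}}(0,k)$-module. Fundamental non-symmetric shift operators: $$\mathcal{G}((0,1),k)=\frac{1}{z-z^{-1}}z\partial_z-\frac{z(1-s)}{(z-z^{-1})^2},$$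 $$\mathcal{G}((0,-1),k)=(z-z^{-1})z\partial_z+(k_1+2k_2-1)(z+z^{-1})+2k_1+z^{-1}-zs,$$ $$\mathcal{G}((2,-1),k)=\frac{1+z^{-1}}{1-z^{-1}}z\partial_z+k_2-\tfrac12-\frac{1+z^{-1}}{1-z^{-1}}\frac{1-s}{z-z^{-1}},$$ $$\mathcal{G}((-2,1),k)=\frac{1-z^{-1}}{1+z^{-1}}z\partial_z+k_1+k_2-\tfrac12+\frac{1-z^{-1}}{1+z^{-1}}\frac{1-s}{z-z^{-1}}.$$ For $\ell=\varepsilon_1N_1(2,-1)+\varepsilon_2N_2(0,1)$ with $N_1,N_2\in\mathbb{Z}_{\ge0}$, $\varepsilon_1,\varepsilon_2\in\{\pm1\}$, $$\mathcal{G}(\ell,k)=\prod_{i=0}^{N_1-1}\mathcal{G}\big(\varepsilon_1(2,-1),k+\varepsilon_1i(2,-1)+\varepsilon_2N_2(0,1)\big)\prod_{j=0}^{N_2-1}\mathcal{G}\big(\varepsilon_2(0,1),k+\varepsilon_2j(0,1)\big),$$ where in each product factors with larger index stand to the left.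
   Formalization: In (ii), that G(l,k) freely generates is claimed only for k nonresonant for l (no dominant Jacobi parameter k1+k2-1/2 or k2-1/2 runs from an integer >=0 to one <0); it fails for k=(0,1/2), l=(0,-1). Freeness of rank one holds for all k. *)

theory Defs
  imports
    Complex_Main
    "HOL-Computational_Algebra.Computational_Algebra"
    "HOL-Library.Poly_Mapping"
    "HOL-Library.Product_Plus"
begin

section \<open>Laurent polynomials and their fraction field\<close>

text \<open>
  The ring of Laurent polynomials in \<open>z\<close> is the group algebra of the integers, i.e. finitely
  supported functions \<open>int \<Rightarrow>\<^sub>0 complex\<close> with the convolution product; \<open>z ^ n\<close> is
  \<open>Poly_Mapping.single n 1\<close>.  Everything below lives in its fraction field, which contains the
  localization at \<open>z - 1/z\<close>.
\<close>

type_synonym laurent = "int \<Rightarrow>\<^sub>0 complex"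
type_synonym ratfun = "laurent fract"

lift_definition laurent_theta :: "laurent \<Rightarrow> laurent"
  is "\<lambda>f n. of_int n * f n"
  by (rule finite_subset) auto

lift_definition laurent_refl :: "laurent \<Rightarrow> laurent"
  is "\<lambda>f n. f (- n)"
proof -
  fix f :: "int \<Rightarrow> complex"
  assume "finite {n. f n \<noteq> 0}"
  then have "finite (uminus ` {n. f n \<noteq> 0})" by simp
  moreover have "{n. f (- n) \<noteq> 0} = uminus ` {n. f n \<noteq> 0}"
    by (auto simp: image_iff) (metis minus_minus)
  ultimately show "finite {n. f (- n) \<noteq> 0}" by simp
qed

lemma laurent_theta_add: "laurent_theta (f + g) = laurent_theta f + laurent_theta g"
  by (rule poly_mapping_eqI) (simp add: laurent_theta.rep_eq lookup_add algebra_simps)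

lemma laurent_refl_add: "laurent_refl (f + g) = laurent_refl f + laurent_refl g"
  by (rule poly_mapping_eqI) (simp add: laurent_refl.rep_eq lookup_add)

lemma laurent_theta_zero [simp]: "laurent_theta 0 = 0"
  by (rule poly_mapping_eqI) (simp add: laurent_theta.rep_eq)

lemma laurent_refl_zero [simp]: "laurent_refl 0 = 0"
  by (rule poly_mapping_eqI) (simp add: laurent_refl.rep_eq)

lemma laurent_theta_single [simp]:
  "laurent_theta (Poly_Mapping.single n c) = Poly_Mapping.single n (of_int n * c)"
  by (rule poly_mapping_eqI) (simp add: laurent_theta.rep_eq lookup_single when_def)

lemma laurent_refl_single [simp]:
  "laurent_refl (Poly_Mapping.single n c) = Poly_Mapping.single (- n) c"
  by (rule poly_mapping_eqI) (auto simp: laurent_refl.rep_eq lookup_single when_def)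

lemma laurent_refl_refl [simp]: "laurent_refl (laurent_refl f) = f"
  by (rule poly_mapping_eqI) (simp add: laurent_refl.rep_eq)

lemma laurent_induct [case_names zero add]:
  fixes f :: laurent
  assumes "P 0" and "\<And>n c f. P f \<Longrightarrow> P (Poly_Mapping.single n c + f)"
  shows "P f"
proof (induction f rule: update_induct)
  case const
  show ?case using assms(1) .
next
  case (update f a b)
  have "Poly_Mapping.update a b f = Poly_Mapping.single a b + f"
    using update.hyps
    by (intro poly_mapping_eqI)
      (auto simp: lookup_update lookup_add lookup_single when_def in_keys_iff)
  then show ?case using assms(2)[OF update.IH] by simp
qed

lemma laurent_theta_mult:
  "laurent_theta (f * g) = laurent_theta f * g + f * laurent_theta g"
proof (induction f rule: laurent_induct)
  case zero
  show ?case by simp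
next
  case (add n c f)
  have "laurent_theta (Poly_Mapping.single n c * g) =
      Poly_Mapping.single n (of_int n * c) * g + Poly_Mapping.single n c * laurent_theta g"
  proof (induction g rule: laurent_induct)
    case zero
    show ?case by simp
  next
    case (add m d g)
    then show ?case
      by (simp add: distrib_left laurent_theta_add mult_single algebra_simps single_add)
  qed
  then show ?case using add by (simp add: laurent_theta_add algebra_simps)
qed

lemma laurent_refl_mult: "laurent_refl (f * g) = laurent_refl f * laurent_refl g"
proof (induction f rule: laurent_induct)
  case zero
  show ?case by simp
next
  case (add n c f)
  have "laurent_refl (Poly_Mapping.single n c * g) = Poly_Mapping.single (- n) c * laurent_refl g"
    by (induction g rule: laurent_induct)
      (simp_all add: distrib_left laurent_refl_add mult_single)
  then show ?case using add by (simp add: laurent_refl_add algebra_simps)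
qed

lemma laurent_refl_eq_0_iff [simp]: "laurent_refl f = 0 \<longleftrightarrow> f = 0"
  by (metis laurent_refl_refl laurent_refl_zero)

text \<open>
  The derivation \<open>z \<partial>\<^sub>z\<close> and the reflection \<open>s\<close>, extended to the fraction field by the quotient
  rule and multiplicativity.  The lemmas \<open>theta_Fract\<close> and \<open>reflection_Fract\<close> show that the choice of
  numerator and denominator is immaterial.
\<close>

definition frac_rep :: "ratfun \<Rightarrow> laurent \<times> laurent" where
  "frac_rep q = (SOME p. snd p \<noteq> 0 \<and> q = Fract (fst p) (snd p))"

definition theta :: "ratfun \<Rightarrow> ratfun" where
  "theta q = (case frac_rep q of (a, b) \<Rightarrow>
     Fract (laurent_theta a * b - a * laurent_theta b) (b * b))"

definition reflection :: "ratfun \<Rightarrow> ratfun" where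
  "reflection q = (case frac_rep q of (a, b) \<Rightarrow> Fract (laurent_refl a) (laurent_refl b))"

lemma frac_rep_Fract:
  assumes "b \<noteq> 0"
  obtains c d where "frac_rep (Fract a b) = (c, d)" "d \<noteq> 0" "a * d = c * b"
proof -
  have "snd (frac_rep (Fract a b)) \<noteq> 0 \<and>
      Fract a b = Fract (fst (frac_rep (Fract a b))) (snd (frac_rep (Fract a b)))"
    unfolding frac_rep_def by (rule someI[of _ "(a, b)"]) (use assms in auto)
  then show ?thesis using that[of "fst (frac_rep (Fract a b))" "snd (frac_rep (Fract a b))"] assms
    by (auto simp: eq_fract)
qed

lemma theta_Fract:
  assumes b: "b \<noteq> 0"
  shows "theta (Fract a b) = Fract (laurent_theta a * b - a * laurent_theta b) (b * b)"
proof -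
  obtain c d where cd: "frac_rep (Fract a b) = (c, d)" "d \<noteq> 0" "a * d = c * b"
    using frac_rep_Fract[OF b] .
  have "laurent_theta a * d + a * laurent_theta d = laurent_theta c * b + c * laurent_theta b"
    using arg_cong[OF cd(3), of laurent_theta] by (simp add: laurent_theta_mult)
  then have "(laurent_theta c * d - c * laurent_theta d) * (b * b) =
      (laurent_theta a * b - a * laurent_theta b) * (d * d)"
    using cd(3) by algebra
  then show ?thesis using b cd by (simp add: theta_def eq_fract)
qed

lemma reflection_Fract:
  assumes b: "b \<noteq> 0"
  shows "reflection (Fract a b) = Fract (laurent_refl a) (laurent_refl b)"
proof -
  obtain c d where cd: "frac_rep (Fract a b) = (c, d)" "d \<noteq> 0" "a * d = c * b"
    using frac_rep_Fract[OF b] .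
  have "laurent_refl c * laurent_refl b = laurent_refl a * laurent_refl d"
    using arg_cong[OF cd(3), of laurent_refl] by (simp add: laurent_refl_mult)
  then show ?thesis using b cd by (simp add: reflection_def eq_fract)
qed

lemma theta_add: "theta (p + q) = theta p + theta q"
proof (cases p; cases q)
  fix a b c d :: laurent
  assume "p = Fract a b" "b \<noteq> 0" "q = Fract c d" "d \<noteq> 0"
  then show ?thesis
    by (simp add: theta_Fract eq_fract laurent_theta_mult laurent_theta_add algebra_simps)
qed

lemma theta_mult: "theta (p * q) = theta p * q + p * theta q"
proof (cases p; cases q)
  fix a b c d :: laurent
  assume "p = Fract a b" "b \<noteq> 0" "q = Fract c d" "d \<noteq> 0"
  then show ?thesis
    by (simp add: theta_Fract eq_fract laurent_theta_mult laurent_theta_add algebra_simps)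
qed

lemma reflection_add: "reflection (p + q) = reflection p + reflection q"
proof (cases p; cases q)
  fix a b c d :: laurent
  assume "p = Fract a b" "b \<noteq> 0" "q = Fract c d" "d \<noteq> 0"
  then show ?thesis
    by (simp add: reflection_Fract laurent_refl_mult laurent_refl_add)
qed

lemma reflection_mult: "reflection (p * q) = reflection p * reflection q"
proof (cases p; cases q)
  fix a b c d :: laurent
  assume "p = Fract a b" "b \<noteq> 0" "q = Fract c d" "d \<noteq> 0"
  then show ?thesis
    by (simp add: reflection_Fract laurent_refl_mult)
qed

definition const :: "complex \<Rightarrow> ratfun" where
  "const c = to_fract (Poly_Mapping.single 0 c)"

definition Z :: ratfun where
  "Z = to_fract (Poly_Mapping.single 1 1)"

definition Delta :: ratfun where
  "Delta = Z - inverse Z"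

definition laurent_polys :: "ratfun set" where
  "laurent_polys = range to_fract"

definition laurent_localized :: "ratfun set" where
  "laurent_localized = {f / Delta ^ n | f n. f \<in> laurent_polys}"


section \<open>Differential-reflection operators\<close>

type_synonym operator = "ratfun \<Rightarrow> ratfun"

definition dr_op :: "(nat \<Rightarrow> ratfun) \<Rightarrow> (nat \<Rightarrow> ratfun) \<Rightarrow> nat \<Rightarrow> operator" where
  "dr_op a b n f = (\<Sum>j\<le>n. a j * (theta ^^ j) f + b j * (theta ^^ j) (reflection f))"

lemma to_fract_sum: "to_fract (sum g A) = (\<Sum>x\<in>A. to_fract (g x))"
  by (induction A rule: infinite_finite_induct) simp_all

lemma common_denominator:
  fixes X :: "ratfun set"
  assumes "finite X"
  shows "\<exists>d. d \<noteq> 0 \<and> (\<forall>x\<in>X. \<exists>p. x * to_fract d = to_fract p)"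
  using assms
proof (induction rule: finite_induct)
  case empty
  show ?case by (rule exI[of _ 1]) simp
next
  case (insert y X)
  then obtain d where d: "d \<noteq> 0" "\<forall>x\<in>X. \<exists>p. x * to_fract d = to_fract p" by blast
  obtain p q where y: "y = Fract p q" "q \<noteq> 0" by (cases y)
  have "y * to_fract (d * q) = to_fract (p * d)"
    using y d(1) by (simp add: to_fract_def eq_fract)
  then have "\<exists>p. y * to_fract (d * q) = to_fract p" by blast
  moreover have "\<exists>p. x * to_fract (d * q) = to_fract p" if "x \<in> X" for x
  proof -
    obtain r where "x * to_fract d = to_fract r" using d(2) \<open>x \<in> X\<close> by blast
    then have "x * to_fract (d * q) = to_fract (r * q)"
      by (simp add: mult.assoc[symmetric])
    then show ?thesis by blast
  qed
  ultimately show ?case using d(1) y(2) by (intro exI[of _ "d * q"]) (auto simp del: to_fract_mult)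
qed

lemma lookup_mult_single:
  fixes f :: laurent
  shows "Poly_Mapping.lookup (f * Poly_Mapping.single m c) e = Poly_Mapping.lookup f (e - m) * c"
  by (induction f rule: laurent_induct)
    (auto simp: distrib_right lookup_add mult_single lookup_single when_def algebra_simps)

lemma theta_to_fract: "theta (to_fract f) = to_fract (laurent_theta f)"
  by (simp add: to_fract_def theta_Fract laurent_theta_single[of 0 1, simplified])

lemma reflection_to_fract: "reflection (to_fract f) = to_fract (laurent_refl f)"
  by (simp add: to_fract_def reflection_Fract laurent_refl_single[of 0 1, simplified])

lemma theta_power_single:
  "(theta ^^ j) (to_fract (Poly_Mapping.single m c)) =
     to_fract (Poly_Mapping.single m (of_int m ^ j * c))"
  by (induction j) (simp_all add: theta_to_fract mult.assoc)

lemma eventually_zero_polynomial: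
  fixes c :: "nat \<Rightarrow> complex"
  assumes "\<And>m::int. m \<ge> M \<Longrightarrow> (\<Sum>j\<le>n. c j * (e * of_int m) ^ j) = 0" and "e \<noteq> 0" and "j \<le> n"
  shows "c j = 0"
proof -
  define p where "p = (\<Sum>j\<le>n. monom (c j) j)"
  have poly_p: "poly p x = (\<Sum>j\<le>n. c j * x ^ j)" for x
    by (simp add: p_def poly_sum poly_monom)
  have "infinite ((\<lambda>m::int. e * of_int m) ` {M..})"
    using assms(2) by (subst finite_image_iff) (auto intro!: inj_onI simp: infinite_Ici)
  moreover have "(\<lambda>m::int. e * of_int m) ` {M..} \<subseteq> {x. poly p x = 0}"
    using assms(1) by (auto simp: poly_p)
  ultimately have "p = 0" using poly_roots_finite finite_subset by blast
  then have "coeff p j = 0" by simp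
  then show ?thesis using assms(3) by (simp add: p_def coeff_sum)
qed

lemma dr_op_zeroD:
  assumes zero: "\<And>f. f \<in> laurent_polys \<Longrightarrow> dr_op a b n f = 0" and "j \<le> n"
  shows "a j = 0 \<and> b j = 0"
proof -
  obtain d where d: "d \<noteq> 0"
    "\<forall>x \<in> a ` {..n} \<union> b ` {..n}. \<exists>p. x * to_fract d = to_fract p"
    using common_denominator[of "a ` {..n} \<union> b ` {..n}"] by auto
  have "\<exists>p. j \<le> n \<longrightarrow> a j * to_fract d = to_fract p" for j using d(2) by auto
  then obtain A where A: "\<And>j. j \<le> n \<Longrightarrow> a j * to_fract d = to_fract (A j)" by metis
  have "\<exists>p. j \<le> n \<longrightarrow> b j * to_fract d = to_fract p" for j using d(2) by auto
  then obtain B where B: "\<And>j. j \<le> n \<Longrightarrow> b j * to_fract d = to_fract (B j)" by metis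
  have eq: "(\<Sum>j\<le>n. Poly_Mapping.lookup (A j) (e - m) * of_int m ^ j
      + Poly_Mapping.lookup (B j) (e + m) * (- of_int m) ^ j) = 0" for m e :: int
  proof -
    let ?s = "\<lambda>m j. Poly_Mapping.single m (of_int m ^ j :: complex)"
    have "0 = to_fract d * dr_op a b n (to_fract (Poly_Mapping.single m 1))"
      using zero by (simp add: laurent_polys_def)
    also have "\<dots> = (\<Sum>j\<le>n. (a j * to_fract d) * to_fract (?s m j)
        + (b j * to_fract d) * to_fract (?s (- m) j))"
      by (simp add: dr_op_def theta_power_single reflection_to_fract sum_distrib_left algebra_simps)
    also have "\<dots> = to_fract (\<Sum>j\<le>n. A j * ?s m j + B j * ?s (- m) j)"
      by (simp add: to_fract_sum A B)
    finally have "to_fract (\<Sum>j\<le>n. A j * ?s m j + B j * ?s (- m) j) = 0" by (rule sym)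
    then have "(\<Sum>j\<le>n. A j * ?s m j + B j * ?s (- m) j) = 0"
      unfolding to_fract_eq_0_iff .
    from arg_cong[OF this, of "\<lambda>p. Poly_Mapping.lookup p e"] show ?thesis
      by (simp add: lookup_sum lookup_add lookup_mult_single)
  qed
  define K where "K = (\<Union>j\<le>n. Poly_Mapping.keys (A j) \<union> Poly_Mapping.keys (B j))"
  have "finite K" by (simp add: K_def)
  then obtain N where N: "\<And>x. x \<in> K \<Longrightarrow> \<bar>x\<bar> \<le> N"
    by (metis abs_le_iff Max_ge finite_imageI imageI)
  have big: "Poly_Mapping.lookup (A j) x = 0 \<and> Poly_Mapping.lookup (B j) x = 0" if "j \<le> n" "\<bar>x\<bar> > N" for j x
  proof -
    have "x \<notin> K" using N that(2) by force
    then show ?thesis using that(1) by (auto simp: K_def in_keys_iff)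
  qed
  have "Poly_Mapping.lookup (A j) x = 0" for x
  proof (rule eventually_zero_polynomial[where e = 1 and M = "N + \<bar>x\<bar> + 1"])
    fix m :: int assume m: "m \<ge> N + \<bar>x\<bar> + 1"
    have "Poly_Mapping.lookup (B j) (x + m + m) = 0" if "j \<le> n" for j
      using big[OF that, of "x + m + m"] big[OF that, of x] m
      by (cases "N \<ge> 0") (auto simp: abs_if split: if_splits)
    then show "(\<Sum>j\<le>n. Poly_Mapping.lookup (A j) x * (1 * of_int m) ^ j) = 0"
      using eq[of "x + m" m] by simp
  qed (use assms in auto)
  moreover have "Poly_Mapping.lookup (B j) x = 0" for x
  proof (rule eventually_zero_polynomial[where e = "-1" and M = "N + \<bar>x\<bar> + 1"])
    fix m :: int assume m: "m \<ge> N + \<bar>x\<bar> + 1"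
    have "Poly_Mapping.lookup (A j) (x - m - m) = 0" if "j \<le> n" for j
      using big[OF that, of "x - m - m"] big[OF that, of x] m
      by (cases "N \<ge> 0") (auto simp: abs_if split: if_splits)
    then show "(\<Sum>j\<le>n. Poly_Mapping.lookup (B j) x * (- 1 * of_int m) ^ j) = 0"
      using eq[of "x - m" m] by simp
  qed (use assms in auto)
  ultimately have "A j = 0" "B j = 0" by (auto intro: poly_mapping_eqI)
  then show ?thesis using A[OF assms(2)] B[OF assms(2)] d(1) by auto
qed

text \<open>
  The algebra obtained from the tensor product of the localized Laurent polynomials, the polynomials
  in \<open>z \<partial>\<^sub>z\<close> and the group algebra of \<open>{1, s}\<close> is identified with its image in the linear operators
  on the field of rational functions; its product is then composition.  By \<open>dr_op_zeroD\<close>,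
  the coefficients of such an operator are determined already by its action on
  the Laurent polynomials, so nothing is lost.
\<close>

definition diff_refl_operators :: "operator set" where
  "diff_refl_operators =
     {dr_op a b n | a b n. (\<forall>j. a j \<in> laurent_localized) \<and> (\<forall>j. b j \<in> laurent_localized)}"


section \<open>Cherednik operators and non-symmetric shift operators\<close>

type_synonym multiplicity = "complex \<times> complex"

definition shift :: "multiplicity \<Rightarrow> int \<times> int \<Rightarrow> multiplicity" where
  "shift k l = (fst k + of_int (fst l), snd k + of_int (snd l))"

definition rho :: "multiplicity \<Rightarrow> complex" where
  "rho k = (fst k + 2 * snd k) / 2"

definition cherednik :: "multiplicity \<Rightarrow> operator" where
  "cherednik k f =
     theta f
     + const (fst k) * (1 / (1 - inverse Z)) * (f - reflection f)
     + const (2 * snd k) * (1 / (1 - inverse Z ^ 2)) * (f - reflection f)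
     - const (rho k) * f"

definition shift_operators :: "int \<times> int \<Rightarrow> multiplicity \<Rightarrow> operator set" where
  "shift_operators l k =
     {S \<in> diff_refl_operators.
        S \<circ> cherednik k = cherednik (shift k l) \<circ> S \<and> S ` laurent_polys \<subseteq> laurent_polys}"

text \<open>The unital complex algebra of operators generated by a single operator.\<close>

inductive_set generated_algebra :: "operator \<Rightarrow> operator set" for D :: operator where
  generator: "D \<in> generated_algebra D"
| one: "id \<in> generated_algebra D"
| add: "A \<in> generated_algebra D \<Longrightarrow> B \<in> generated_algebra D \<Longrightarrow>
    (\<lambda>f. A f + B f) \<in> generated_algebra D"
| scale: "A \<in> generated_algebra D \<Longrightarrow> (\<lambda>f. const c * A f) \<in> generated_algebra D"
| mult: "A \<in> generated_algebra D \<Longrightarrow> B \<in> generated_algebra D \<Longrightarrow> A \<circ> B \<in> generated_algebra D"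

text \<open>
  \<open>S\<close> is a basis of the right module \<open>shift_operators l k\<close> over \<open>shift_operators 0 k\<close>.
\<close>

definition freely_generates :: "operator \<Rightarrow> int \<times> int \<Rightarrow> multiplicity \<Rightarrow> bool" where
  "freely_generates S l k \<longleftrightarrow>
     bij_betw (\<lambda>A. S \<circ> A) (shift_operators 0 k) (shift_operators l k)"


section \<open>The fundamental shift operators and their products\<close>

definition G_0_1 :: "multiplicity \<Rightarrow> operator" where
  "G_0_1 k f = 1 / (Z - inverse Z) * theta f - Z * (f - reflection f) / (Z - inverse Z) ^ 2"

definition G_0_m1 :: "multiplicity \<Rightarrow> operator" where
  "G_0_m1 k f =
     (Z - inverse Z) * theta f
     + (const (fst k + 2 * snd k - 1) * (Z + inverse Z) + const (2 * fst k) + inverse Z) * f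
     - Z * reflection f"

definition G_2_m1 :: "multiplicity \<Rightarrow> operator" where
  "G_2_m1 k f =
     (1 + inverse Z) / (1 - inverse Z) * theta f
     + const (snd k - 1 / 2) * f
     - (1 + inverse Z) / (1 - inverse Z) * ((f - reflection f) / (Z - inverse Z))"

definition G_m2_1 :: "multiplicity \<Rightarrow> operator" where
  "G_m2_1 k f =
     (1 - inverse Z) / (1 + inverse Z) * theta f
     + const (fst k + snd k - 1 / 2) * f
     + (1 - inverse Z) / (1 + inverse Z) * ((f - reflection f) / (Z - inverse Z))"

text \<open>Products in which the factors with larger index stand to the left.\<close>

fun left_prod :: "(nat \<Rightarrow> operator) \<Rightarrow> nat \<Rightarrow> operator" where
  "left_prod F 0 = id"
| "left_prod F (Suc n) = F n \<circ> left_prod F n"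

text \<open>
  Writing \<open>l = m1 (2, -1) + m2 (0, 1)\<close>, with \<open>m1 = e1 N1\<close> and \<open>m2 = e2 N2\<close>.  If \<open>N1 = 0\<close> or
  \<open>N2 = 0\<close> then the sign \<open>e1\<close> or \<open>e2\<close> is not determined by \<open>l\<close>, but it does not occur in
  the product either.
\<close>

definition shift_generator :: "int \<times> int \<Rightarrow> multiplicity \<Rightarrow> operator" where
  "shift_generator l k =
     (let m1 = fst l div 2; m2 = snd l + fst l div 2;
          e1 = sgn m1; N1 = nat \<bar>m1\<bar>; e2 = sgn m2; N2 = nat \<bar>m2\<bar>
      in left_prod (\<lambda>i. (if e1 = 1 then G_2_m1 else G_m2_1)
              (shift k (e1 * int i * 2, e1 * int i * (- 1) + e2 * int N2))) N1
         \<circ> left_prod (\<lambda>j. (if e2 = 1 then G_0_1 else G_0_m1)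
              (shift k (0, e2 * int j))) N2)"


section \<open>Resonances\<close>

text \<open>
  In terms of the Jacobi parameters \<open>\<alpha> = k1 + k2 - 1/2\<close> and \<open>\<beta> = k2 - 1/2\<close>, the shift \<open>l\<close> adds
  \<open>l1 + l2\<close> to \<open>\<alpha>\<close> and \<open>l2\<close> to \<open>\<beta>\<close>, and \<open>shift_generator l k\<close> is of order
  \<open>max \<bar>l1 + l2\<bar> \<bar>l2\<bar>\<close> in \<open>z \<partial>\<^sub>z\<close>.  If a parameter runs from a non-negative to a negative integer,
  then it no longer forces the order of a shift operator up to the absolute value of
  its increment.  Call \<open>k\<close> non-resonant for \<open>l\<close> if this does not happen to (one of) the parameters
  with the largest increment.  For resonant \<open>k\<close> there can be shift operators of smaller
  order than \<open>shift_generator l k\<close>; \<open>resonant_example\<close> exhibits one of order zero.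
\<close>

definition crosses :: "complex \<Rightarrow> int \<Rightarrow> bool" where
  "crosses x d \<longleftrightarrow> (\<exists>n. 0 \<le> n \<and> n + d < 0 \<and> x = of_int n)"

definition nonresonant :: "int \<times> int \<Rightarrow> multiplicity \<Rightarrow> bool" where
  "nonresonant l k \<longleftrightarrow>
     (let \<alpha> = fst k + snd k - 1 / 2; \<beta> = snd k - 1 / 2;
          d\<alpha> = fst l + snd l; d\<beta> = snd l
      in (\<bar>d\<beta>\<bar> \<le> \<bar>d\<alpha>\<bar> \<and> \<not> crosses \<alpha> d\<alpha>) \<or> (\<bar>d\<alpha>\<bar> \<le> \<bar>d\<beta>\<bar> \<and> \<not> crosses \<beta> d\<beta>))"

lemma const_simps:
  "const 0 = 0" "const 1 = 1" "const (c + d) = const c + const d" "const (- c) = - const c"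
  by (simp_all add: const_def single_add single_uminus del: to_fract_uminus)
    (simp_all add: to_fract_def)

lemma theta_const [simp]: "theta (const c) = 0"
  by (simp add: const_def theta_to_fract)

lemma reflection_const [simp]: "reflection (const c) = const c"
  by (simp add: const_def reflection_to_fract)

lemma theta_0 [simp]: "theta 0 = 0" and theta_1 [simp]: "theta 1 = 0"
  and reflection_0 [simp]: "reflection 0 = 0" and reflection_1 [simp]: "reflection 1 = 1"
  using theta_const[of 0] theta_const[of 1] reflection_const[of 0] reflection_const[of 1]
  by (simp_all add: const_simps)

lemma theta_minus: "theta (- p) = - theta p"
  using theta_add[of p "- p"] by (simp add: eq_neg_iff_add_eq_0 add.commute)

lemma reflection_minus: "reflection (- p) = - reflection p"
  using reflection_add[of p "- p"] by (simp add: eq_neg_iff_add_eq_0 add.commute)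

lemma Z_inverse: "inverse Z = to_fract (Poly_Mapping.single (- 1) 1)"
proof -
  have "Z * to_fract (Poly_Mapping.single (- 1) 1) = 1"
    unfolding Z_def to_fract_mult[symmetric] by (simp add: mult_single)
  then show ?thesis by (metis inverse_unique)
qed

lemma Z_nonzero [simp]: "Z \<noteq> 0"
  using Z_inverse by (auto simp: Z_def) (metis lookup_single_eq lookup_zero zero_neq_one)

lemma theta_Z: "theta Z = Z" "theta (inverse Z) = - inverse Z"
  unfolding Z_inverse unfolding Z_def
  by (simp_all add: theta_to_fract single_uminus)

lemma reflection_Z: "reflection Z = inverse Z" "reflection (inverse Z) = Z"
  unfolding Z_inverse unfolding Z_def by (simp_all add: reflection_to_fract)

lemma theta_Delta: "theta Delta = Z + inverse Z"
  by (simp add: Delta_def theta_add theta_minus theta_Z flip: add_uminus_conv_diff)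

lemma reflection_Delta: "reflection Delta = - Delta"
  by (simp add: Delta_def reflection_add reflection_minus reflection_Z flip: add_uminus_conv_diff)

lemma Delta_eq: "Delta = to_fract (Poly_Mapping.single 1 1 - Poly_Mapping.single (- 1) 1)"
  unfolding Delta_def Z_inverse unfolding Z_def by (simp add: to_fract_def)

lemma Delta_nonzero [simp]: "Delta \<noteq> 0"
proof
  assume "Delta = 0"
  then have "(Poly_Mapping.single 1 1 - Poly_Mapping.single (- 1) 1 :: laurent) = 0"
    by (simp add: Delta_eq)
  from arg_cong[OF this, of "\<lambda>p. Poly_Mapping.lookup p 1"] show False
    by (simp add: lookup_minus lookup_single when_def)
qed

lemma Delta_cherednik_coefficient: "1 / (1 - inverse Z ^ 2) = Z / Delta"
proof -
  have "Z * (1 - inverse Z ^ 2) = Delta"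
    by (simp add: Delta_def power2_eq_square right_diff_distrib mult.assoc[symmetric])
  then show ?thesis
    by (metis Z_nonzero mult.right_neutral nonzero_mult_divide_mult_cancel_left)
qed

lemma dr_op_const_mult: "dr_op a b n (const c * f) = const c * dr_op a b n f"
proof -
  have "(theta ^^ j) (const c * g) = const c * (theta ^^ j) g" for j g
    by (induction j) (simp_all add: theta_mult)
  then show ?thesis
    by (simp add: dr_op_def reflection_mult sum_distrib_left distrib_left mult.left_commute)
qed

lemma resonant_example:
  defines "k \<equiv> (0, 1 / 2)" and "l \<equiv> (0, - 1)"
  shows "(\<lambda>f. Delta * f) \<in> shift_operators l k"
    and "\<not> freely_generates (shift_generator l k) l k"
proof -
  define h where "h = const (1 / 2)"
  have h: "h + h = 1" unfolding h_def const_simps(3)[symmetric] by (simp add: const_simps)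
  have D: "cherednik k f = theta f + Z / Delta * (f - reflection f) - h * f" for f
    by (simp add: cherednik_def k_def rho_def h_def const_simps Delta_cherednik_coefficient)
  have D': "cherednik (shift k l) f = theta f - Z / Delta * (f - reflection f) + h * f" for f
    by (simp add: cherednik_def k_def l_def shift_def rho_def h_def const_simps
        Delta_cherednik_coefficient flip: minus_divide_left)
  show mem: "(\<lambda>f. Delta * f) \<in> shift_operators l k"
  proof -
    have "f \<in> laurent_localized" if "f \<in> laurent_polys" for f
      unfolding laurent_localized_def using that
      by (intro CollectI exI[of _ f] exI[of _ "0::nat"]) simp
    moreover have "Delta \<in> laurent_polys"
      unfolding laurent_polys_def Delta_eq by (rule rangeI)
    moreover have "0 \<in> laurent_polys"
      unfolding laurent_polys_def by (metis rangeI to_fract_0)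
    ultimately have loc: "Delta \<in> laurent_localized" "0 \<in> laurent_localized"
      by blast+
    have "(\<lambda>f. Delta * f) = dr_op (\<lambda>j. if j = 0 then Delta else 0) (\<lambda>_. 0) 0"
      by (auto simp: dr_op_def)
    then have "(\<lambda>f. Delta * f) \<in> diff_refl_operators"
      unfolding diff_refl_operators_def using loc
      by (intro CollectI exI[of _ "\<lambda>j::nat. if j = 0 then Delta else 0"]
          exI[of _ "\<lambda>_::nat. 0"] exI[of _ "0::nat"]) auto
    moreover have "(\<lambda>f. Delta * f) ` laurent_polys \<subseteq> laurent_polys"
      unfolding laurent_polys_def Delta_eq
      by (force simp del: to_fract_diff to_fract_mult simp add: to_fract_mult[symmetric])
    moreover have "Delta * cherednik k f = cherednik (shift k l) (Delta * f)" for f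
    proof -
      have "Delta * cherednik k f = Delta * theta f + Z * (f - reflection f) - h * Delta * f"
        by (simp add: D algebra_simps)
      moreover have "cherednik (shift k l) (Delta * f) =
          (Z + inverse Z) * f + Delta * theta f - Z * (f + reflection f) + h * Delta * f"
        by (simp add: D' theta_mult reflection_mult theta_Delta reflection_Delta algebra_simps)
      moreover have "(h + h) * Delta * f = (Z - inverse Z) * f"
        by (simp add: h Delta_def)
      ultimately show ?thesis by algebra
    qed
    ultimately show ?thesis by (auto simp: shift_operators_def)
  qed
  have gen: "shift_generator l k = G_0_m1 k"
    by (simp add: shift_generator_def l_def k_def shift_def)
  have G: "G_0_m1 k f = Delta * (cherednik k f - h * f)" for f
  proof -
    have "Delta * (cherednik k f - h * f) =
        Delta * theta f + Z * (f - reflection f) - (h + h) * Delta * f"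
      by (simp add: D algebra_simps)
    then show ?thesis
      by (simp add: h G_0_m1_def k_def const_simps Delta_def algebra_simps)
  qed
  show "\<not> freely_generates (shift_generator l k) l k"
  proof
    assume "freely_generates (shift_generator l k) l k"
    then obtain A where A: "A \<in> shift_operators 0 k" "(\<lambda>f. Delta * f) = G_0_m1 k \<circ> A"
      using mem unfolding freely_generates_def bij_betw_def gen by blast
    have inv: "cherednik k (A f) - h * A f = f" for f
      using fun_cong[OF A(2), of f] by (simp add: G)
    have comm: "A (cherednik k f) = cherednik k (A f)" for f
      using A(1) by (auto simp: shift_operators_def shift_def fun_eq_iff)
    have lin: "A (h * f) = h * A f" for f
      using A(1) unfolding h_def
      by (auto simp: shift_operators_def diff_refl_operators_def dr_op_const_mult)
    define f0 where "f0 = inverse Delta"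
    have f0: "Delta * f0 = 1" by (simp add: f0_def)
    have "theta Delta * f0 + Delta * theta f0 = 0"
      using arg_cong[OF f0, of theta] by (simp add: theta_mult)
    then have th: "theta f0 = - (Z + inverse Z) * f0 * f0"
      by (simp add: theta_Delta f0_def field_simps eq_neg_iff_add_eq_0)
    have "reflection Delta * reflection f0 = 1"
      using arg_cong[OF f0, of reflection] by (simp add: reflection_mult)
    then have "Delta * (reflection f0 + f0) = 0"
      using f0 by (simp add: reflection_Delta distrib_left) (metis add.right_inverse)
    then have re: "reflection f0 = - f0"
      by (simp add: eq_neg_iff_add_eq_0)
    have "cherednik k f0 = theta f0 + Z * f0 * (f0 - reflection f0) - h * f0"
      by (simp add: D f0_def divide_inverse)
    also have "\<dots> = (Z - inverse Z) * f0 * f0 - h * f0"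
      unfolding th re by (simp add: algebra_simps)
    also have "\<dots> = (h + h) * f0 - h * f0"
      by (simp add: f0 h flip: Delta_def)
    finally have "cherednik k f0 = h * f0" by (simp add: algebra_simps)
    then have "cherednik k (A f0) = h * A f0" using comm[of f0] lin[of f0] by simp
    then have "f0 = 0" using inv[of f0] by simp
    then show False by (simp add: f0_def)
  qed
qed

end

theory Submission
  imports Defs
begin

text \<open>
  The proof expands operators at the fixed points \<open>c = 1\<close> and \<open>c = - 1\<close> of the reflection. With
  \<open>z = c * exp t\<close> the derivation \<open>z \<partial>\<^sub>z\<close> becomes \<open>d/dt\<close> and the reflection \<open>s\<close> becomes \<open>t \<mapsto> - t\<close>. In lowest
  order in \<open>t\<close> the Cherednik operator is the rational Dunkl operator \<open>\<partial> + (x / t) (1 - s)\<close>, where \<open>x\<close>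
  is \<open>k1 + k2\<close> at \<open>1\<close> and \<open>k2\<close> at \<open>- 1\<close>; it maps \<open>t ^ m\<close> to \<open>[m] t ^ (m - 1)\<close> with \<open>[m] = m\<close> for even and
  \<open>[m] = m + 2 x\<close> for odd \<open>m\<close>. In the same sense any non-zero differential-reflection operator has a symbol:
  it maps \<open>t ^ m\<close> to \<open>\<sigma> m * t ^ (m - e)\<close> up to higher order, with \<open>\<sigma>\<close> polynomial on the even and on the odd
  integers. If it is a shift operator, and if the shift adds the integer \<open>d\<close> to \<open>x\<close>, then \<open>\<sigma>\<close> solves
  \<open>\<sigma> (m - 1) [m] = [m - e]' \<sigma> m\<close>, where the bracket with a prime belongs to \<open>x + d\<close>.

  For fixed \<open>e\<close> this equation has at most one solution up to scalars
  (\<open>dunkl_recursion_unique\<close>), and the degree of its even part is \<open>e - d\<close> (\<open>dunkl_recursion_degree\<close>). So the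
  integer \<open>e\<close>, rather than the order in \<open>z \<partial>\<^sub>z\<close>, filters the shift operators with one-dimensional steps;
  it is bounded below by \<open>d\<close>, and it grows by one under composition with the Cherednik operator. Hence an
  operator with minimal \<open>e\<close> freely generates the module over the algebra of polynomials in the Cherednik
  operator (\<open>shift_operators_generated\<close>). For the zero shift the identity is minimal, which identifies
  that algebra with all operators that commute with the Cherednik operator and preserve Laurent polynomials.

  The product of fundamental operators has at most \<open>\<bar>d\<bar>\<close> factors of order one if \<open>d\<close> is the increment of largest
  absolute value, so that its \<open>e\<close> is at most \<open>\<bar>d\<bar> + d\<close>. This is also a lower bound for every shift operator unless
  \<open>x - 1 / 2\<close> runs from a non-negative to a negative integer (\<open>local_order_lower_bound\<close>). For \<open>d \<ge> 0\<close> the symbol vanishes at \<open>0 \<le> m < e\<close>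
  because the image of a Laurent polynomial has no pole, and this gives too many zeros for the degree
  \<open>e - d\<close> unless \<open>e \<ge> 2 d\<close>. For \<open>d < 0\<close> the claim is \<open>e \<ge> 0\<close>: otherwise the first \<open>m \<ge> 0\<close> with
  \<open>\<sigma> m \<noteq> 0\<close> satisfies \<open>[m - e]' = 0\<close>, and together with the degree this makes \<open>x - 1 / 2\<close> run from a
  non-negative to a negative integer.

  What remains is explicit. The fundamental operators and the Cherednik operator are of the form
  \<open>u \<theta> + v + x s\<close> with \<open>\<theta> = z \<partial>\<^sub>z\<close>, so that their intertwining and commutation relations reduce to identities between
  rational functions. The fundamental operators preserve Laurent polynomials because each of these is a sum \<open>p + Delta * q\<close> with
  symmetric \<open>p\<close> and \<open>q\<close>. The relations for composite shifts follow by reordering commuting factors.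
\<close>

section \<open>Local expansions at the fixed points of the reflection\<close>

text \<open>The Taylor series in \<open>t\<close> of \<open>p\<close> at \<open>z = c * exp t\<close>. In this coordinate \<open>z \<partial>\<^sub>z\<close> becomes the
  derivative, and at a fixed point \<open>c\<close> of \<open>z \<mapsto> 1/z\<close> the reflection becomes \<open>t \<mapsto> - t\<close>; both identities
  are exact, which is the reason for preferring \<open>t\<close> to the coordinate \<open>z - c\<close>.\<close>

definition taylor :: "complex \<Rightarrow> laurent \<Rightarrow> complex fps" where
  "taylor c p = (\<Sum>n\<in>Poly_Mapping.keys p.
     fps_const (Poly_Mapping.lookup p n * c powi n) * fps_exp (of_int n))"

lemma taylor_0 [simp]: "taylor c 0 = 0"
  by (simp add: taylor_def)

lemma taylor_add: "taylor c (p + q) = taylor c p + taylor c q"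
  unfolding taylor_def
  by (rule setsum_keys_plus_distrib[where
        f = "\<lambda>n a. fps_const (a * c powi n) * fps_exp (of_int n)"])
    (simp_all add: distrib_right flip: fps_const_add)

lemma taylor_single:
  "taylor c (Poly_Mapping.single n a) = fps_const (a * c powi n) * fps_exp (of_int n)"
  by (simp add: taylor_def)

lemma taylor_mult:
  assumes "c \<noteq> 0"
  shows "taylor c (p * q) = taylor c p * taylor c q"
proof (induction p rule: laurent_induct)
  case (add n a p)
  have "taylor c (Poly_Mapping.single n a * q) = taylor c (Poly_Mapping.single n a) * taylor c q"
  proof (induction q rule: laurent_induct)
    case (add m b q)
    have "taylor c (Poly_Mapping.single n a * Poly_Mapping.single m b) =
        taylor c (Poly_Mapping.single n a) * taylor c (Poly_Mapping.single m b)"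
      using assms
      by (simp add: mult_single taylor_single power_int_add fps_exp_add_mult mult_ac
          flip: fps_const_mult)
    with add show ?case by (simp add: distrib_left taylor_add)
  qed simp
  with add show ?case by (simp add: distrib_right taylor_add)
qed simp

lemma taylor_theta: "taylor c (laurent_theta p) = fps_deriv (taylor c p)"
  by (induction p rule: laurent_induct)
    (simp_all add: laurent_theta_add taylor_add taylor_single mult_ac flip: fps_const_mult)

lemma taylor_refl:
  assumes "c = 1 \<or> c = -1"
  shows "taylor c (laurent_refl p) = fps_compose (taylor c p) (- fps_X)"
proof (induction p rule: laurent_induct)
  case (add n a p)
  have "c powi (- n) = c powi n"
    using assms by (auto simp: power_int_minus power_int_minus_left)
  with add show ?case
    by (simp add: laurent_refl_add taylor_add taylor_single fps_compose_add_distrib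
        fps_compose_mult_distrib)
qed simp

text \<open>Exponentials with different exponents are linearly independent: the Taylor coefficients
  determine all power sums \<open>\<Sum>n. p n * c ^ n * n ^ i\<close>, hence the pairing of \<open>p\<close> with any
  interpolation polynomial.\<close>

lemma taylor_eq_0_iff:
  assumes "c \<noteq> 0"
  shows "taylor c p = 0 \<longleftrightarrow> p = 0"
proof
  assume zero: "taylor c p = 0"
  let ?K = "Poly_Mapping.keys p"
  have pow: "(\<Sum>n\<in>?K. Poly_Mapping.lookup p n * c powi n * of_int n ^ i) = 0" for i
  proof -
    have "(\<Sum>n\<in>?K. Poly_Mapping.lookup p n * c powi n * (of_int n ^ i / fact i)) = 0"
      using arg_cong[OF zero, of "\<lambda>f. fps_nth f i"]
      by (simp add: taylor_def fps_sum_nth)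
    then show ?thesis by (simp flip: sum_divide_distrib)
  qed
  have Q: "(\<Sum>n\<in>?K. Poly_Mapping.lookup p n * c powi n * poly q (of_int n)) = 0" for q
  proof -
    have "(\<Sum>n\<in>?K. Poly_Mapping.lookup p n * c powi n * poly q (of_int n)) =
       (\<Sum>i\<le>degree q. coeff q i * (\<Sum>n\<in>?K. Poly_Mapping.lookup p n * c powi n * of_int n ^ i))"
      unfolding poly_altdef sum_distrib_left by (subst sum.swap) (simp add: mult_ac)
    then show ?thesis by (simp add: pow)
  qed
  show "p = 0"
  proof (rule ccontr)
    assume "p \<noteq> 0"
    then obtain n where n: "n \<in> ?K" by (metis ex_in_conv keys_eq_empty)
    \<comment> \<open>a polynomial that vanishes at all exponents of \<open>p\<close> except \<open>n\<close>\<close>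
    define q where "q = (\<Prod>m\<in>?K - {n}. [:- of_int m, 1 :: complex:])"
    have q: "poly q (of_int m) = 0" if "m \<in> ?K - {n}" for m
      using that by (auto simp: q_def poly_prod)
    have "(\<Sum>n\<in>?K. Poly_Mapping.lookup p n * c powi n * poly q (of_int n)) =
        Poly_Mapping.lookup p n * c powi n * poly q (of_int n)"
      using n q by (subst sum.remove[OF _ n]) (auto intro: sum.neutral)
    moreover have "poly q (of_int n) \<noteq> 0" by (auto simp: q_def poly_prod)
    ultimately show False using n assms Q[of q] by (auto simp: in_keys_iff)
  qed
qed simp

definition expansion :: "complex \<Rightarrow> ratfun \<Rightarrow> complex fls" where
  "expansion c q = (case frac_rep q of (a, b) \<Rightarrow>
     fps_to_fls (taylor c a) / fps_to_fls (taylor c b))"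

text \<open>The expansion extends from Laurent polynomials to their quotients because \<open>taylor\<close> is
  multiplicative and injective.\<close>

lemma expansion_Fract:
  assumes c: "c \<noteq> 0" and b: "b \<noteq> 0"
  shows "expansion c (Fract a b) = fps_to_fls (taylor c a) / fps_to_fls (taylor c b)"
proof -
  obtain x y where xy: "frac_rep (Fract a b) = (x, y)" "y \<noteq> 0" "a * y = x * b"
    using frac_rep_Fract[OF b] .
  have "fps_to_fls (taylor c a) * fps_to_fls (taylor c y) =
      fps_to_fls (taylor c x) * fps_to_fls (taylor c b)"
    using arg_cong[OF xy(3), of "taylor c"] by (simp add: taylor_mult c flip: fls_times_fps_to_fls)
  then show ?thesis
    using b c xy by (simp add: expansion_def field_simps taylor_eq_0_iff)
qed

lemma expansion_to_fract:
  assumes "c \<noteq> 0"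
  shows "expansion c (to_fract p) = fps_to_fls (taylor c p)"
proof -
  have "taylor c 1 = 1" using taylor_single[of c 0 1] by simp
  then show ?thesis using assms by (simp add: to_fract_def expansion_Fract)
qed

lemma expansion_add:
  assumes "c \<noteq> 0"
  shows "expansion c (p + q) = expansion c p + expansion c q"
proof (cases p; cases q)
  fix a b x y :: laurent
  assume "p = Fract a b" "b \<noteq> 0" "q = Fract x y" "y \<noteq> 0"
  then show ?thesis using assms
    by (simp add: expansion_Fract taylor_add taylor_mult taylor_eq_0_iff fls_times_fps_to_fls
        add_frac_eq)
qed

lemma expansion_mult:
  assumes "c \<noteq> 0"
  shows "expansion c (p * q) = expansion c p * expansion c q"
proof (cases p; cases q)
  fix a b x y :: laurent
  assume "p = Fract a b" "b \<noteq> 0" "q = Fract x y" "y \<noteq> 0"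
  then show ?thesis using assms
    by (simp add: expansion_Fract taylor_mult fls_times_fps_to_fls)
qed

lemma expansion_theta:
  assumes "c \<noteq> 0"
  shows "expansion c (theta p) = fls_deriv (expansion c p)"
proof (cases p)
  case (Fract a b)
  then have nz: "fps_to_fls (taylor c b) \<noteq> 0" using assms by (simp add: taylor_eq_0_iff)
  let ?A = "fps_to_fls (taylor c a)" and ?B = "fps_to_fls (taylor c b)"
  have quot: "expansion c p = ?A / ?B"
    using Fract assms by (simp add: expansion_Fract)
  then have A: "?A = expansion c p * ?B" using nz by (simp del: fps_to_fls_eq_0_iff)
  have "taylor c (p - q) = taylor c p - taylor c q" for p q
    using taylor_add[of c "p - q" q] by simp
  then have "expansion c (theta p) = (fls_deriv ?A * ?B - ?A * fls_deriv ?B) / (?B * ?B)"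
    using Fract assms nz
    by (simp only: theta_Fract expansion_Fract taylor_mult taylor_theta fls_times_fps_to_fls
        fps_to_fls_minus fls_deriv_fps_to_fls mult_eq_0_iff simp_thms)
  also have "\<dots> = (fls_deriv (expansion c p) * (?B * ?B)) / (?B * ?B)"
    unfolding A fls_deriv_mult by (simp only: algebra_simps add_diff_cancel_left' add_diff_cancel_left)
  finally show ?thesis using nz by simp
qed

lemma expansion_reflection:
  assumes "c = 1 \<or> c = -1"
  shows "expansion c (reflection p) = fls_compose_fps (expansion c p) (- fps_X)"
proof (cases p)
  case (Fract a b)
  then show ?thesis using assms
    by (auto simp: reflection_Fract expansion_Fract taylor_refl fls_compose_fps_divide)
qed

lemma expansion_0 [simp]: "c \<noteq> 0 \<Longrightarrow> expansion c 0 = 0"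
  using expansion_to_fract[of c 0] by simp

lemma expansion_minus: "c \<noteq> 0 \<Longrightarrow> expansion c (- p) = - expansion c p"
  using expansion_add[of c p "- p"] by (simp add: eq_neg_iff_add_eq_0 add.commute)

lemma expansion_const: "c \<noteq> 0 \<Longrightarrow> expansion c (const a) = fls_const a"
  by (simp add: const_def expansion_to_fract taylor_single fps_const_to_fls)

lemma expansion_1 [simp]: "c \<noteq> 0 \<Longrightarrow> expansion c 1 = 1"
  using expansion_const[of c 1] by (simp add: const_simps)

lemma expansion_eq_0_iff: "c \<noteq> 0 \<Longrightarrow> expansion c p = 0 \<longleftrightarrow> p = 0"
  by (cases p) (auto simp: expansion_Fract taylor_eq_0_iff eq_fract Zero_fract_def)

lemma expansion_inverse: "c \<noteq> 0 \<Longrightarrow> expansion c (inverse p) = inverse (expansion c p)"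
  using expansion_mult[of c p "inverse p"]
  by (cases "p = 0") (auto simp: inverse_unique)


section \<open>Leading coefficients of Laurent series\<close>

text \<open>The value \<open>a\<close> is allowed to vanish, so that \<open>m\<close> is only a lower bound for the order of \<open>f\<close>. This
  makes the notion stable under sums and under operators.\<close>

definition leads :: "complex fls \<Rightarrow> int \<Rightarrow> complex \<Rightarrow> bool" where
  "leads f m a \<longleftrightarrow> (\<forall>i<m. fls_nth f i = 0) \<and> fls_nth f m = a"

lemma leads_iff_factor: "leads f m a \<longleftrightarrow> (\<exists>g. f = fls_X_intpow m * fps_to_fls g \<and> fps_nth g 0 = a)"
proof
  assume l: "leads f m a"
  define g where "g = fls_regpart (fls_shift m f)"
  have "f = fls_X_intpow m * fps_to_fls g"
    using l by (intro fls_eqI) (auto simp: leads_def g_def fls_X_intpow_times_conv_shift)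
  moreover have "fps_nth g 0 = a" using l by (simp add: leads_def g_def)
  ultimately show "\<exists>g. f = fls_X_intpow m * fps_to_fls g \<and> fps_nth g 0 = a" by blast
qed (auto simp: leads_def fls_X_intpow_times_conv_shift)

lemma leads_mult:
  assumes "leads f m a" "leads g n b"
  shows "leads (f * g) (m + n) (a * b)"
proof -
  obtain f' g' where "f = fls_X_intpow m * fps_to_fls f'" "fps_nth f' 0 = a"
      "g = fls_X_intpow n * fps_to_fls g'" "fps_nth g' 0 = b"
    using assms by (auto simp: leads_iff_factor)
  then have "f * g = (fls_X_intpow m * fls_X_intpow n) * (fps_to_fls f' * fps_to_fls g')"
      and "fps_nth (f' * g') 0 = a * b"
    by (simp_all only: mult.assoc mult.left_commute fps_mult_nth_0)
  then have "f * g = (fls_X_intpow m * fls_X_intpow n) * fps_to_fls (f' * g')"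
      and "fps_nth (f' * g') 0 = a * b"
    by (simp_all only: fls_times_fps_to_fls)
  then show ?thesis unfolding leads_iff_factor fls_X_intpow_times_fls_X_intpow by blast
qed

lemma leads_add: "leads f m a \<Longrightarrow> leads g m b \<Longrightarrow> leads (f + g) m (a + b)"
  by (auto simp: leads_def)

lemma leads_deriv: "leads f m a \<Longrightarrow> leads (fls_deriv f) (m - 1) (of_int m * a)"
  by (auto simp: leads_def)

lemma leads_flip:
  assumes "leads f m a"
  shows "leads (fls_compose_fps f (- fps_X)) m ((-1) powi m * a)"
proof -
  obtain g where g: "f = fls_X_intpow m * fps_to_fls g" "fps_nth g 0 = a"
    using assms by (auto simp: leads_iff_factor)
  have "fls_compose_fps f (- fps_X) =
      fps_to_fls (- fps_X) powi m * fps_to_fls (fps_compose g (- fps_X))"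
    using g by (simp add: fls_compose_fps_mult fls_compose_fps_powi flip: fls_X_power_int)
  also have "fps_to_fls (- fps_X) powi m = ((-1) * fls_X :: complex fls) powi m"
    by simp
  also have "\<dots> = fls_const ((-1) powi m) * fls_X_intpow m"
    by (subst power_int_mult_distrib) (simp add: fls_const_power_int)
  finally have "fls_compose_fps f (- fps_X) =
      fls_X_intpow m * fps_to_fls (fps_const ((-1) powi m) * fps_compose g (- fps_X))"
    by (simp add: fls_times_fps_to_fls mult_ac)
  moreover have "fps_nth (fps_const ((-1) powi m) * fps_compose g (- fps_X)) 0 = (-1) powi m * a"
    using g by simp
  ultimately show ?thesis unfolding leads_iff_factor by blast
qed

section \<open>The difference equation of symbols\<close>

text \<open>In lowest order at a fixed point of the reflection, an operator maps \<open>t ^ m\<close> to a multiple of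
  \<open>t ^ (m - e)\<close>. The derivative contributes polynomials in \<open>m\<close> to the factor and the reflection
  contributes signs \<open>(- 1) ^ m\<close>, so the factor is a quasi-polynomial of period two.\<close>

definition quasi_poly :: "complex poly \<Rightarrow> complex poly \<Rightarrow> int \<Rightarrow> complex" where
  "quasi_poly p q m = poly (if even m then p else q) (of_int m)"

text \<open>The rational Dunkl operator \<open>\<partial> + (x / t) (1 - s)\<close> maps \<open>t ^ m\<close> to \<open>dunkl_bracket x m\<close> times
  \<open>t ^ (m - 1)\<close>. The recursion below says that \<open>t ^ m \<mapsto> \<sigma> m * t ^ (m - e)\<close> intertwines the Dunkl operators
  with parameters \<open>x\<close> and \<open>y\<close>.\<close>

definition dunkl_bracket :: "complex \<Rightarrow> int \<Rightarrow> complex" where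
  "dunkl_bracket x m = of_int m + (if even m then 0 else 2 * x)"

definition dunkl_recursion :: "complex \<Rightarrow> complex \<Rightarrow> int \<Rightarrow> (int \<Rightarrow> complex) \<Rightarrow> bool" where
  "dunkl_recursion x y e \<sigma> \<longleftrightarrow>
     (\<forall>m. \<sigma> (m - 1) * dunkl_bracket x m = dunkl_bracket y (m - e) * \<sigma> m)"

lemma poly_eq_0_if_progression:
  fixes p :: "complex poly"
  assumes "\<And>m::int. m \<ge> M \<Longrightarrow> even m = b \<Longrightarrow> poly p (of_int m) = 0"
  shows "p = 0"
proof (rule ccontr)
  assume "p \<noteq> 0"
  then have "finite {x. poly p x = 0}" by (rule poly_roots_finite)
  moreover have "(\<lambda>i::nat. of_int (2 * (\<bar>M\<bar> + int i) + (if b then 0 else 1))) ` UNIV \<subseteq> {x. poly p x = 0}"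
  proof (clarify)
    fix i :: nat
    let ?m = "2 * (\<bar>M\<bar> + int i) + (if b then 0 else 1)"
    have "?m \<ge> M" "even ?m = b" by auto
    then show "poly p (of_int ?m) = 0" by (rule assms)
  qed
  ultimately have "finite ((\<lambda>i::nat. of_int (2 * (\<bar>M\<bar> + int i) + (if b then 0 else 1)) :: complex) ` UNIV)"
    by (rule rev_finite_subset)
  then show False
    by (subst (asm) finite_image_iff) (auto intro!: injI simp del: of_int_add of_int_mult)
qed

lemma quasi_poly_eq_0:
  assumes "\<And>m. m \<ge> M \<Longrightarrow> quasi_poly p q m = 0"
  shows "p = 0" and "q = 0"
proof -
  show "p = 0"
  proof (rule poly_eq_0_if_progression[of M True])
    show "poly p (of_int m) = 0" if "m \<ge> M" "even m = True" for m
      using assms[of m] that by (simp add: quasi_poly_def)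
  qed
  show "q = 0"
  proof (rule poly_eq_0_if_progression[of M False])
    show "poly q (of_int m) = 0" if "m \<ge> M" "even m = False" for m
      using assms[of m] that by (simp add: quasi_poly_def)
  qed
qed

lemma dunkl_bracket_eventually_nonzero: "\<exists>M. \<forall>m\<ge>M. dunkl_bracket y m \<noteq> 0"
proof -
  have "dunkl_bracket y m \<noteq> 0" if "m \<ge> \<lfloor>norm (2 * y)\<rfloor> + 1" for m
  proof
    assume "dunkl_bracket y m = 0"
    then have "norm (of_int m :: complex) \<le> norm (2 * y)"
      by (auto simp: dunkl_bracket_def add_eq_0_iff2 split: if_splits)
    then have "of_int m \<le> norm (2 * y)" by simp
    then show False using that by linarith
  qed
  then show ?thesis by blast
qed

text \<open>Beyond the zeros of the bracket on the right the recursion propagates a zero of the solution to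
  all larger arguments, so the solution vanishes. The bound \<open>M\<close> depends on \<open>y\<close> and \<open>e\<close> only, which
  is what allows two solutions to be compared at one and the same argument.\<close>

lemma dunkl_recursion_vanishing:
  obtains M where
    "\<And>x p q m. dunkl_recursion x y e (quasi_poly p q) \<Longrightarrow> m \<ge> M \<Longrightarrow> quasi_poly p q m = 0 \<Longrightarrow>
       p = 0 \<and> q = 0"
proof -
  obtain M where M: "\<And>m. m \<ge> M \<Longrightarrow> dunkl_bracket y m \<noteq> 0"
    using dunkl_bracket_eventually_nonzero by blast
  show thesis
  proof (rule that[of "M + e"])
    fix x p q m
    assume rec: "dunkl_recursion x y e (quasi_poly p q)" and m: "m \<ge> M + e" "quasi_poly p q m = 0"
    have "quasi_poly p q i = 0" if "i \<ge> m" for i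
      using that
    proof (induction i rule: int_ge_induct)
      case (step i)
      have "0 = dunkl_bracket y (i + 1 - e) * quasi_poly p q (i + 1)"
        using rec step.IH unfolding dunkl_recursion_def by (metis add_diff_cancel_right' mult_zero_left)
      then show ?case using M[of "i + 1 - e"] step m by simp
    qed (use m in simp)
    then show "p = 0 \<and> q = 0" using quasi_poly_eq_0 by blast
  qed
qed

lemma dunkl_recursion_nonzero:
  assumes "dunkl_recursion x y e (quasi_poly p q)" and "p \<noteq> 0 \<or> q \<noteq> 0"
  shows "\<exists>M. \<forall>m\<ge>M. quasi_poly p q m \<noteq> 0"
  using dunkl_recursion_vanishing[of y e] assms by metis

text \<open>A combination of two solutions that vanishes at one large argument vanishes altogether.\<close>

lemma dunkl_recursion_unique:
  assumes rec: "dunkl_recursion x y e (quasi_poly p q)" "dunkl_recursion x y e (quasi_poly r s)"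
    and nz: "p \<noteq> 0 \<or> q \<noteq> 0"
  shows "\<exists>a. r = smult a p \<and> s = smult a q"
proof -
  obtain M where M: "\<And>x p q m. dunkl_recursion x y e (quasi_poly p q) \<Longrightarrow> m \<ge> M \<Longrightarrow>
      quasi_poly p q m = 0 \<Longrightarrow> p = 0 \<and> q = 0"
    using dunkl_recursion_vanishing by blast
  define a where "a = quasi_poly r s M / quasi_poly p q M"
  have qp: "quasi_poly (r - smult a p) (s - smult a q) m = quasi_poly r s m - a * quasi_poly p q m" for m
    by (simp add: quasi_poly_def)
  have "dunkl_recursion x y e (quasi_poly (r - smult a p) (s - smult a q))"
    using rec unfolding dunkl_recursion_def qp by (auto simp: algebra_simps)
  moreover have "quasi_poly p q M \<noteq> 0"
    using M[OF rec(1) order_refl] nz by blast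
  then have "quasi_poly (r - smult a p) (s - smult a q) M = 0"
    unfolding qp by (simp add: a_def)
  ultimately have "r - smult a p = 0 \<and> s - smult a q = 0" using M by blast
  then show ?thesis by auto
qed

lemma coeff_pcompose_shift:
  fixes p :: "complex poly"
  assumes "degree p \<le> Suc n"
  shows "coeff (pcompose p [:- a, 1:]) (Suc n) = coeff p (Suc n) \<and>
    coeff (pcompose p [:- a, 1:]) n = coeff p n - a * of_nat (Suc n) * coeff p (Suc n)"
  using assms
proof (induction n arbitrary: p)
  case 0
  obtain u r where r: "p = pCons u r" by (cases p)
  then have "degree r = 0" using 0 by (auto split: if_splits)
  then obtain v where "p = [:u, v:]" using r degree_0_id by metis
  then show ?case by (simp add: pcompose_pCons)
next
  case (Suc n)
  obtain u r where p: "p = pCons u r" by (cases p)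
  then have r: "degree r \<le> Suc n" using Suc.prems by (auto split: if_splits)
  have "coeff (pcompose r [:- a, 1:]) (Suc (Suc n)) = 0" "coeff r (Suc (Suc n)) = 0"
    using r degree_pcompose[of r "[:- a, 1:]"] by (auto intro!: coeff_eq_0)
  then show ?case
    using Suc.IH[OF r] by (cases n) (simp_all add: p pcompose_pCons algebra_simps)
qed

text \<open>Two steps of the recursion relate \<open>p (X - 2)\<close> to \<open>p\<close> with monic quadratic coefficients on both
  sides. The coefficient one below the top sees the degree of \<open>p\<close> through the shift of the
  argument, and comparing it on both sides determines the degree.\<close>

lemma dunkl_recursion_degree:
  assumes rec: "dunkl_recursion x (x + of_int d) e (quasi_poly p q)" and p: "p \<noteq> 0"
  shows "int (degree p) = e - d"
proof -
  define y where "y = x + of_int d"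
  \<comment> \<open>Exactly one of \<open>m - e\<close> and \<open>m - 1 - e\<close> is odd, so the product of their brackets is a monic
    quadratic polynomial; only its constant term \<open>b\<close> depends on the parity of \<open>e\<close>.\<close>
  define b where "b = (if even e then - of_int e * (2 * y - 1 - of_int e)
    else (2 * y - of_int e) * (- 1 - of_int e))"
  define Q where "Q = [:b, 2 * y - 2 * of_int e - 1, 1:]"
  define P where "P = [:0, 2 * x - 1, 1:]"
  have "poly (pcompose p [:- 2, 1:] * P - Q * p) (of_int m) = 0" if m: "even m = True" for m
  proof -
    have "dunkl_bracket x m = of_int m" "dunkl_bracket x (m - 1) = of_int m - 1 + 2 * x"
      using m by (auto simp: dunkl_bracket_def)
    then have 1: "quasi_poly p q (m - 1) * of_int m = dunkl_bracket y (m - e) * quasi_poly p q m"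
      and 2: "quasi_poly p q (m - 2) * (of_int m - 1 + 2 * x) =
        dunkl_bracket y (m - 1 - e) * quasi_poly p q (m - 1)"
      using rec[unfolded dunkl_recursion_def, folded y_def, rule_format, of m]
        rec[unfolded dunkl_recursion_def, folded y_def, rule_format, of "m - 1"] by simp_all
    have "dunkl_bracket y (m - e) * dunkl_bracket y (m - 1 - e) = poly Q (of_int m)"
      using m by (auto simp: dunkl_bracket_def Q_def b_def algebra_simps)
    then have "quasi_poly p q (m - 2) * poly P (of_int m) = poly Q (of_int m) * quasi_poly p q m"
    proof -
      have "quasi_poly p q (m - 2) * poly P (of_int m) =
          (quasi_poly p q (m - 2) * (of_int m - 1 + 2 * x)) * of_int m"
        by (simp add: P_def algebra_simps)
      also have "\<dots> = dunkl_bracket y (m - 1 - e) * (quasi_poly p q (m - 1) * of_int m)"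
        unfolding 2 by simp
      also have "\<dots> = (dunkl_bracket y (m - e) * dunkl_bracket y (m - 1 - e)) * quasi_poly p q m"
        unfolding 1 by simp
      finally show ?thesis using \<open>dunkl_bracket y (m - e) * dunkl_bracket y (m - 1 - e) = poly Q (of_int m)\<close>
        by simp
    qed
    then show ?thesis
      using m by (simp add: quasi_poly_def poly_pcompose algebra_simps)
  qed
  then have eq: "pcompose p [:- 2, 1:] * P = Q * p"
    using poly_eq_0_if_progression[of 0 True "pcompose p [:- 2, 1:] * P - Q * p"] by auto
  show ?thesis
  proof (cases "degree p")
    case 0
    then obtain a where "p = [:a:]" by (rule degree_eq_zeroE)
    with p have a: "p = [:a:]" "a \<noteq> 0" by simp_all
    from arg_cong[OF eq, of "\<lambda>r. coeff r 1"] have "2 * x - 1 = 2 * y - 2 * of_int e - 1"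
      using a by (simp add: P_def Q_def)
    then have "(of_int d :: complex) = of_int e" by (simp add: y_def)
    then show ?thesis using 0 by simp
  next
    case (Suc n)
    let ?p = "pcompose p [:- 2, 1:]"
    have c: "coeff ?p (Suc n) = coeff p (Suc n)"
        "coeff ?p n = coeff p n - 2 * of_nat (Suc n) * coeff p (Suc n)"
      using coeff_pcompose_shift[of p n 2, OF eq_refl[OF Suc]] by blast+
    have nz: "coeff p (Suc n) \<noteq> 0" unfolding Suc[symmetric] using p by simp
    have z: "coeff p (Suc (Suc n)) = 0" using Suc by (intro coeff_eq_0) simp
    have "coeff (?p * P) (Suc (Suc n)) = coeff ?p n + (2 * x - 1) * coeff ?p (Suc n)"
      by (simp add: P_def mult_pCons_right)
    moreover have "coeff (?p * P) (Suc (Suc n)) = coeff (Q * p) (Suc (Suc n))"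
      by (simp only: eq)
    moreover have "coeff (Q * p) (Suc (Suc n)) =
        coeff p n + (2 * y - 2 * of_int e - 1) * coeff p (Suc n)"
      by (simp add: Q_def mult_pCons_left z)
    ultimately have "(2 * x - 1 - 2 * of_nat (Suc n)) * coeff p (Suc n) =
        (2 * y - 2 * of_int e - 1) * coeff p (Suc n)"
      unfolding c by algebra
    then have "2 * x - 1 - 2 * of_nat (Suc n) = 2 * y - 2 * of_int e - 1" using nz by simp
    then have "2 * of_nat (Suc n) = 2 * (of_int e - of_int d :: complex)"
      unfolding y_def by algebra
    then have "of_nat (Suc n) = (of_int e - of_int d :: complex)"
      by (rule mult_left_cancel[THEN iffD1, rotated]) simp
    then have "(of_int (int (Suc n)) :: complex) = of_int (e - d)"
      by simp
    then show ?thesis unfolding of_int_eq_iff Suc .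
  qed
qed

text \<open>The hypothesis lists \<open>nat ((e + 1) div 2)\<close> distinct roots.\<close>

lemma even_zeros_le_degree:
  fixes p :: "complex poly"
  assumes "p \<noteq> 0" and "\<And>m. 0 \<le> m \<Longrightarrow> m < e \<Longrightarrow> even m \<Longrightarrow> poly p (of_int m) = 0"
  shows "e \<le> 2 * int (degree p)"
proof -
  let ?k = "nat ((e + 1) div 2)"
  have "(\<lambda>i. of_int (2 * int i)) ` {..<?k} \<subseteq> {x. poly p x = 0}"
    using assms(2) by (force simp del: of_int_mult)
  then have "card ((\<lambda>i. of_int (2 * int i) :: complex) ` {..<?k}) \<le> degree p"
    using card_poly_roots_bound[OF assms(1)] poly_roots_finite[OF assms(1)]
    by (meson card_mono order_trans)
  then have "?k \<le> degree p"
    by (subst (asm) card_image) (auto intro!: inj_onI simp del: of_int_mult)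
  then show ?thesis by linarith
qed

text \<open>The degree \<open>e - d\<close> is at least half of \<open>e\<close> because of the even zeros below \<open>e\<close>.\<close>

lemma dunkl_recursion_regular:
  assumes rec: "dunkl_recursion x (x + of_int d) e (quasi_poly p q)" and p: "p \<noteq> 0"
    and regular: "\<And>m. 0 \<le> m \<Longrightarrow> m < e \<Longrightarrow> quasi_poly p q m = 0"
  shows "e \<ge> 2 * d"
proof -
  have "poly p (of_int m) = 0" if "0 \<le> m" "m < e" "even m" for m
    using regular[of m] that by (simp add: quasi_poly_def)
  then have "e \<le> 2 * int (degree p)" by (intro even_zeros_le_degree p)
  then show ?thesis using dunkl_recursion_degree[OF rec p] by linarith
qed

text \<open>A solution with \<open>e < 0\<close> would belong to an operator that raises the order of vanishing at the
  fixed point. Such operators exist only if the parameter \<open>x - 1 / 2\<close> passes from a non-negative to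
  a negative integer.\<close>

lemma dunkl_recursion_not_crossing:
  assumes rec: "dunkl_recursion x (x + of_int d) e (quasi_poly p q)" and p: "p \<noteq> 0"
    and nc: "\<not> crosses (x - 1 / 2) d"
  shows "e \<ge> 0"
proof (rule ccontr)
  assume e: "\<not> e \<ge> 0"
  obtain M where M: "\<And>m. m \<ge> M \<Longrightarrow> quasi_poly p q m \<noteq> 0"
    using dunkl_recursion_nonzero[OF rec] p by blast
  \<comment> \<open>At the first \<open>N \<ge> 0\<close> where the symbol does not vanish, the recursion forces a zero of the
    bracket at \<open>N - e > 0\<close>, which determines the shifted parameter; counting the even zeros below
    \<open>N\<close> against the degree \<open>e - d\<close> then shows that the unshifted one was non-negative.\<close>
  define N where "N = (LEAST n. quasi_poly p q (int n) \<noteq> 0)"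
  have "quasi_poly p q (int (nat \<bar>M\<bar>)) \<noteq> 0" by (rule M) simp
  then have N: "quasi_poly p q (int N) \<noteq> 0" unfolding N_def by (rule LeastI)
  have below: "quasi_poly p q m = 0" if "0 \<le> m" "m < int N" for m
    using not_less_Least[of "nat m" "\<lambda>n. quasi_poly p q (int n) \<noteq> 0"] that
    by (simp add: N_def nat_less_iff)
  have "quasi_poly p q (int N - 1) * dunkl_bracket x (int N) = 0"
    using below[of "int N - 1"] by (cases N) (simp_all add: dunkl_bracket_def)
  then have br: "dunkl_bracket (x + of_int d) (int N - e) = 0"
    using rec[unfolded dunkl_recursion_def, rule_format, of "int N"] N by simp
  have "(of_int (int N - e) :: complex) \<noteq> 0" unfolding of_int_eq_0_iff using e by linarith
  then have odd: "odd (int N - e)" and br': "of_int (int N - e) + 2 * (x + of_int d) = 0"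
    using br by (auto simp: dunkl_bracket_def split: if_splits simp del: of_int_diff)
  then obtain a where a: "int N - e = 2 * a + 1" by (elim oddE)
  have "x - 1 / 2 = of_int (- a - 1 - d)"
  proof -
    have "2 * (x - 1 / 2) = 2 * of_int (- a - 1 - d)"
      using br' unfolding a of_int_add of_int_mult of_int_diff of_int_minus by simp algebra
    then show ?thesis by (rule mult_left_cancel[THEN iffD1, rotated]) simp
  qed
  moreover have "int N \<le> 2 * (e - d)"
  proof -
    have "poly p (of_int m) = 0" if "0 \<le> m" "m < int N" "even m" for m
      using below[of m] that by (simp add: quasi_poly_def)
    then have "int N \<le> 2 * int (degree p)" by (intro even_zeros_le_degree p)
    then show ?thesis by (simp only: dunkl_recursion_degree[OF rec p])
  qed
  then have "0 \<le> - a - 1 - d" using a e by presburger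
  moreover have "- a - 1 - d + d < 0" using a e by presburger
  ultimately show False using nc unfolding crosses_def by blast
qed

section \<open>Symbols of operators\<close>

text \<open>The symbol \<open>\<sigma>\<close> is the action of \<open>S\<close> on leading terms at \<open>c\<close>. As leading terms may be zero,
  an operator with a symbol of order \<open>e\<close> has the zero symbol for every larger order.\<close>

definition has_symbol :: "complex \<Rightarrow> operator \<Rightarrow> int \<Rightarrow> (int \<Rightarrow> complex) \<Rightarrow> bool" where
  "has_symbol c S e \<sigma> \<longleftrightarrow>
     (\<forall>f m a. leads (expansion c f) m a \<longrightarrow> leads (expansion c (S f)) (m - e) (\<sigma> m * a))"

lemma has_symbol_id: "has_symbol c id 0 (\<lambda>_. 1)"
  by (simp add: has_symbol_def)

lemma has_symbol_comp:
  assumes "has_symbol c S e \<sigma>" "has_symbol c T e' \<tau>"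
  shows "has_symbol c (S \<circ> T) (e + e') (\<lambda>m. \<sigma> (m - e') * \<tau> m)"
  using assms unfolding has_symbol_def comp_def
  by (metis (no_types, lifting) diff_diff_eq add.commute mult.assoc)

lemma has_symbol_raise: "has_symbol c S e \<sigma> \<Longrightarrow> e < e' \<Longrightarrow> has_symbol c S e' (\<lambda>_. 0)"
  by (simp add: has_symbol_def leads_def)

lemma Delta_power_laurent:
  assumes "m \<ge> 0"
  shows "Delta powi m \<in> laurent_polys"
proof -
  have "to_fract (p ^ n) = to_fract p ^ n" for p :: laurent and n
    by (induction n) simp_all
  then show ?thesis
    using assms unfolding laurent_polys_def Delta_eq power_int_def by (metis rangeI)
qed

definition falling :: "nat \<Rightarrow> complex poly" where
  "falling j = (\<Prod>i<j. [:- of_nat i, 1:])"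

context
  fixes c :: complex
  assumes c: "c = 1 \<or> c = -1"
begin

lemma base_nonzero: "c \<noteq> 0"
  using c by auto

lemma has_symbol_add:
  "has_symbol c S e \<sigma> \<Longrightarrow> has_symbol c T e \<tau> \<Longrightarrow>
    has_symbol c (\<lambda>f. S f + T f) e (\<lambda>m. \<sigma> m + \<tau> m)"
  by (auto simp: has_symbol_def expansion_add base_nonzero distrib_right intro: leads_add)

lemma has_symbol_mult:
  assumes "leads (expansion c u) (- e) a"
  shows "has_symbol c (\<lambda>f. u * f) e (\<lambda>_. a)"
  unfolding has_symbol_def using leads_mult[OF assms]
  by (simp add: expansion_mult base_nonzero)

lemma has_symbol_const: "has_symbol c (\<lambda>f. const a * f) 0 (\<lambda>_. a)"
  by (rule has_symbol_mult) (simp add: expansion_const base_nonzero leads_def)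

lemma has_symbol_theta: "has_symbol c theta 1 of_int"
  unfolding has_symbol_def by (simp add: expansion_theta base_nonzero leads_deriv)

lemma has_symbol_reflection: "has_symbol c reflection 0 (\<lambda>m. (-1) powi m)"
  unfolding has_symbol_def by (simp add: expansion_reflection c leads_flip)

lemma leads_Delta: "leads (expansion c Delta) 1 (2 * c)"
proof -
  have "taylor c (p - q) = taylor c p - taylor c q" for p q
    using taylor_add[of c "p - q" q] by simp
  moreover have "inverse c = c" using c by auto
  ultimately have "expansion c Delta = fps_to_fls (fps_const c * (fps_exp 1 - fps_exp (- 1)))"
    unfolding Delta_eq by (simp del: to_fract_diff add: expansion_to_fract base_nonzero taylor_single power_int_minus
        right_diff_distrib)
  then show ?thesis by (auto simp: leads_def)
qed

text \<open>The powers of \<open>Delta\<close> realize a non-zero leading term in each degree; this is why a symbol is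
  determined by its operator.\<close>

lemma leads_Delta_power: "\<exists>a. a \<noteq> 0 \<and> leads (expansion c (Delta powi m)) m a"
proof -
  let ?D = "expansion c Delta"
  have nz: "?D \<noteq> 0" by (simp add: expansion_eq_0_iff base_nonzero)
  then have "fls_subdegree ?D = 1"
    using leads_Delta base_nonzero by (intro fls_subdegree_eqI) (auto simp: leads_def)
  have pow: "expansion c (Delta ^ n) = ?D ^ n" for n
    by (induction n) (simp_all add: expansion_mult base_nonzero)
  have "expansion c (Delta powi m) = ?D powi m"
    unfolding power_int_def
    by (simp add: pow expansion_inverse base_nonzero power_inverse)
  moreover have "fls_subdegree (?D powi m) = m"
    using \<open>fls_subdegree ?D = 1\<close> nz by simp
  moreover have "?D powi m \<noteq> 0" using nz by simp
  ultimately have "fls_nth (?D powi m) m \<noteq> 0"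
      and "leads (expansion c (Delta powi m)) m (fls_nth (?D powi m) m)"
    using nth_fls_subdegree_nonzero[of "?D powi m"]
    by (auto simp: leads_def intro: fls_eq0_below_subdegree)
  then show ?thesis by blast
qed

lemma has_symbol_unique:
  assumes "has_symbol c S e \<sigma>" "has_symbol c S e \<tau>"
  shows "\<sigma> = \<tau>"
proof
  fix m
  obtain a where "a \<noteq> 0" "leads (expansion c (Delta powi m)) m a"
    using leads_Delta_power by blast
  with assms have "\<sigma> m * a = \<tau> m * a" unfolding has_symbol_def leads_def by metis
  then show "\<sigma> m = \<tau> m" using \<open>a \<noteq> 0\<close> by simp
qed

lemma has_symbol_sum:
  assumes "\<And>j. j \<in> A \<Longrightarrow> has_symbol c (S j) e (\<sigma> j)" "finite A"
  shows "has_symbol c (\<lambda>f. \<Sum>j\<in>A. S j f) e (\<lambda>m. \<Sum>j\<in>A. \<sigma> j m)"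
  using assms(2,1)
proof (induction A rule: finite_induct)
  case empty
  show ?case by (simp add: has_symbol_def leads_def base_nonzero)
next
  case (insert j A)
  then show ?case using has_symbol_add by simp
qed

lemma has_symbol_theta_power: "has_symbol c (theta ^^ j) (int j) (\<lambda>m. poly (falling j) (of_int m))"
proof (induction j)
  case 0
  show ?case using has_symbol_id by (simp add: falling_def id_def)
next
  case (Suc j)
  from has_symbol_comp[OF has_symbol_theta this] show ?case
    by (simp add: falling_def mult_ac comp_def algebra_simps)
qed

text \<open>Evaluation at \<open>j\<close> kills the falling factorials of index larger than \<open>j\<close>, so the system of
  evaluations is triangular.\<close>

lemma falling_independent:
  assumes "(\<Sum>j\<le>n. smult (w j) (falling j)) = 0" and "j \<le> n"
  shows "w j = 0"
  using assms(2)
proof (induction j rule: less_induct)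
  case (less j)
  have "poly (falling i) (of_nat j) = 0" if "i > j" for i
    using that by (auto simp: falling_def poly_prod)
  then have "(\<Sum>i\<le>n. w i * poly (falling i) (of_nat j)) =
      (\<Sum>i\<in>{j}. w i * poly (falling i) (of_nat j))"
    using less by (intro sum.mono_neutral_right) (auto, metis linorder_neqE_nat)
  moreover have "poly (falling j) (of_nat j) \<noteq> 0"
    by (auto simp: falling_def poly_prod)
  ultimately show ?case
    using arg_cong[OF assms(1), of "\<lambda>p. poly p (of_nat j)"] by (simp add: poly_sum)
qed

lemma degree_falling: "degree (falling j) = j"
  unfolding falling_def by (subst degree_prod_eq_sum_degree) auto

lemma has_symbol_dr_op:
  assumes "\<And>j. j \<le> n \<Longrightarrow> leads (expansion c (a j)) (int j - e) (u j)"
    and "\<And>j. j \<le> n \<Longrightarrow> leads (expansion c (b j)) (int j - e) (v j)"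
  shows "has_symbol c (dr_op a b n) e
    (quasi_poly (\<Sum>j\<le>n. smult (u j + v j) (falling j)) (\<Sum>j\<le>n. smult (u j - v j) (falling j)))"
proof -
  have "has_symbol c (\<lambda>f. a j * (theta ^^ j) f + b j * (theta ^^ j) (reflection f)) e
      (\<lambda>m. u j * poly (falling j) (of_int m) + v j * poly (falling j) (of_int m) * (-1) powi m)"
    if "j \<le> n" for j
  proof (rule has_symbol_add)
    have 1: "has_symbol c (\<lambda>f. a j * f) (e - int j) (\<lambda>_. u j)"
      and 2: "has_symbol c (\<lambda>f. b j * f) (e - int j) (\<lambda>_. v j)"
      using assms that by (auto intro!: has_symbol_mult)
    from has_symbol_comp[OF 1 has_symbol_theta_power[of j]]
    show "has_symbol c (\<lambda>f. a j * (theta ^^ j) f) e (\<lambda>m. u j * poly (falling j) (of_int m))"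
      by (simp add: comp_def)
    from has_symbol_comp[OF has_symbol_comp[OF 2 has_symbol_theta_power[of j]] has_symbol_reflection]
    show "has_symbol c (\<lambda>f. b j * (theta ^^ j) (reflection f)) e
        (\<lambda>m. v j * poly (falling j) (of_int m) * (-1) powi m)"
      by (simp add: comp_def)
  qed
  then have "has_symbol c (dr_op a b n) e (\<lambda>m. \<Sum>j\<le>n. u j * poly (falling j) (of_int m)
      + v j * poly (falling j) (of_int m) * (-1) powi m)"
    unfolding dr_op_def[abs_def] by (intro has_symbol_sum) auto
  also have "(\<lambda>m. \<Sum>j\<le>n. u j * poly (falling j) (of_int m)
      + v j * poly (falling j) (of_int m) * (-1) powi m) =
    quasi_poly (\<Sum>j\<le>n. smult (u j + v j) (falling j)) (\<Sum>j\<le>n. smult (u j - v j) (falling j))"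
    by (auto simp: fun_eq_iff quasi_poly_def poly_sum power_int_minus_left algebra_simps)
  finally show ?thesis .
qed

text \<open>The even and the odd part of the symbol have the coefficients \<open>u j + v j\<close> and \<open>u j - v j\<close> in the basis
  of falling factorials, where \<open>u j\<close> and \<open>v j\<close> come from the terms without and with reflection.
  Independence of that basis shows that nothing cancels in the lowest degree.\<close>

lemma has_symbol_exists:
  assumes nz: "dr_op a b n \<noteq> (\<lambda>_. 0)"
  shows "\<exists>e p q. has_symbol c (dr_op a b n) e (quasi_poly p q) \<and> degree p \<le> n \<and> (p \<noteq> 0 \<or> q \<noteq> 0)"
proof -
  let ?A = "\<lambda>j. expansion c (a j)" and ?B = "\<lambda>j. expansion c (b j)"
  \<comment> \<open>A coefficient of \<open>theta ^^ j\<close> that starts in degree \<open>i\<close> lowers degrees by \<open>j - i\<close>; the order of the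
    symbol is the largest such drop.\<close>
  define X where "X = (\<lambda>j. int j - fls_subdegree (?A j)) ` {j. j \<le> n \<and> a j \<noteq> 0}
    \<union> (\<lambda>j. int j - fls_subdegree (?B j)) ` {j. j \<le> n \<and> b j \<noteq> 0}"
  have "finite X" by (simp add: X_def)
  moreover have "X \<noteq> {}"
  proof
    assume "X = {}"
    then have "dr_op a b n f = 0" for f by (auto simp: X_def dr_op_def)
    then show False using nz by auto
  qed
  ultimately have Max: "Max X \<in> X" "\<And>x. x \<in> X \<Longrightarrow> x \<le> Max X" by auto
  define e where "e = Max X"
  define u where "u j = fls_nth (?A j) (int j - e)" for j
  define v where "v j = fls_nth (?B j) (int j - e)" for j
  define p where "p = (\<Sum>j\<le>n. smult (u j + v j) (falling j))"
  define q where "q = (\<Sum>j\<le>n. smult (u j - v j) (falling j))"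
  have "leads (?A j) (int j - e) (u j)" if "j \<le> n" for j
  proof (cases "a j = 0")
    case False
    then have "int j - fls_subdegree (?A j) \<le> e" using that Max(2) by (auto simp: e_def X_def)
    then show ?thesis by (auto simp: leads_def u_def intro!: fls_eq0_below_subdegree)
  qed (simp add: leads_def u_def base_nonzero)
  moreover have "leads (?B j) (int j - e) (v j)" if "j \<le> n" for j
  proof (cases "b j = 0")
    case False
    then have "int j - fls_subdegree (?B j) \<le> e" using that Max(2) by (auto simp: e_def X_def)
    then show ?thesis by (auto simp: leads_def v_def intro!: fls_eq0_below_subdegree)
  qed (simp add: leads_def v_def base_nonzero)
  ultimately have "has_symbol c (dr_op a b n) e (quasi_poly p q)"
    unfolding p_def q_def by (rule has_symbol_dr_op)
  moreover have "degree p \<le> n"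
    unfolding p_def by (intro degree_sum_le) (auto simp: degree_falling intro: order_trans[OF degree_smult_le])
  moreover have "p \<noteq> 0 \<or> q \<noteq> 0"
  proof (rule ccontr)
    assume "\<not> (p \<noteq> 0 \<or> q \<noteq> 0)"
    then have "u j + v j = 0" "u j - v j = 0" if "j \<le> n" for j
      using falling_independent[of "\<lambda>j. u j + v j" n j] falling_independent[of "\<lambda>j. u j - v j" n j] that
      by (auto simp: p_def q_def)
    then have 0: "u j = 0" "v j = 0" if "j \<le> n" for j
      using that by (simp_all add: eq_iff_diff_eq_0[symmetric])
    from Max(1) obtain j where j: "j \<le> n"
      "a j \<noteq> 0 \<and> e = int j - fls_subdegree (?A j) \<or> b j \<noteq> 0 \<and> e = int j - fls_subdegree (?B j)"
      by (auto simp: X_def e_def)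
    then have "u j \<noteq> 0 \<or> v j \<noteq> 0"
      by (auto simp: u_def v_def expansion_eq_0_iff base_nonzero)
    then show False using 0 j by blast
  qed
  ultimately show ?thesis by blast
qed

end

section \<open>First-order operators\<close>

definition inv_Delta :: ratfun where
  "inv_Delta = inverse Delta"

lemma Z_inv_Z: "Z * inverse Z = 1"
  by simp

lemma inv_Delta_Delta: "inv_Delta * (Z - inverse Z) = 1"
  by (simp add: inv_Delta_def flip: Delta_def)

lemma theta_of_nat [simp]: "theta (of_nat n) = 0"
  by (induction n) (simp_all add: theta_add)

lemma reflection_of_nat [simp]: "reflection (of_nat n) = of_nat n"
  by (induction n) (simp_all add: reflection_add)

lemma theta_numeral [simp]: "theta (numeral n) = 0"
  by (metis of_nat_numeral theta_of_nat)

lemma reflection_numeral [simp]: "reflection (numeral n) = numeral n"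
  by (metis of_nat_numeral reflection_of_nat)

lemma theta_diff: "theta (p - q) = theta p - theta q"
  using theta_add[of p "- q"] by (simp add: theta_minus)

lemma reflection_diff: "reflection (p - q) = reflection p - reflection q"
  using reflection_add[of p "- q"] by (simp add: reflection_minus)

lemma reflection_inverse: "reflection (inverse p) = inverse (reflection p)"
proof (cases "p = 0")
  case False
  then have "reflection p * reflection (inverse p) = 1"
    by (metis reflection_1 reflection_mult right_inverse)
  then show ?thesis by (metis inverse_unique)
qed simp

lemma theta_inverse: "theta (inverse p) = - theta p * inverse p * inverse p"
proof (cases "p = 0")
  case False
  have "theta p * inverse p + p * theta (inverse p) = 0"
    using False theta_mult[of p "inverse p"] by simp
  then have "inverse p * (theta p * inverse p + p * theta (inverse p)) = 0" by simp
  moreover have "inverse p * p = 1" using False by simp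
  ultimately show ?thesis by algebra
qed simp

lemma theta_inv_Delta: "theta inv_Delta = - (Z + inverse Z) * inv_Delta * inv_Delta"
  by (simp add: inv_Delta_def theta_inverse theta_Delta)

lemma reflection_inv_Delta: "reflection inv_Delta = - inv_Delta"
  by (simp add: inv_Delta_def reflection_inverse reflection_Delta)

lemma reflection_reflection [simp]: "reflection (reflection p) = p"
  by (cases p) (simp add: reflection_Fract)

lemma reflection_theta: "reflection (theta p) = - theta (reflection p)"
proof (cases p)
  case (Fract a b)
  have 1: "laurent_refl (laurent_theta q) = - laurent_theta (laurent_refl q)" for q
    by (rule poly_mapping_eqI) (simp add: laurent_refl.rep_eq laurent_theta.rep_eq)
  have 2: "laurent_refl (q - r) = laurent_refl q - laurent_refl r" for q r
    using laurent_refl_add[of "q - r" r] by simp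
  show ?thesis using Fract
    by (simp add: theta_Fract reflection_Fract laurent_refl_mult 1 2 algebra_simps)
qed

definition first_order :: "ratfun \<Rightarrow> ratfun \<Rightarrow> ratfun \<Rightarrow> operator" where
  "first_order u v x f = u * theta f + v * f + x * reflection f"

lemma first_order_comp:
  "first_order u v x (first_order u' v' x' f) =
     u * u' * theta (theta f)
     + (u * theta u' + u * v' + v * u') * theta f
     + (u * theta v' + v * v' + x * reflection x') * f
     + (u * x' - x * reflection u') * theta (reflection f)
     + (u * theta x' + v * x' + x * reflection v') * reflection f"
  by (simp add: first_order_def theta_add theta_mult reflection_add reflection_mult
      reflection_theta algebra_simps)

text \<open>The operators \<open>theta \<circ> theta\<close>, \<open>theta\<close>, \<open>id\<close>, \<open>theta \<circ> reflection\<close> and \<open>reflection\<close> span the composites of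
  first-order operators of this form, so that an identity between two composites amounts to five identities
  between rational functions.\<close>

lemma first_order_comp_eqI:
  assumes "u * u' = p * p'"
    and "u * theta u' + u * v' + v * u' = p * theta p' + p * q' + q * p'"
    and "u * theta v' + v * v' + x * reflection x' = p * theta q' + q * q' + r * reflection r'"
    and "u * x' - x * reflection u' = p * r' - r * reflection p'"
    and "u * theta x' + v * x' + x * reflection v' = p * theta r' + q * r' + r * reflection q'"
  shows "first_order u v x \<circ> first_order u' v' x' = first_order p q r \<circ> first_order p' q' r'"
  by (rule ext) (simp only: comp_apply first_order_comp assms)

text \<open>The Cherednik operator and the fundamental shift operators in the form \<open>first_order\<close>, with
  coefficients written as polynomials in \<open>Z\<close>, \<open>1 / Z\<close> and \<open>1 / Delta\<close>. The
  parameters \<open>k1\<close> and \<open>k2\<close> are elements of the field, so that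
  identities between the coefficients become polynomial identities modulo the relations
  \<open>Z * (1 / Z) = 1\<close> and \<open>(1 / Delta) * (Z - 1 / Z) = 1\<close>.\<close>

definition cherednik_form :: "ratfun \<Rightarrow> ratfun \<Rightarrow> operator" where
  "cherednik_form k1 k2 = first_order 1
     (k1 * (Z + 1) * inv_Delta + 2 * k2 * Z * inv_Delta - const (1 / 2) * k1 - k2)
     (- (k1 * (Z + 1) * inv_Delta + 2 * k2 * Z * inv_Delta))"

definition G_0_1_form :: operator where
  "G_0_1_form = first_order inv_Delta (- (Z * inv_Delta * inv_Delta)) (Z * inv_Delta * inv_Delta)"

definition G_0_m1_form :: "ratfun \<Rightarrow> ratfun \<Rightarrow> operator" where
  "G_0_m1_form k1 k2 = first_order (Z - inverse Z)
     ((k1 + 2 * k2 - 1) * (Z + inverse Z) + 2 * k1 + inverse Z) (- Z)"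

definition G_2_m1_form :: "ratfun \<Rightarrow> operator" where
  "G_2_m1_form k2 = first_order ((Z + inverse Z + 2) * inv_Delta)
     (k2 - const (1 / 2) - (Z + inverse Z + 2) * inv_Delta * inv_Delta)
     ((Z + inverse Z + 2) * inv_Delta * inv_Delta)"

definition G_m2_1_form :: "ratfun \<Rightarrow> ratfun \<Rightarrow> operator" where
  "G_m2_1_form k1 k2 = first_order ((Z + inverse Z - 2) * inv_Delta)
     (k1 + k2 - const (1 / 2) + (Z + inverse Z - 2) * inv_Delta * inv_Delta)
     (- ((Z + inverse Z - 2) * inv_Delta * inv_Delta))"

lemmas form_defs = cherednik_form_def G_0_1_form_def G_0_m1_form_def G_2_m1_form_def G_m2_1_form_def

lemmas derivation_simps = theta_add theta_diff theta_minus theta_mult theta_Z theta_inv_Delta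
  reflection_add reflection_diff reflection_minus reflection_mult reflection_Z reflection_inv_Delta
  theta_const theta_numeral theta_1 theta_0 reflection_const reflection_numeral reflection_1

lemma const_half: "2 * const (1 / 2) = 1"
proof -
  have "const (1 / 2) + const (1 / 2) = 1"
    unfolding const_simps(3)[symmetric] by (simp add: const_simps)
  then show ?thesis by simp
qed

context
  fixes k1 k2 :: ratfun
  assumes k: "theta k1 = 0" "theta k2 = 0" "reflection k1 = k1" "reflection k2 = k2"
begin

lemma G_0_1_intertwines:
  "G_0_1_form \<circ> cherednik_form k1 k2 = cherednik_form k1 (k2 + 1) \<circ> G_0_1_form"
  unfolding form_defs
  by (rule first_order_comp_eqI; (simp only: derivation_simps k)?;
     (algebra | use Z_inv_Z inv_Delta_Delta const_half in algebra))

lemma G_0_m1_intertwines: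
  "G_0_m1_form k1 k2 \<circ> cherednik_form k1 k2 = cherednik_form k1 (k2 - 1) \<circ> G_0_m1_form k1 k2"
  unfolding form_defs
  by (rule first_order_comp_eqI; (simp only: derivation_simps k)?;
     (algebra | use Z_inv_Z inv_Delta_Delta const_half in algebra))

lemma G_2_m1_intertwines:
  "G_2_m1_form k2 \<circ> cherednik_form k1 k2 = cherednik_form (k1 + 2) (k2 - 1) \<circ> G_2_m1_form k2"
  unfolding form_defs
  by (rule first_order_comp_eqI; (simp only: derivation_simps k)?;
     (algebra | use Z_inv_Z inv_Delta_Delta const_half in algebra))

lemma G_m2_1_intertwines:
  "G_m2_1_form k1 k2 \<circ> cherednik_form k1 k2 = cherednik_form (k1 - 2) (k2 + 1) \<circ> G_m2_1_form k1 k2"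
  unfolding form_defs
  by (rule first_order_comp_eqI; (simp only: derivation_simps k)?;
     (algebra | use Z_inv_Z inv_Delta_Delta const_half in algebra))

lemma G_0_1_G_2_m1_commute:
  "G_0_1_form \<circ> G_2_m1_form k2 = G_2_m1_form (k2 + 1) \<circ> G_0_1_form"
  unfolding form_defs
  by (rule first_order_comp_eqI; (simp only: derivation_simps k)?;
     (algebra | use Z_inv_Z inv_Delta_Delta const_half in algebra))

lemma G_0_1_G_m2_1_commute:
  "G_0_1_form \<circ> G_m2_1_form k1 k2 = G_m2_1_form k1 (k2 + 1) \<circ> G_0_1_form"
  unfolding form_defs
  by (rule first_order_comp_eqI; (simp only: derivation_simps k)?;
     (algebra | use Z_inv_Z inv_Delta_Delta const_half in algebra))

lemma G_0_m1_G_2_m1_commute: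
  "G_0_m1_form (k1 + 2) (k2 - 1) \<circ> G_2_m1_form k2 = G_2_m1_form (k2 - 1) \<circ> G_0_m1_form k1 k2"
  unfolding form_defs
  by (rule first_order_comp_eqI; (simp only: derivation_simps k)?;
     (algebra | use Z_inv_Z inv_Delta_Delta const_half in algebra))

lemma G_0_m1_G_m2_1_commute:
  "G_0_m1_form (k1 - 2) (k2 + 1) \<circ> G_m2_1_form k1 k2 = G_m2_1_form k1 (k2 - 1) \<circ> G_0_m1_form k1 k2"
  unfolding form_defs
  by (rule first_order_comp_eqI; (simp only: derivation_simps k)?;
     (algebra | use Z_inv_Z inv_Delta_Delta const_half in algebra))

end

section \<open>Differential-reflection operators of bounded order\<close>

lemma laurent_polys_I: "to_fract p \<in> laurent_polys"
  by (simp add: laurent_polys_def)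

lemma laurent_polys_closed:
  assumes "f \<in> laurent_polys" "g \<in> laurent_polys"
  shows laurent_polys_add: "f + g \<in> laurent_polys"
    and laurent_polys_diff: "f - g \<in> laurent_polys"
    and laurent_polys_mult: "f * g \<in> laurent_polys"
  using assms by (auto simp: laurent_polys_def simp flip: to_fract_add to_fract_diff to_fract_mult)

lemma laurent_polys_unary:
  assumes "f \<in> laurent_polys"
  shows laurent_polys_theta: "theta f \<in> laurent_polys"
    and laurent_polys_reflection: "reflection f \<in> laurent_polys"
    and laurent_polys_minus: "- f \<in> laurent_polys"
  using assms by (auto simp: laurent_polys_def theta_to_fract reflection_to_fract
      simp flip: to_fract_uminus)

lemma laurent_polys_const: "const a \<in> laurent_polys"
  by (simp add: const_def laurent_polys_I)

lemma laurent_polys_0: "0 \<in> laurent_polys" and laurent_polys_1: "1 \<in> laurent_polys"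
  using laurent_polys_const[of 0] laurent_polys_const[of 1] by (simp_all add: const_simps)

lemma laurent_polys_numeral: "numeral n \<in> laurent_polys"
proof -
  have "of_nat m \<in> laurent_polys" for m
    by (induction m) (simp_all add: laurent_polys_0 laurent_polys_1 laurent_polys_add)
  then show ?thesis by (metis of_nat_numeral)
qed

lemma laurent_polys_Z: "Z \<in> laurent_polys" "inverse Z \<in> laurent_polys"
  unfolding Z_inverse by (simp_all add: Z_def laurent_polys_I)

lemma laurent_polys_Delta: "Delta \<in> laurent_polys"
  unfolding Delta_def by (intro laurent_polys_diff laurent_polys_Z)

lemmas laurent_polys_intros = laurent_polys_add laurent_polys_diff laurent_polys_mult
  laurent_polys_theta laurent_polys_reflection laurent_polys_minus laurent_polys_const
  laurent_polys_0 laurent_polys_1 laurent_polys_numeral laurent_polys_Z laurent_polys_Delta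

lemma laurent_polys_power: "f \<in> laurent_polys \<Longrightarrow> f ^ n \<in> laurent_polys"
  by (induction n) (auto intro: laurent_polys_intros)

lemma localizedI: "f \<in> laurent_polys \<Longrightarrow> f / Delta ^ n \<in> laurent_localized"
  by (auto simp: laurent_localized_def)

lemma localized_laurent: "f \<in> laurent_polys \<Longrightarrow> f \<in> laurent_localized"
  using localizedI[of f 0] by simp

lemma localized_inv_Delta: "inv_Delta \<in> laurent_localized"
  using localizedI[OF laurent_polys_1, of 1] by (simp add: inv_Delta_def inverse_eq_divide)

lemma localized_add:
  assumes "p \<in> laurent_localized" "q \<in> laurent_localized"
  shows "p + q \<in> laurent_localized"
proof -
  obtain f m g n where "p = f / Delta ^ m" "f \<in> laurent_polys" "q = g / Delta ^ n" "g \<in> laurent_polys"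
    using assms by (auto simp: laurent_localized_def)
  moreover from this have "p + q = (f * Delta ^ n + g * Delta ^ m) / Delta ^ (m + n)"
    by (simp add: add_frac_eq power_add)
  ultimately show ?thesis
    by (auto intro!: localizedI laurent_polys_intros laurent_polys_power)
qed

lemma localized_mult:
  assumes "p \<in> laurent_localized" "q \<in> laurent_localized"
  shows "p * q \<in> laurent_localized"
proof -
  obtain f m g n where "p = f / Delta ^ m" "f \<in> laurent_polys" "q = g / Delta ^ n" "g \<in> laurent_polys"
    using assms by (auto simp: laurent_localized_def)
  moreover from this have "p * q = (f * g) / Delta ^ (m + n)"
    by (simp add: power_add)
  ultimately show ?thesis by (metis localizedI laurent_polys_mult)
qed

lemma localized_minus: "p \<in> laurent_localized \<Longrightarrow> - p \<in> laurent_localized"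
  using localized_mult[of "- 1" p] localized_laurent[OF laurent_polys_minus[OF laurent_polys_1]]
  by simp

lemma localized_diff:
  "p \<in> laurent_localized \<Longrightarrow> q \<in> laurent_localized \<Longrightarrow> p - q \<in> laurent_localized"
  using localized_add[of p "- q"] localized_minus[of q] by simp

lemma localized_inverse_power: "inverse (Delta ^ n) \<in> laurent_localized"
  using localizedI[OF laurent_polys_1, of n] by (simp add: inverse_eq_divide)

lemma localized_theta:
  assumes "p \<in> laurent_localized"
  shows "theta p \<in> laurent_localized"
proof -
  obtain f n where p: "p = f / Delta ^ n" "f \<in> laurent_polys"
    using assms by (auto simp: laurent_localized_def)
  have "theta p = theta f * inverse (Delta ^ n)
      + f * (- theta (Delta ^ n) * inverse (Delta ^ n) * inverse (Delta ^ n))"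
    by (simp add: p divide_inverse theta_mult theta_inverse)
  moreover have "theta f \<in> laurent_localized" "f \<in> laurent_localized"
      "theta (Delta ^ n) \<in> laurent_localized"
    using p(2) by (simp_all add: localized_laurent laurent_polys_theta laurent_polys_power
        laurent_polys_Delta)
  ultimately show ?thesis
    by (metis localized_add localized_mult localized_minus localized_inverse_power)
qed

lemma localized_reflection:
  assumes "p \<in> laurent_localized"
  shows "reflection p \<in> laurent_localized"
proof -
  obtain f n where p: "p = f / Delta ^ n" "f \<in> laurent_polys"
    using assms by (auto simp: laurent_localized_def)
  have "reflection (Delta ^ n) = (- 1) ^ n * Delta ^ n"
    by (induction n) (simp_all add: reflection_mult reflection_Delta)
  then have "reflection p = reflection f * inverse ((- 1) ^ n * Delta ^ n)"
    by (simp only: p divide_inverse reflection_mult reflection_inverse)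
  also have "\<dots> = ((- 1) ^ n * reflection f) * inverse (Delta ^ n)"
    by (cases "even n") simp_all
  finally show ?thesis
    using p(2) by (metis localized_mult localized_inverse_power localized_laurent
      laurent_polys_power laurent_polys_mult laurent_polys_minus laurent_polys_1
      laurent_polys_reflection)
qed

lemma localized_sign: "p \<in> laurent_localized \<Longrightarrow> (- 1) ^ n * p \<in> laurent_localized"
  by (simp add: localized_mult localized_laurent laurent_polys_power laurent_polys_minus
      laurent_polys_1)

text \<open>Elements are kept together with a bound on their order in \<open>theta\<close>. It suffices to show that composition
  with a first-order operator from the left stays inside: composites with powers of the
  Cherednik operator on the right can be rewritten by the intertwining relation.\<close>

definition operators_le :: "nat \<Rightarrow> operator set" where
  "operators_le n =
     {dr_op a b n | a b. (\<forall>j. a j \<in> laurent_localized) \<and> (\<forall>j. b j \<in> laurent_localized)}"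

lemma diff_refl_operators_eq: "diff_refl_operators = (\<Union>n. operators_le n)"
  by (auto simp: diff_refl_operators_def operators_le_def)

lemma operators_leI:
  assumes "\<And>f. S f = (\<Sum>j\<le>n. a j * (theta ^^ j) f + b j * (theta ^^ j) (reflection f))"
    and "\<And>j. a j \<in> laurent_localized" "\<And>j. b j \<in> laurent_localized"
  shows "S \<in> operators_le n"
proof -
  have "S = dr_op a b n" using assms(1) by (auto simp: dr_op_def)
  then show ?thesis using assms(2,3) by (auto simp: operators_le_def)
qed

lemma operators_leE:
  assumes "S \<in> operators_le n"
  obtains a b where "S = dr_op a b n" "\<And>j. a j \<in> laurent_localized" "\<And>j. b j \<in> laurent_localized"
  using assms by (auto simp: operators_le_def)

lemma localized_0: "0 \<in> laurent_localized"
  by (intro localized_laurent laurent_polys_0)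

lemma operators_le_id: "id \<in> operators_le 0"
  by (rule operators_leI[where a = "\<lambda>_. 1" and b = "\<lambda>_. 0"])
    (auto intro: localized_laurent laurent_polys_intros)

lemma operators_le_add:
  assumes "S \<in> operators_le n" "T \<in> operators_le n"
  shows "(\<lambda>f. S f + T f) \<in> operators_le n"
proof -
  obtain a b a' b' where "S = dr_op a b n" "T = dr_op a' b' n"
    "\<And>j. a j \<in> laurent_localized" "\<And>j. b j \<in> laurent_localized"
    "\<And>j. a' j \<in> laurent_localized" "\<And>j. b' j \<in> laurent_localized"
    using assms by (auto elim!: operators_leE)
  then show ?thesis
    by (intro operators_leI[where a = "\<lambda>j. a j + a' j" and b = "\<lambda>j. b j + b' j"])
      (auto simp: dr_op_def sum.distrib algebra_simps intro: localized_add)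
qed

lemma operators_le_mult:
  assumes "S \<in> operators_le n" "u \<in> laurent_localized"
  shows "(\<lambda>f. u * S f) \<in> operators_le n"
proof -
  obtain a b where "S = dr_op a b n"
    "\<And>j. a j \<in> laurent_localized" "\<And>j. b j \<in> laurent_localized"
    using assms(1) by (auto elim!: operators_leE)
  then show ?thesis using assms(2)
    by (intro operators_leI[where a = "\<lambda>j. u * a j" and b = "\<lambda>j. u * b j"])
      (auto simp: dr_op_def sum_distrib_left algebra_simps intro: localized_mult)
qed

lemma operators_le_mono:
  assumes "S \<in> operators_le m" "m \<le> n"
  shows "S \<in> operators_le n"
proof -
  obtain a b where S: "S = dr_op a b m"
    "\<And>j. a j \<in> laurent_localized" "\<And>j. b j \<in> laurent_localized"
    using assms(1) by (auto elim!: operators_leE)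
  let ?a = "\<lambda>j. if j \<le> m then a j else 0" and ?b = "\<lambda>j. if j \<le> m then b j else 0"
  have "dr_op a b m f = (\<Sum>j\<le>n. ?a j * (theta ^^ j) f + ?b j * (theta ^^ j) (reflection f))" for f
    unfolding dr_op_def using assms(2) by (intro sum.mono_neutral_cong_left) auto
  then show ?thesis
    by (intro operators_leI[where a = ?a and b = ?b]) (auto simp: S localized_0)
qed

lemma theta_sum: "theta (sum g A) = (\<Sum>x\<in>A. theta (g x))"
  by (induction A rule: infinite_finite_induct) (simp_all add: theta_add)

lemma reflection_sum: "reflection (sum g A) = (\<Sum>x\<in>A. reflection (g x))"
  by (induction A rule: infinite_finite_induct) (simp_all add: reflection_add)

lemma operators_le_theta:
  assumes "S \<in> operators_le n"
  shows "(\<lambda>f. theta (S f)) \<in> operators_le (Suc n)"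
proof -
  obtain a b where S: "S = dr_op a b n"
    "\<And>j. a j \<in> laurent_localized" "\<And>j. b j \<in> laurent_localized"
    using assms(1) by (auto elim!: operators_leE)
  have "(\<lambda>f. \<Sum>j\<le>n. theta (a j) * (theta ^^ j) f + theta (b j) * (theta ^^ j) (reflection f))
      \<in> operators_le n"
    by (rule operators_leI[where a = "\<lambda>j. theta (a j)" and b = "\<lambda>j. theta (b j)"])
      (auto simp: S localized_theta)
  moreover have "(\<lambda>f. \<Sum>j\<le>n. a j * (theta ^^ Suc j) f + b j * (theta ^^ Suc j) (reflection f))
      \<in> operators_le (Suc n)"
  proof (rule operators_leI)
    show "(\<Sum>j\<le>n. a j * (theta ^^ Suc j) f + b j * (theta ^^ Suc j) (reflection f)) =
        (\<Sum>j\<le>Suc n. (if j = 0 then 0 else a (j - 1)) * (theta ^^ j) f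
          + (if j = 0 then 0 else b (j - 1)) * (theta ^^ j) (reflection f))" for f
      unfolding sum.atMost_Suc_shift by simp
  qed (simp_all add: S localized_0)
  moreover have "theta (S f) =
      (\<Sum>j\<le>n. theta (a j) * (theta ^^ j) f + theta (b j) * (theta ^^ j) (reflection f)) +
      (\<Sum>j\<le>n. a j * (theta ^^ Suc j) f + b j * (theta ^^ Suc j) (reflection f))" for f
    by (simp add: S dr_op_def theta_sum theta_add theta_mult sum.distrib algebra_simps)
  ultimately show ?thesis
    using operators_le_add operators_le_mono[of _ n "Suc n"] by simp
qed

lemma operators_le_reflection:
  assumes "S \<in> operators_le n"
  shows "(\<lambda>f. reflection (S f)) \<in> operators_le n"
proof -
  obtain a b where S: "S = dr_op a b n"
    "\<And>j. a j \<in> laurent_localized" "\<And>j. b j \<in> laurent_localized"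
    using assms(1) by (auto elim!: operators_leE)
  have pow: "reflection ((theta ^^ j) f) = (- 1) ^ j * (theta ^^ j) (reflection f)" for j f
  proof (induction j)
    case (Suc j)
    have "theta ((- 1) ^ j * g) = (- 1) ^ j * theta g" for g
      by (cases "even j") (simp_all add: theta_minus)
    then show ?case using Suc by (simp add: reflection_theta)
  qed simp
  show ?thesis
  proof (rule operators_leI)
    show "reflection (S f) = (\<Sum>j\<le>n. (- 1) ^ j * reflection (b j) * (theta ^^ j) f
        + (- 1) ^ j * reflection (a j) * (theta ^^ j) (reflection f))" for f
      unfolding S(1) dr_op_def reflection_sum reflection_add reflection_mult pow
        reflection_reflection
      by (rule sum.cong) (simp_all only: ac_simps)
  qed (simp_all add: S localized_sign localized_reflection)
qed

lemma first_order_comp_le: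
  assumes "S \<in> operators_le n"
    and "u \<in> laurent_localized" "v \<in> laurent_localized" "x \<in> laurent_localized"
  shows "first_order u v x \<circ> S \<in> operators_le (Suc n)"
proof -
  have "(\<lambda>f. u * theta (S f)) \<in> operators_le (Suc n)"
    by (rule operators_le_mult[OF operators_le_theta[OF assms(1)] assms(2)])
  moreover have "(\<lambda>f. v * S f) \<in> operators_le (Suc n)"
    by (rule operators_le_mult[OF operators_le_mono[OF assms(1)] assms(3)]) simp
  moreover have "(\<lambda>f. x * reflection (S f)) \<in> operators_le (Suc n)"
    by (rule operators_le_mult[OF operators_le_reflection[OF operators_le_mono[OF assms(1)]] assms(4)]) simp
  ultimately have "(\<lambda>f. u * theta (S f) + v * S f + x * reflection (S f)) \<in> operators_le (Suc n)"
    using operators_le_add[OF operators_le_add] by blast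
  then show ?thesis by (simp add: first_order_def[abs_def] comp_def)
qed

text \<open>The coefficients of an operator are determined by its action on Laurent polynomials.\<close>

lemma first_order_nonzero:
  assumes "u \<noteq> 0"
  shows "first_order u v x \<noteq> (\<lambda>_. 0)"
proof
  assume 0: "first_order u v x = (\<lambda>_. 0)"
  have "dr_op (\<lambda>j. if j = 0 then v else u) (\<lambda>j. if j = 0 then x else 0) 1 f = first_order u v x f" for f
    by (simp add: dr_op_def first_order_def)
  then show False
    using dr_op_zeroD[of "\<lambda>j. if j = 0 then v else u" "\<lambda>j. if j = 0 then x else 0" 1 1] assms 0
    by simp
qed

section \<open>The fundamental operators as first-order operators\<close>

lemma inverse_one_minus_inverse_Z: "1 / (1 - inverse Z) = (Z + 1) * inv_Delta"
proof -
  have "(Z + 1) * (1 - inverse Z) = Delta" by (simp add: Delta_def algebra_simps)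
  then have "(1 - inverse Z) * ((Z + 1) * inv_Delta) = 1"
    by (metis Delta_nonzero inv_Delta_def mult.assoc mult.commute right_inverse)
  then show ?thesis by (metis inverse_eq_divide inverse_unique)
qed

lemma inverse_one_plus_inverse_Z: "1 / (1 + inverse Z) = (Z - 1) * inv_Delta"
proof -
  have "(Z - 1) * (1 + inverse Z) = Delta" by (simp add: Delta_def algebra_simps)
  then have "(1 + inverse Z) * ((Z - 1) * inv_Delta) = 1"
    by (metis Delta_nonzero inv_Delta_def mult.assoc mult.commute right_inverse)
  then show ?thesis by (metis inverse_eq_divide inverse_unique)
qed

lemma cayley_plus: "(1 + inverse Z) / (1 - inverse Z) = (Z + inverse Z + 2) * inv_Delta"
proof -
  have "(1 + inverse Z) / (1 - inverse Z) = (1 + inverse Z) * ((Z + 1) * inv_Delta)"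
    by (simp flip: inverse_one_minus_inverse_Z)
  then show ?thesis using Z_inv_Z by algebra
qed

lemma cayley_minus: "(1 - inverse Z) / (1 + inverse Z) = (Z + inverse Z - 2) * inv_Delta"
proof -
  have "(1 - inverse Z) / (1 + inverse Z) = (1 - inverse Z) * ((Z - 1) * inv_Delta)"
    by (simp flip: inverse_one_plus_inverse_Z)
  then show ?thesis using Z_inv_Z by algebra
qed

lemma const_mult: "const (a * b) = const a * const b"
  by (simp add: const_def mult_single flip: to_fract_mult)

lemma const_2: "const 2 = 2"
  using const_simps(3)[of 1 1] by (simp add: const_simps(2))

lemma cherednik_eq_form: "cherednik k = cherednik_form (const (fst k)) (const (snd k))"
proof
  fix f
  have "const (rho k) = const (1 / 2) * const (fst k) + const (snd k)"
    unfolding const_mult[symmetric] const_simps(3)[symmetric]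
    by (rule arg_cong[where f = const]) (simp add: rho_def add_divide_distrib)
  moreover have "Z / Delta = Z * inv_Delta" by (simp add: inv_Delta_def divide_inverse)
  moreover have "const (2 * snd k) = 2 * const (snd k)" by (simp add: const_mult const_2)
  ultimately show "cherednik k f = cherednik_form (const (fst k)) (const (snd k)) f"
    unfolding cherednik_def cherednik_form_def first_order_def inverse_one_minus_inverse_Z Delta_cherednik_coefficient
    by algebra
qed

lemma divide_Delta:
  "x / (Z - inverse Z) = x * inv_Delta" "x / (Z - inverse Z) ^ 2 = x * inv_Delta * inv_Delta"
  by (simp_all add: inv_Delta_def divide_inverse power2_eq_square mult.assoc flip: Delta_def)

lemma const_minus_half: "const (a - 1 / 2) = const a - const (1 / 2)"
  using const_simps(3)[of a "- (1 / 2)"] const_simps(4)[of "1 / 2"] by simp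

lemma G_0_1_eq_form: "G_0_1 k = G_0_1_form"
  unfolding fun_eq_iff G_0_1_def G_0_1_form_def first_order_def divide_Delta
  by (simp add: algebra_simps)

lemma G_0_m1_eq_form: "G_0_m1 k = G_0_m1_form (const (fst k)) (const (snd k))"
proof -
  have "const (fst k + 2 * snd k - 1) = const (fst k) + 2 * const (snd k) - 1"
    using const_simps(3)[of "fst k + 2 * snd k" "- 1"]
    by (simp add: const_simps const_mult const_2)
  then show ?thesis
    unfolding fun_eq_iff G_0_m1_def G_0_m1_form_def first_order_def by (simp add: const_mult const_2)
qed

lemma G_2_m1_eq_form: "G_2_m1 k = G_2_m1_form (const (snd k))"
  unfolding fun_eq_iff G_2_m1_def G_2_m1_form_def first_order_def cayley_plus const_minus_half
    divide_Delta
  by (simp add: algebra_simps)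

lemma G_m2_1_eq_form: "G_m2_1 k = G_m2_1_form (const (fst k)) (const (snd k))"
  unfolding fun_eq_iff G_m2_1_def G_m2_1_form_def first_order_def cayley_minus const_minus_half
    divide_Delta const_simps(3)
  by (simp add: algebra_simps)

section \<open>Elementary shift operators\<close>

text \<open>First-order shift operators; all shift operators constructed explicitly are products of these.\<close>

definition elementary_shift :: "operator \<Rightarrow> int \<times> int \<Rightarrow> multiplicity \<Rightarrow> bool" where
  "elementary_shift T l k \<longleftrightarrow>
     (\<exists>u v x. T = first_order u v x \<and> u \<noteq> 0 \<and>
        u \<in> laurent_localized \<and> v \<in> laurent_localized \<and> x \<in> laurent_localized) \<and>
     T \<circ> cherednik k = cherednik (shift k l) \<circ> T \<and> T ` laurent_polys \<subseteq> laurent_polys"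

lemma shift_0: "shift k 0 = k" "shift k (0, 0) = k"
  by (simp_all add: shift_def)

lemma shift_shift: "shift (shift k l) l' = shift k (l + l')"
  by (simp add: shift_def)

lemma elementary_shift_comp:
  assumes T: "elementary_shift T l' (shift k l)"
    and S: "S \<in> shift_operators l k" "S \<in> operators_le n"
  shows "T \<circ> S \<in> shift_operators (l + l') k" and "T \<circ> S \<in> operators_le (Suc n)"
proof -
  show le: "T \<circ> S \<in> operators_le (Suc n)"
    using T S(2) by (auto simp: elementary_shift_def intro: first_order_comp_le)
  have T': "T (cherednik (shift k l) f) = cherednik (shift k (l + l')) (T f)" for f
    using T by (auto simp: elementary_shift_def shift_shift fun_eq_iff)
  have S': "S (cherednik k f) = cherednik (shift k l) (S f)" for f
    using S(1) by (auto simp: shift_operators_def fun_eq_iff)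
  show "T \<circ> S \<in> shift_operators (l + l') k"
    unfolding shift_operators_def
  proof (intro CollectI conjI)
    show "T \<circ> S \<in> diff_refl_operators" using le by (auto simp: diff_refl_operators_eq)
    show "T \<circ> S \<circ> cherednik k = cherednik (shift k (l + l')) \<circ> (T \<circ> S)"
      by (simp add: fun_eq_iff T' S')
    show "(T \<circ> S) ` laurent_polys \<subseteq> laurent_polys"
      using T S(1) by (auto simp: elementary_shift_def shift_operators_def image_subset_iff)
  qed
qed

lemma shift_operators_id: "id \<in> shift_operators 0 k"
  unfolding shift_operators_def
  using operators_le_id by (auto simp: diff_refl_operators_eq shift_0)

lemma elementary_shift_nonzero: "elementary_shift T l k \<Longrightarrow> T \<noteq> (\<lambda>_. 0)"
  using first_order_nonzero by (auto simp: elementary_shift_def)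

definition symmetric :: "ratfun \<Rightarrow> bool" where
  "symmetric p \<longleftrightarrow> p \<in> laurent_polys \<and> reflection p = p"

lemma symmetric_closed:
  "symmetric p \<Longrightarrow> symmetric q \<Longrightarrow> symmetric (p + q)"
  "symmetric p \<Longrightarrow> symmetric q \<Longrightarrow> symmetric (p * q)"
  "symmetric p \<Longrightarrow> symmetric (- p)"
  "symmetric (const a)"
  "symmetric (Z + inverse Z)"
  "symmetric (Delta * Delta)"
  by (auto simp: symmetric_def reflection_add reflection_mult reflection_minus reflection_Z
      reflection_Delta intro: laurent_polys_intros)

text \<open>Every Laurent polynomial is \<open>p + Delta * q\<close> with \<open>p\<close> and \<open>q\<close> symmetric: such sums are
  closed under multiplication by \<open>Z = (Z + 1/Z + Delta) / 2\<close> and by its inverse.\<close>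

lemma symmetric_decomposition:
  assumes "f \<in> laurent_polys"
  shows "\<exists>p q. symmetric p \<and> symmetric q \<and> f = p + Delta * q"
proof -
  let ?P = "\<lambda>f. \<exists>p q. symmetric p \<and> symmetric q \<and> f = p + Delta * q"
  have add: "?P (f + g)" if f: "?P f" and g: "?P g" for f g
  proof -
    obtain p q p' q' where "symmetric p" "symmetric q" "f = p + Delta * q"
      "symmetric p'" "symmetric q'" "g = p' + Delta * q'" using f g by blast
    then show ?thesis
      by (rule_tac exI[of _ "p + p'"], rule_tac exI[of _ "q + q'"])
        (simp add: symmetric_closed algebra_simps)
  qed
  have mult: "?P (f * g)" if f: "?P f" and g: "?P g" for f g
  proof -
    obtain p q p' q' where "symmetric p" "symmetric q" "f = p + Delta * q"
      "symmetric p'" "symmetric q'" "g = p' + Delta * q'" using f g by blast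
    moreover from this have "symmetric (p * p' + (Delta * Delta) * (q * q'))"
        "symmetric (p * q' + q * p')"
      by (simp_all add: symmetric_closed(1,2,6))
    moreover from calculation have
        "f * g = p * p' + (Delta * Delta) * (q * q') + Delta * (p * q' + q * p')"
      by (simp add: algebra_simps)
    ultimately show ?thesis by blast
  qed
  have const: "?P (const a)" for a
    using symmetric_closed(4)[of a] symmetric_closed(4)[of 0]
    by (metis add.right_neutral const_simps(1) mult_zero_right)
  have Z: "?P Z" "?P (inverse Z)"
  proof -
    have Z_eq: "Z = const (1 / 2) * (Z + inverse Z) + Delta * const (1 / 2)"
      and inverse_Z_eq: "inverse Z = const (1 / 2) * (Z + inverse Z) + Delta * - const (1 / 2)"
      using const_half unfolding Delta_def by algebra+
    have s: "symmetric (const (1 / 2) * (Z + inverse Z))" "symmetric (const (1 / 2))"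
        "symmetric (- const (1 / 2))"
      by (simp_all only: symmetric_closed)
    show "?P Z" by (rule exI, rule exI, rule conjI[OF s(1) conjI[OF s(2) Z_eq]])
    show "?P (inverse Z)" by (rule exI, rule exI, rule conjI[OF s(1) conjI[OF s(3) inverse_Z_eq]])
  qed
  have pow: "?P (Z ^ n)" "?P (inverse Z ^ n)" for n
    using const[of 1] Z mult by (induction n) (auto simp: const_simps(2))
  have to_fract_power: "to_fract (p ^ n) = to_fract p ^ n" for p :: laurent and n
    by (induction n) simp_all
  have single_power: "Poly_Mapping.single x (1::complex) ^ n = Poly_Mapping.single (int n * x) 1"
    for x :: int and n
    by (induction n) (simp_all add: mult_single algebra_simps)
  have single: "?P (to_fract (Poly_Mapping.single n a))" for n a
  proof (cases "n \<ge> 0")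
    case True
    have "Poly_Mapping.single n a = Poly_Mapping.single 0 a * Poly_Mapping.single 1 1 ^ nat n"
      using True by (simp add: single_power mult_single)
    then have "to_fract (Poly_Mapping.single n a) = const a * Z ^ nat n"
      by (simp only: to_fract_mult to_fract_power const_def Z_def)
    then show ?thesis using mult[OF const pow(1)] by simp
  next
    case False
    have "Poly_Mapping.single n a = Poly_Mapping.single 0 a * Poly_Mapping.single (- 1) 1 ^ nat (- n)"
      using False by (simp add: single_power mult_single)
    then have "to_fract (Poly_Mapping.single n a) = const a * inverse Z ^ nat (- n)"
      by (simp only: to_fract_mult to_fract_power const_def Z_inverse)
    then show ?thesis using mult[OF const pow(2)] by simp
  qed
  obtain g where g: "f = to_fract g" using assms by (auto simp: laurent_polys_def)
  show ?thesis unfolding g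
  proof (induction g rule: laurent_induct)
    case zero
    show ?case using const[of 0] by (simp add: const_simps)
  next
    case (add n c f)
    then show ?case using \<open>\<And>f g. ?P f \<Longrightarrow> ?P g \<Longrightarrow> ?P (f + g)\<close> single by simp
  qed
qed

text \<open>The derivative of a symmetric Laurent polynomial is antisymmetric, hence divisible by
  \<open>Delta\<close>.\<close>

lemma symmetric_theta:
  assumes "symmetric p"
  shows "\<exists>q \<in> laurent_polys. theta p = Delta * q"
proof -
  have tp: "theta p \<in> laurent_polys" "reflection (theta p) = - theta p"
    using assms by (auto simp: symmetric_def reflection_theta intro: laurent_polys_theta)
  obtain a b where ab: "symmetric a" "symmetric b" "theta p = a + Delta * b"
    using symmetric_decomposition[OF tp(1)] by blast
  then have "a - Delta * b = - (a + Delta * b)"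
    using tp(2) by (simp add: symmetric_def reflection_add reflection_mult reflection_Delta)
  then have "2 * a = 0" by algebra
  have "a = const (1 / 2) * (2 * a)" using const_half by algebra
  also have "\<dots> = 0" unfolding \<open>2 * a = 0\<close> by simp
  finally have "a = 0" .
  then show ?thesis using ab by (auto simp: symmetric_def)
qed

text \<open>On \<open>p + Delta * q\<close> with \<open>p\<close> and \<open>q\<close> symmetric the reflection acts as a sign on each summand, and the
  derivatives of \<open>p\<close> and \<open>q\<close> contribute further factors \<open>Delta\<close>. These compensate the
  denominators of \<open>u\<close>, \<open>v\<close> and \<open>x\<close>.\<close>

lemma first_order_preserves_laurent:
  assumes "\<And>p q. symmetric p \<Longrightarrow> q \<in> laurent_polys \<Longrightarrow> theta p = Delta * q \<Longrightarrow>
      u * (Delta * q) + (v + x) * p \<in> laurent_polys"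
    and "\<And>p q. symmetric p \<Longrightarrow> q \<in> laurent_polys \<Longrightarrow> theta p = Delta * q \<Longrightarrow>
      u * ((Z + inverse Z) * p + Delta * Delta * q) + (v - x) * Delta * p \<in> laurent_polys"
  shows "first_order u v x ` laurent_polys \<subseteq> laurent_polys"
proof (clarify)
  fix f assume "f \<in> laurent_polys"
  then obtain p q where pq: "symmetric p" "symmetric q" "f = p + Delta * q"
    using symmetric_decomposition by blast
  then obtain p' q' where p': "p' \<in> laurent_polys" "theta p = Delta * p'"
    "q' \<in> laurent_polys" "theta q = Delta * q'" using symmetric_theta by meson
  have "first_order u v x f = (u * (Delta * p') + (v + x) * p) +
      (u * ((Z + inverse Z) * q + Delta * Delta * q') + (v - x) * Delta * q)"
    using pq by (simp add: first_order_def theta_add theta_mult p' theta_Delta reflection_add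
        reflection_mult reflection_Delta symmetric_def algebra_simps)
  then show "first_order u v x f \<in> laurent_polys"
    using laurent_polys_add[OF assms(1)[OF pq(1) p'(1,2)] assms(2)[OF pq(2) p'(3,4)]] by simp
qed


lemma Delta_relations: "Delta = Z - inverse Z" "Z * inverse Z = 1" "inv_Delta * (Z - inverse Z) = 1"
  using Z_inv_Z inv_Delta_Delta by (simp_all add: Delta_def)

lemma elementary_shiftI:
  assumes "T = first_order u v x" "u \<noteq> 0"
    and "u \<in> laurent_localized" "v \<in> laurent_localized" "x \<in> laurent_localized"
    and "T \<circ> cherednik k = cherednik (shift k l) \<circ> T"
    and "\<And>p q. p \<in> laurent_polys \<Longrightarrow> q \<in> laurent_polys \<Longrightarrow>
      u * (Delta * q) + (v + x) * p \<in> laurent_polys \<and>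
      u * ((Z + inverse Z) * p + Delta * Delta * q) + (v - x) * Delta * p \<in> laurent_polys"
  shows "elementary_shift T l k"
proof -
  have "first_order u v x ` laurent_polys \<subseteq> laurent_polys"
    by (rule first_order_preserves_laurent) (use assms(7) in \<open>auto simp: symmetric_def\<close>)
  then show ?thesis using assms(1-6) unfolding elementary_shift_def by blast
qed

lemmas laurent_localized_intros = localized_inv_Delta localized_mult localized_minus localized_diff
  localized_add localized_laurent[OF laurent_polys_const] localized_laurent[OF laurent_polys_numeral]
  localized_laurent[OF laurent_polys_Z(1)] localized_laurent[OF laurent_polys_Z(2)]
  localized_laurent[OF laurent_polys_1]

lemma elementary_shift_cherednik: "elementary_shift (cherednik k) 0 k"
proof (rule elementary_shiftI[OF cherednik_eq_form[unfolded cherednik_form_def]])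
  fix p q assume pq: "p \<in> laurent_polys" "q \<in> laurent_polys"
  define k1 k2 h where "k1 = const (fst k)" "k2 = const (snd k)" "h = const (1 / 2)"
  note kh = this
  define C where "C = k1 * (Z + 1) * inv_Delta + 2 * k2 * Z * inv_Delta"
  have "1 * (Delta * q) + (C - h * k1 - k2 + - C) * p = Delta * q - (h * k1 + k2) * p"
    by algebra
  moreover have "1 * ((Z + inverse Z) * p + Delta * Delta * q) + (C - h * k1 - k2 - - C) * Delta * p =
      (Z + inverse Z) * p + Delta * Delta * q + 2 * (k1 * (Z + 1) + 2 * k2 * Z) * p
        - (h * k1 + k2) * Delta * p"
    unfolding C_def using Delta_relations by algebra
  ultimately show "1 * (Delta * q) + (const (fst k) * (Z + 1) * inv_Delta
        + 2 * const (snd k) * Z * inv_Delta - const (1 / 2) * const (fst k) - const (snd k)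
        + - (const (fst k) * (Z + 1) * inv_Delta + 2 * const (snd k) * Z * inv_Delta)) * p
      \<in> laurent_polys \<and>
      1 * ((Z + inverse Z) * p + Delta * Delta * q) + (const (fst k) * (Z + 1) * inv_Delta
        + 2 * const (snd k) * Z * inv_Delta - const (1 / 2) * const (fst k) - const (snd k)
        - - (const (fst k) * (Z + 1) * inv_Delta + 2 * const (snd k) * Z * inv_Delta)) * Delta * p
      \<in> laurent_polys"
    unfolding kh[symmetric] C_def[symmetric] using pq by (auto simp: kh intro!: laurent_polys_intros)
qed (simp_all add: shift_0 laurent_localized_intros)

lemma const_plus_int:
  "const (a + 1) = const a + 1" "const (a - 1) = const a - 1"
  "const (a + 2) = const a + 2" "const (a - 2) = const a - 2"
  using const_simps(3)[of a "- 1"] const_simps(3)[of a "- 2"]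
  by (simp_all add: const_simps const_2)

lemma elementary_shift_G_0_1: "elementary_shift (G_0_1 k) (0, 1) k"
proof (rule elementary_shiftI)
  show "G_0_1 k = first_order inv_Delta (- (Z * inv_Delta * inv_Delta)) (Z * inv_Delta * inv_Delta)"
    by (simp add: G_0_1_eq_form G_0_1_form_def)
  show "G_0_1 k \<circ> cherednik k = cherednik (shift k (0, 1)) \<circ> G_0_1 k"
    unfolding G_0_1_eq_form cherednik_eq_form
    by (subst G_0_1_intertwines) (simp_all add: shift_def const_plus_int)
  fix p q assume pq: "p \<in> laurent_polys" "q \<in> laurent_polys"
  let ?x = "Z * inv_Delta * inv_Delta"
  have "inv_Delta * (Delta * q) + (- ?x + ?x) * p = q"
    using Delta_relations by algebra
  moreover have "inv_Delta * ((Z + inverse Z) * p + Delta * Delta * q) + (- ?x - ?x) * Delta * p =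
      Delta * q - p"
    using Delta_relations by algebra
  ultimately show "inv_Delta * (Delta * q) + (- ?x + ?x) * p \<in> laurent_polys \<and>
      inv_Delta * ((Z + inverse Z) * p + Delta * Delta * q) + (- ?x - ?x) * Delta * p
        \<in> laurent_polys"
    using pq by (simp only: laurent_polys_intros simp_thms)
qed (auto simp: inv_Delta_def[symmetric] intro!: laurent_localized_intros, simp add: inv_Delta_def)

lemma elementary_shift_G_0_m1: "elementary_shift (G_0_m1 k) (0, - 1) k"
proof (rule elementary_shiftI[OF G_0_m1_eq_form[unfolded G_0_m1_form_def]])
  show "G_0_m1 k \<circ> cherednik k = cherednik (shift k (0, - 1)) \<circ> G_0_m1 k"
    unfolding G_0_m1_eq_form cherednik_eq_form
    by (subst G_0_m1_intertwines) (simp_all add: shift_def const_plus_int)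
  show "Z - inverse Z \<noteq> 0" by (simp flip: Delta_def)
qed (auto intro!: laurent_localized_intros laurent_polys_intros)

lemma Z_inverse_Z_plus_const: "theta a = 0 \<Longrightarrow> Z + inverse Z + a \<noteq> 0"
proof
  assume "theta a = 0" "Z + inverse Z + a = 0"
  then have "theta (Z + inverse Z + a) = 0" by simp
  then have "Z - inverse Z = 0" using \<open>theta a = 0\<close> by (simp add: theta_add theta_Z)
  then show False using Delta_nonzero by (simp add: Delta_def)
qed

lemma elementary_shift_G_2_m1: "elementary_shift (G_2_m1 k) (2, - 1) k"
proof (rule elementary_shiftI[OF G_2_m1_eq_form[unfolded G_2_m1_form_def]])
  show "G_2_m1 k \<circ> cherednik k = cherednik (shift k (2, - 1)) \<circ> G_2_m1 k"
    unfolding G_2_m1_eq_form cherednik_eq_form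
    by (subst G_2_m1_intertwines) (simp_all add: shift_def const_plus_int)
  show "(Z + inverse Z + 2) * inv_Delta \<noteq> 0"
    using Z_inverse_Z_plus_const[of 2] by (simp add: inv_Delta_def)
  fix p q assume pq: "p \<in> laurent_polys" "q \<in> laurent_polys"
  define k2 where "k2 = const (snd k) - const (1 / 2)"
  have k2: "k2 \<in> laurent_polys" by (auto simp: k2_def intro: laurent_polys_intros)
  let ?u = "(Z + inverse Z + 2) * inv_Delta"
  have "?u * (Delta * q) + (k2 - ?u * inv_Delta + ?u * inv_Delta) * p =
      (Z + inverse Z + 2) * q + k2 * p"
    using Delta_relations by algebra
  moreover have "?u * ((Z + inverse Z) * p + Delta * Delta * q)
        + (k2 - ?u * inv_Delta - ?u * inv_Delta) * Delta * p =
      Delta * p + (Z + inverse Z + 2) * Delta * q + k2 * Delta * p"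
    using Delta_relations by algebra
  ultimately show "?u * (Delta * q) + (const (snd k) - const (1 / 2) - ?u * inv_Delta
        + ?u * inv_Delta) * p \<in> laurent_polys \<and>
      ?u * ((Z + inverse Z) * p + Delta * Delta * q)
        + (const (snd k) - const (1 / 2) - ?u * inv_Delta - ?u * inv_Delta) * Delta * p
        \<in> laurent_polys"
    unfolding k2_def[symmetric] using pq k2 by (simp only: laurent_polys_intros simp_thms)
qed (auto intro!: laurent_localized_intros)

lemma elementary_shift_G_m2_1: "elementary_shift (G_m2_1 k) (- 2, 1) k"
proof (rule elementary_shiftI[OF G_m2_1_eq_form[unfolded G_m2_1_form_def]])
  show "G_m2_1 k \<circ> cherednik k = cherednik (shift k (- 2, 1)) \<circ> G_m2_1 k"
    unfolding G_m2_1_eq_form cherednik_eq_form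
    by (subst G_m2_1_intertwines) (simp_all add: shift_def const_plus_int)
  show "(Z + inverse Z - 2) * inv_Delta \<noteq> 0"
    using Z_inverse_Z_plus_const[of "- 2"] by (simp add: inv_Delta_def theta_minus)
  fix p q assume pq: "p \<in> laurent_polys" "q \<in> laurent_polys"
  define k2 where "k2 = const (fst k) + const (snd k) - const (1 / 2)"
  have k2: "k2 \<in> laurent_polys" by (auto simp: k2_def intro!: laurent_polys_intros)
  let ?u = "(Z + inverse Z - 2) * inv_Delta"
  have "?u * (Delta * q) + (k2 + ?u * inv_Delta + - (?u * inv_Delta)) * p =
      (Z + inverse Z - 2) * q + k2 * p"
    using Delta_relations by algebra
  moreover have "?u * ((Z + inverse Z) * p + Delta * Delta * q)
        + (k2 + ?u * inv_Delta - - (?u * inv_Delta)) * Delta * p =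
      Delta * p + (Z + inverse Z - 2) * Delta * q + k2 * Delta * p"
    using Delta_relations by algebra
  ultimately show "?u * (Delta * q) + (const (fst k) + const (snd k) - const (1 / 2) + ?u * inv_Delta
        + - (?u * inv_Delta)) * p \<in> laurent_polys \<and>
      ?u * ((Z + inverse Z) * p + Delta * Delta * q)
        + (const (fst k) + const (snd k) - const (1 / 2) + ?u * inv_Delta - - (?u * inv_Delta))
          * Delta * p \<in> laurent_polys"
    unfolding k2_def[symmetric] using pq k2 by (simp only: laurent_polys_intros simp_thms)
qed (auto intro!: laurent_localized_intros)

section \<open>Symbols of shift operators\<close>

text \<open>At \<open>c = 1\<close> both poles of the Cherednik operator contribute to the residue, at \<open>c = - 1\<close> only the one that
  belongs to \<open>k2\<close>. Up to the shift by \<open>1 / 2\<close> these are the Jacobi parameters.\<close>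

definition local_parameter :: "complex \<Rightarrow> multiplicity \<Rightarrow> complex" where
  "local_parameter c k = (if c = 1 then fst k + snd k else snd k)"

definition local_increment :: "complex \<Rightarrow> int \<times> int \<Rightarrow> int" where
  "local_increment c l = (if c = 1 then fst l + snd l else snd l)"

lemma local_parameter_shift:
  "local_parameter c (shift k l) = local_parameter c k + of_int (local_increment c l)"
  by (simp add: local_parameter_def local_increment_def shift_def)

text \<open>Requiring the symbol to be non-zero for all large \<open>m\<close>, and not just somewhere, makes the order
  additive under composition.\<close>

definition local_order :: "complex \<Rightarrow> operator \<Rightarrow> int \<Rightarrow> bool" where
  "local_order c S e \<longleftrightarrow> (\<exists>\<sigma>. has_symbol c S e \<sigma> \<and> (\<exists>M. \<forall>m\<ge>M. \<sigma> m \<noteq> 0))"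

lemma local_order_id: "local_order c id 0"
  unfolding local_order_def using has_symbol_id by (metis zero_neq_one)

lemma local_order_comp:
  assumes "local_order c S e" "local_order c T e'"
  shows "local_order c (S \<circ> T) (e + e')"
proof -
  obtain \<sigma> M \<tau> N where "has_symbol c S e \<sigma>" "\<And>m. m \<ge> M \<Longrightarrow> \<sigma> m \<noteq> 0"
    "has_symbol c T e' \<tau>" "\<And>m. m \<ge> N \<Longrightarrow> \<tau> m \<noteq> 0"
    using assms by (auto simp: local_order_def)
  moreover from this have "\<forall>m \<ge> max (M + e') N. \<sigma> (m - e') * \<tau> m \<noteq> 0" by auto
  ultimately show ?thesis unfolding local_order_def using has_symbol_comp by blast
qed

lemma shift_operators_intertwine:
  "S \<in> shift_operators l k \<Longrightarrow> S (cherednik k f) = cherednik (shift k l) (S f)"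
  by (auto simp: shift_operators_def fun_eq_iff)

lemma shift_operators_laurent:
  "S \<in> shift_operators l k \<Longrightarrow> f \<in> laurent_polys \<Longrightarrow> S f \<in> laurent_polys"
  by (auto simp: shift_operators_def)

lemma shift_operators_le:
  assumes "S \<in> shift_operators l k"
  obtains n where "S \<in> operators_le n"
  using assms by (auto simp: shift_operators_def diff_refl_operators_eq)

context
  fixes c :: complex
  assumes c: "c = 1 \<or> c = - 1"
begin

lemma leads_const: "leads (expansion c (const a)) 0 a" "leads (expansion c (const a)) (- 1) 0"
  using base_nonzero[OF c] by (auto simp: expansion_const leads_def)

lemma leads_Z: "leads (expansion c Z) 0 c"
  using base_nonzero[OF c] by (auto simp: Z_def expansion_to_fract taylor_single leads_def)

lemma leads_inv_Delta: "leads (expansion c inv_Delta) (- 1) (1 / (2 * c))"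
proof -
  have nz: "c \<noteq> 0" by (rule base_nonzero[OF c])
  let ?D = "expansion c Delta"
  have D: "leads ?D 1 (2 * c)" by (rule leads_Delta[OF c])
  then have sub: "fls_subdegree ?D = 1"
    using nz by (intro fls_subdegree_eqI) (auto simp: leads_def)
  have inv: "expansion c inv_Delta = inverse ?D"
    unfolding inv_Delta_def by (rule expansion_inverse[OF nz])
  have "fls_subdegree (inverse ?D) = - 1" using sub by simp
  then have "leads (inverse ?D) (- 1) (fls_nth (inverse ?D) (- 1))"
    by (auto simp: leads_def intro: fls_eq0_below_subdegree)
  moreover from leads_mult[OF D this] have "fls_nth (inverse ?D) (- 1) = 1 / (2 * c)"
    using nz by (simp add: leads_def expansion_eq_0_iff field_simps)
  ultimately show ?thesis by (simp add: inv)
qed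

lemma leads_expansion_add:
  "leads (expansion c p) m a \<Longrightarrow> leads (expansion c q) m b \<Longrightarrow> leads (expansion c (p + q)) m (a + b)"
  using base_nonzero[OF c] by (simp add: expansion_add leads_add)

lemma leads_expansion_minus:
  "leads (expansion c p) m a \<Longrightarrow> leads (expansion c (- p)) m (- a)"
  using base_nonzero[OF c] by (simp add: expansion_minus leads_def)

lemma leads_expansion_mult:
  "leads (expansion c p) m a \<Longrightarrow> leads (expansion c q) n b \<Longrightarrow>
    leads (expansion c (p * q)) (m + n) (a * b)"
  using base_nonzero[OF c] by (simp add: expansion_mult leads_mult)

text \<open>The Cherednik operator agrees in lowest order with the rational Dunkl operator whose parameter is the
  residue of its coefficient.\<close>

lemma has_symbol_cherednik:
  "has_symbol c (cherednik k) 1 (dunkl_bracket (local_parameter c k))"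
proof -
  define x where "x = local_parameter c k"
  define C where "C = const (fst k) * (Z + 1) * inv_Delta + 2 * const (snd k) * Z * inv_Delta"
  define r where "r = - (const (1 / 2) * const (fst k) + const (snd k))"
  have "const (fst k) * (Z + const 1) * inv_Delta + const (2 * snd k) * Z * inv_Delta = C"
    by (simp add: C_def const_mult const_2 const_simps(2))
  moreover have "leads (expansion c
      (const (fst k) * (Z + const 1) * inv_Delta + const (2 * snd k) * Z * inv_Delta))
      (0 + 0 + - 1) (fst k * (c + 1) * (1 / (2 * c)) + 2 * snd k * c * (1 / (2 * c)))"
    by (intro leads_expansion_add leads_expansion_mult leads_const leads_Z leads_inv_Delta)
  moreover have "fst k * (c + 1) * (1 / (2 * c)) + 2 * snd k * c * (1 / (2 * c)) = x"
    using c by (auto simp: x_def local_parameter_def field_simps)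
  ultimately have C: "leads (expansion c C) (- 1) x" by simp
  have "r = const (- (fst k / 2 + snd k))"
    unfolding r_def const_mult[symmetric] const_simps(3,4)[symmetric] by simp
  then have r: "leads (expansion c r) (- 1) 0" using leads_const(2) by simp
  have D: "cherednik k = (\<lambda>f. theta f + (C + r) * f + - C * reflection f)"
    unfolding cherednik_eq_form cherednik_form_def first_order_def[abs_def] C_def r_def
    by (simp add: algebra_simps)
  have 1: "has_symbol c (\<lambda>f. (C + r) * f) 1 (\<lambda>_. x + 0)"
    by (rule has_symbol_mult[OF c leads_expansion_add[OF C r]])
  have 2: "has_symbol c (\<lambda>f. - C * f) 1 (\<lambda>_. - x)"
    by (rule has_symbol_mult[OF c leads_expansion_minus[OF C]])
  from has_symbol_comp[OF 2 has_symbol_reflection[OF c]]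
  have 3: "has_symbol c (\<lambda>f. - C * reflection f) 1 (\<lambda>m. - x * (- 1) powi m)"
    by (simp add: comp_def)
  from has_symbol_add[OF c has_symbol_add[OF c has_symbol_theta[OF c] 1] 3]
  have "has_symbol c (cherednik k) 1 (\<lambda>m. of_int m + (x + 0) + - x * (- 1) powi m)"
    by (simp add: D)
  also have "(\<lambda>m. of_int m + (x + 0) + - x * (- 1) powi m) = dunkl_bracket x"
    by (auto simp: fun_eq_iff dunkl_bracket_def power_int_minus_left)
  finally show ?thesis by (simp add: x_def)
qed

lemma local_order_cherednik: "local_order c (cherednik k) 1"
  unfolding local_order_def
  using has_symbol_cherednik dunkl_bracket_eventually_nonzero by blast

lemma local_order_unique:
  assumes "local_order c S e" "local_order c S e'"
  shows "e = e'"
proof -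
  have "\<not> e < e'" if SS: "local_order c S e" "local_order c S e'" for e e'
  proof
    assume "e < e'"
    obtain \<sigma> where "has_symbol c S e \<sigma>" using SS(1) by (auto simp: local_order_def)
    moreover obtain \<tau> M where "has_symbol c S e' \<tau>" "\<And>m. m \<ge> M \<Longrightarrow> \<tau> m \<noteq> 0"
      using SS(2) by (auto simp: local_order_def)
    ultimately have "\<tau> = (\<lambda>_. 0)" "\<tau> M \<noteq> 0"
      using has_symbol_unique[OF c] has_symbol_raise[OF _ \<open>e < e'\<close>] by blast+
    then show False by simp
  qed
  then show ?thesis using assms by (meson linorder_neqE)
qed

lemma local_order_nonzero: "local_order c S e \<Longrightarrow> S \<noteq> (\<lambda>_. 0)"
proof
  assume S: "local_order c S e" "S = (\<lambda>_. 0)"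
  then obtain \<sigma> M where \<sigma>: "has_symbol c S e \<sigma>" "\<forall>m\<ge>M. \<sigma> m \<noteq> 0"
    unfolding local_order_def by blast
  have "has_symbol c S e (\<lambda>_. 0)"
    using base_nonzero[OF c] by (simp add: S(2) has_symbol_def leads_def)
  then have "\<sigma> = (\<lambda>_. 0)" by (rule has_symbol_unique[OF c \<sigma>(1)])
  then show False using \<sigma>(2) by auto
qed

text \<open>The symbols of the two composites in the intertwining relation agree, which is the difference
  equation for the symbol of \<open>S\<close>.\<close>

lemma shift_operator_symbol:
  assumes S: "S \<in> shift_operators l k" "S \<noteq> (\<lambda>_. 0)" "S \<in> operators_le n"
  obtains e p q where "has_symbol c S e (quasi_poly p q)" "p \<noteq> 0" "degree p \<le> n"
    "dunkl_recursion (local_parameter c k)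
       (local_parameter c k + of_int (local_increment c l)) e (quasi_poly p q)"
    "local_order c S e"
proof -
  obtain a b where ab: "S = dr_op a b n" using S(3) by (auto simp: operators_le_def)
  then obtain e p q where sym: "has_symbol c S e (quasi_poly p q)" "degree p \<le> n" "p \<noteq> 0 \<or> q \<noteq> 0"
    using has_symbol_exists[OF c S(2)[unfolded ab]] by blast
  have "S \<circ> cherednik k = cherednik (shift k l) \<circ> S"
    using S(1) by (simp add: shift_operators_def)
  moreover from has_symbol_comp[OF sym(1) has_symbol_cherednik[of k]]
  have "has_symbol c (S \<circ> cherednik k) (e + 1)
      (\<lambda>m. quasi_poly p q (m - 1) * dunkl_bracket (local_parameter c k) m)" .
  moreover from has_symbol_comp[OF has_symbol_cherednik[of "shift k l"] sym(1)]
  have "has_symbol c (cherednik (shift k l) \<circ> S) (e + 1)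
      (\<lambda>m. dunkl_bracket (local_parameter c (shift k l)) (m - e) * quasi_poly p q m)"
    by (simp add: add.commute)
  ultimately have "(\<lambda>m. quasi_poly p q (m - 1) * dunkl_bracket (local_parameter c k) m) =
      (\<lambda>m. dunkl_bracket (local_parameter c (shift k l)) (m - e) * quasi_poly p q m)"
    using has_symbol_unique[OF c] by (metis (no_types, lifting))
  then have rec: "dunkl_recursion (local_parameter c k)
       (local_parameter c k + of_int (local_increment c l)) e (quasi_poly p q)"
    unfolding dunkl_recursion_def local_parameter_shift by (simp add: fun_eq_iff)
  then obtain M where M: "\<forall>m\<ge>M. quasi_poly p q m \<noteq> 0"
    using dunkl_recursion_nonzero sym(3) by blast
  have "p \<noteq> 0"
  proof
    assume "p = 0"
    moreover have "even (2 * \<bar>M\<bar>)" by simp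
    ultimately have "quasi_poly p q (2 * \<bar>M\<bar>) = 0" by (simp only: quasi_poly_def if_True poly_0)
    then show False using M by simp
  qed
  moreover have "local_order c S e" using sym(1) M by (auto simp: local_order_def)
  ultimately show ?thesis by (intro that[OF sym(1) _ sym(2) rec])
qed

lemma shift_operator_local_order:
  assumes "S \<in> shift_operators l k" "S \<noteq> (\<lambda>_. 0)"
  obtains e where "local_order c S e"
proof -
  obtain n where "S \<in> operators_le n" using shift_operators_le assms(1) .
  then obtain e p q where "has_symbol c S e (quasi_poly p q)" "p \<noteq> 0" "degree p \<le> n"
    "dunkl_recursion (local_parameter c k)
       (local_parameter c k + of_int (local_increment c l)) e (quasi_poly p q)"
    "local_order c S e"
    by (rule shift_operator_symbol[OF assms])
  then show thesis by (intro that)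
qed

text \<open>The degree of the symbol is \<open>e - local_increment c l\<close>, and it is a natural number.\<close>

lemma local_order_ge_increment:
  assumes "S \<in> shift_operators l k" "local_order c S e"
  shows "e \<ge> local_increment c l"
proof -
  obtain n where n: "S \<in> operators_le n" using shift_operators_le assms(1) .
  obtain e' p q where "has_symbol c S e' (quasi_poly p q)" and p: "p \<noteq> 0"
    and "degree p \<le> n" and rec: "dunkl_recursion (local_parameter c k)
       (local_parameter c k + of_int (local_increment c l)) e' (quasi_poly p q)"
    and e': "local_order c S e'"
    using shift_operator_symbol[OF assms(1) local_order_nonzero[OF assms(2)] n] .
  show ?thesis
    using dunkl_recursion_degree[OF rec p] local_order_unique[OF assms(2) e'] by linarith
qed

text \<open>An operator of order at most \<open>n\<close> has a symbol of degree at most \<open>n\<close>.\<close>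

lemma local_order_le:
  assumes "S \<in> shift_operators l k" "S \<in> operators_le n" "local_order c S e"
  shows "e \<le> int n + local_increment c l"
proof -
  obtain e' p q where "has_symbol c S e' (quasi_poly p q)" and p: "p \<noteq> 0" "degree p \<le> n"
    and rec: "dunkl_recursion (local_parameter c k)
       (local_parameter c k + of_int (local_increment c l)) e' (quasi_poly p q)"
    and e': "local_order c S e'"
    using shift_operator_symbol[OF assms(1) local_order_nonzero[OF assms(3)] assms(2)] .
  show ?thesis
    using dunkl_recursion_degree[OF rec p(1)] p(2) local_order_unique[OF assms(3) e'] by linarith
qed

text \<open>For a non-negative increment the bound comes from regularity: \<open>S\<close> maps \<open>Delta ^ m\<close> with \<open>m \<ge> 0\<close> to a Laurent
  polynomial, which has no pole at \<open>c\<close>, so the symbol vanishes for \<open>0 \<le> m < e\<close>. For a negative increment it comes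
  from the absence of a crossing.\<close>

lemma local_order_lower_bound:
  assumes S: "S \<in> shift_operators l k" "local_order c S e"
    and nc: "\<not> crosses (local_parameter c k - 1 / 2) (local_increment c l)"
  shows "e \<ge> \<bar>local_increment c l\<bar> + local_increment c l"
proof -
  obtain n where n: "S \<in> operators_le n" using shift_operators_le S(1) .
  obtain e' p q where sym: "has_symbol c S e' (quasi_poly p q)" and p: "p \<noteq> 0"
    and "degree p \<le> n" and rec: "dunkl_recursion (local_parameter c k)
       (local_parameter c k + of_int (local_increment c l)) e' (quasi_poly p q)"
    and "local_order c S e'"
    using shift_operator_symbol[OF S(1) local_order_nonzero[OF S(2)] n] .
  then have e': "e' = e" using local_order_unique[OF S(2)] by blast
  show ?thesis
  proof (cases "local_increment c l \<ge> 0")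
    case True
    have regular: "quasi_poly p q m = 0" if m: "0 \<le> m" "m < e" for m
    proof -
      obtain a where a: "a \<noteq> 0" "leads (expansion c (Delta powi m)) m a"
        using leads_Delta_power[OF c] by blast
      then have "leads (expansion c (S (Delta powi m))) (m - e) (quasi_poly p q m * a)"
        using sym unfolding e' has_symbol_def by blast
      moreover have "S (Delta powi m) \<in> laurent_polys"
        using shift_operators_laurent[OF S(1) Delta_power_laurent[OF m(1)]] .
      then have "fls_nth (expansion c (S (Delta powi m))) (m - e) = 0"
        using m base_nonzero[OF c] by (auto simp: laurent_polys_def expansion_to_fract)
      ultimately have "quasi_poly p q m * a = 0" unfolding leads_def by metis
      then show ?thesis using a(1) by simp
    qed
    have "e \<ge> 2 * local_increment c l"
      by (rule dunkl_recursion_regular[OF rec[unfolded e'] p regular])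
    then show ?thesis using True by linarith
  next
    case False
    then show ?thesis using dunkl_recursion_not_crossing[OF rec p nc] unfolding e' by linarith
  qed
qed

end

section \<open>Shift operators as a module over the operators commuting with the Cherednik operator\<close>

lemma shift_operators_add_scale:
  assumes S: "S \<in> shift_operators l k" and T: "T \<in> shift_operators l k"
  shows "(\<lambda>f. S f + const a * T f) \<in> shift_operators l k"
proof -
  obtain m n where mn: "S \<in> operators_le m" "T \<in> operators_le n"
    using shift_operators_le S T by metis
  then have "S \<in> operators_le (max m n)" "T \<in> operators_le (max m n)"
    using operators_le_mono by (meson max.cobounded1 max.cobounded2)+
  then have "(\<lambda>f. S f + const a * T f) \<in> operators_le (max m n)"
    by (intro operators_le_add operators_le_mult localized_laurent laurent_polys_const)
  moreover have "cherednik k' (f + const a * g) = cherednik k' f + const a * cherednik k' g" for k' f g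
    unfolding cherednik_eq_form cherednik_form_def
    by (simp add: first_order_def theta_add theta_mult reflection_add reflection_mult algebra_simps)
  ultimately show ?thesis
    using shift_operators_laurent[OF S] shift_operators_laurent[OF T]
    by (auto simp: shift_operators_def diff_refl_operators_eq fun_eq_iff
        shift_operators_intertwine[OF S] shift_operators_intertwine[OF T]
        intro!: laurent_polys_intros)
qed

lemma shift_operators_linear:
  assumes S: "S \<in> shift_operators l k"
  shows "S (f + g) = S f + S g" and "S (const a * f) = const a * S f" and "S 0 = 0"
proof -
  obtain u v n where uv: "S = dr_op u v n"
    using S by (auto simp: shift_operators_def diff_refl_operators_def)
  have "(theta ^^ j) (f + g) = (theta ^^ j) f + (theta ^^ j) g" for j f g
    by (induction j) (simp_all add: theta_add)
  then show "S (f + g) = S f + S g"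
    by (simp add: uv dr_op_def reflection_add sum.distrib distrib_left algebra_simps)
  show scale: "S (const a * f) = const a * S f" for a f by (simp add: uv dr_op_const_mult)
  show "S 0 = 0" using scale[of 0 0] by (simp add: const_simps)
qed

lemma shift_operators_comp_cherednik:
  assumes "S \<in> shift_operators l k"
  shows "S \<circ> cherednik k \<in> shift_operators l k"
proof -
  obtain n where n: "S \<in> operators_le n" using shift_operators_le assms .
  have "S \<circ> cherednik k = cherednik (shift k l) \<circ> S"
    using assms by (simp add: shift_operators_def)
  then show ?thesis
    using elementary_shift_comp(1)[OF elementary_shift_cherednik assms n] by simp
qed

text \<open>The induction runs over the algebra and lets \<open>S\<close> vary. In this way composition from the right
  reduces to the case of the generator, where intertwining turns it into composition from
  the left.\<close>

lemma shift_operators_comp_generated: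
  assumes "A \<in> generated_algebra (cherednik k)" and "S \<in> shift_operators l k"
  shows "S \<circ> A \<in> shift_operators l k"
  using assms
proof (induction arbitrary: S)
  case generator
  then show ?case by (rule shift_operators_comp_cherednik)
next
  case one
  then show ?case by simp
next
  case (add A B)
  have "S \<circ> (\<lambda>f. A f + B f) = (\<lambda>f. (S \<circ> A) f + const 1 * (S \<circ> B) f)"
    by (simp add: fun_eq_iff shift_operators_linear[OF add.prems] const_simps)
  then show ?case using shift_operators_add_scale add by simp
next
  case (scale A a)
  have "S \<circ> (\<lambda>f. const a * A f) = (\<lambda>f. (S \<circ> A) f + const (a - 1) * (S \<circ> A) f)"
    by (simp add: fun_eq_iff shift_operators_linear(2)[OF scale.prems] const_plus_int left_diff_distrib)
  then show ?case using shift_operators_add_scale scale by simp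
next
  case (mult A B)
  then show ?case unfolding comp_assoc[symmetric] by blast
qed

lemma generated_algebra_subset: "generated_algebra (cherednik k) \<subseteq> shift_operators 0 k"
proof
  fix A assume "A \<in> generated_algebra (cherednik k)"
  from shift_operators_comp_generated[OF this shift_operators_id]
  show "A \<in> shift_operators 0 k" by simp
qed

lemma generated_algebra_power: "D ^^ j \<in> generated_algebra D"
proof (induction j)
  case 0
  show ?case using generated_algebra.one[of D] by (simp add: id_def)
next
  case (Suc j)
  show ?case using generated_algebra.mult[OF generated_algebra.generator Suc] by (simp add: comp_def)
qed

text \<open>The symbols of \<open>S\<close> and \<open>T\<close> solve the same recursion with the same \<open>e\<close>, hence are proportional, and a
  suitable combination has smaller order or vanishes.\<close>

lemma shift_operators_reduce:
  assumes c: "c = 1 \<or> c = - 1"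
    and S: "S \<in> shift_operators l k" "local_order c S e"
    and T: "T \<in> shift_operators l k" "local_order c T e"
  obtains a U where "U \<in> shift_operators l k" "T = (\<lambda>f. U f + const a * S f)"
    "U = (\<lambda>_. 0) \<or> (\<exists>e'<e. local_order c U e')"
proof -
  obtain m n where mn: "S \<in> operators_le m" "T \<in> operators_le n"
    using shift_operators_le S T by metis
  obtain e1 p q where 1: "has_symbol c S e1 (quasi_poly p q)" "p \<noteq> 0" "degree p \<le> m"
    "dunkl_recursion (local_parameter c k)
       (local_parameter c k + of_int (local_increment c l)) e1 (quasi_poly p q)" "local_order c S e1"
    using shift_operator_symbol[OF c S(1) local_order_nonzero[OF c S(2)] mn(1)] .
  obtain e2 r s where 2: "has_symbol c T e2 (quasi_poly r s)" "r \<noteq> 0" "degree r \<le> n"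
    "dunkl_recursion (local_parameter c k)
       (local_parameter c k + of_int (local_increment c l)) e2 (quasi_poly r s)" "local_order c T e2"
    using shift_operator_symbol[OF c T(1) local_order_nonzero[OF c T(2)] mn(2)] .
  have e: "e1 = e" "e2 = e"
    using local_order_unique[OF c] S(2) T(2) 1(5) 2(5) by blast+
  obtain a where a: "r = smult a p" "s = smult a q"
    using dunkl_recursion_unique[of "local_parameter c k" _ e p q r s] 1 2 e by blast
  define U where "U = (\<lambda>f. T f + const (- a) * S f)"
  have U: "U \<in> shift_operators l k"
    unfolding U_def by (rule shift_operators_add_scale) fact+
  have "has_symbol c (\<lambda>f. const (- a) * S f) e (\<lambda>m. - a * quasi_poly p q m)"
    using has_symbol_comp[OF has_symbol_const[OF c, of "- a"] 1(1)[unfolded e]]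
    by (simp add: comp_def)
  from has_symbol_add[OF c 2(1)[unfolded e] this]
  have "has_symbol c U e (\<lambda>m. quasi_poly r s m + - a * quasi_poly p q m)"
    unfolding U_def .
  also have "(\<lambda>m. quasi_poly r s m + - a * quasi_poly p q m) = (\<lambda>_. 0)"
    by (simp add: fun_eq_iff quasi_poly_def a)
  finally have U0: "has_symbol c U e (\<lambda>_. 0)" .
  have "\<exists>e'<e. local_order c U e'" if nz: "U \<noteq> (\<lambda>_. 0)"
  proof -
    obtain e' where e': "local_order c U e'" using shift_operator_local_order[OF c U nz] .
    then obtain \<tau> M where \<tau>: "has_symbol c U e' \<tau>" "\<tau> M \<noteq> 0"
      by (auto simp: local_order_def)
    have "has_symbol c U e' (\<lambda>_. 0)" if "e \<le> e'"
      using U0 has_symbol_raise[OF U0] that by (cases "e = e'") auto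
    then have "e' < e" using has_symbol_unique[OF c \<tau>(1)] \<tau>(2) by (metis not_le)
    then show ?thesis using e' by blast
  qed
  moreover have "T = (\<lambda>f. U f + const a * S f)"
    by (simp add: U_def const_simps)
  ultimately show thesis using that U by blast
qed

text \<open>Since the Cherednik operator has order one, the composites of \<open>S\<close> with its powers realize every order from \<open>e\<close>
  on. Subtracting multiples of them lowers the order of \<open>T\<close> until nothing is left.\<close>

lemma shift_operators_generated:
  assumes c: "c = 1 \<or> c = - 1"
    and S: "S \<in> shift_operators l k" "local_order c S e"
    and minimal: "\<And>T e'. T \<in> shift_operators l k \<Longrightarrow> local_order c T e' \<Longrightarrow> e \<le> e'"
    and T: "T \<in> shift_operators l k"
  shows "\<exists>A \<in> generated_algebra (cherednik k). T = S \<circ> A"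
proof -
  let ?gen = "generated_algebra (cherednik k)"
  have zero: "\<exists>A \<in> ?gen. T = S \<circ> A" if "T = (\<lambda>_. 0)" for T
  proof
    show "(\<lambda>f. const 0 * cherednik k f) \<in> ?gen"
      by (intro generated_algebra.scale generated_algebra.generator)
    show "T = S \<circ> (\<lambda>f. const 0 * cherednik k f)"
      by (simp add: that fun_eq_iff const_simps shift_operators_linear(3)[OF S(1)])
  qed
  have "\<exists>A \<in> ?gen. T = S \<circ> A"
    if "T \<in> shift_operators l k" "local_order c T e'" "e' < e + int n" for T e' n
    using that
  proof (induction n arbitrary: T e')
    case 0
    then show ?case using minimal by force
  next
    case (Suc n)
    define j where "j = nat (e' - e)"
    have j: "e' = e + int j" using minimal[OF Suc.prems(1,2)] by (simp add: j_def)
    define R where "R = S \<circ> cherednik k ^^ j"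
    have R: "R \<in> shift_operators l k"
      unfolding R_def by (rule shift_operators_comp_generated[OF generated_algebra_power S(1)])
    have "local_order c (cherednik k ^^ i) (int i)" for i
    proof (induction i)
      case 0
      show ?case using local_order_id by (simp add: id_def)
    next
      case (Suc i)
      from local_order_comp[OF local_order_cherednik[OF c, of k] this] show ?case
        by (simp add: comp_def)
    qed
    then have Re: "local_order c R e'"
      unfolding R_def j by (rule local_order_comp[OF S(2)])
    obtain a U where U: "U \<in> shift_operators l k" "T = (\<lambda>f. U f + const a * R f)"
      "U = (\<lambda>_. 0) \<or> (\<exists>e''<e'. local_order c U e'')"
      using shift_operators_reduce[OF c R Re Suc.prems(1,2)] .
    obtain A where A: "A \<in> ?gen" "U = S \<circ> A"
    proof (cases "U = (\<lambda>_. 0)")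
      case True
      then show ?thesis using zero that by blast
    next
      case False
      then obtain e'' where "e'' < e'" "local_order c U e''" using U(3) by blast
      then show ?thesis using Suc.IH[OF U(1)] Suc.prems(3) that by force
    qed
    let ?B = "\<lambda>f. A f + const a * (cherednik k ^^ j) f"
    have "?B \<in> ?gen"
      by (intro generated_algebra.add generated_algebra.scale generated_algebra_power A(1))
    moreover have "T = S \<circ> ?B"
      unfolding U(2) A(2) R_def by (simp add: fun_eq_iff shift_operators_linear[OF S(1)])
    ultimately show ?case by blast
  qed
  note step = this
  show ?thesis
  proof (cases "T = (\<lambda>_. 0)")
    case False
    then obtain e' where e': "local_order c T e'" using shift_operator_local_order[OF c T] by blast
    show ?thesis
      by (rule step[OF T e', of "nat (e' - e + 1)"]) simp
  qed (rule zero)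
qed

text \<open>For the zero shift orders are non-negative, so the identity has minimal order.\<close>

lemma shift_operators_0_eq: "shift_operators 0 k = generated_algebra (cherednik k)"
proof
  show "shift_operators 0 k \<subseteq> generated_algebra (cherednik k)"
  proof
    fix T assume T: "T \<in> shift_operators 0 k"
    have "local_order 1 id 0" by (rule local_order_id)
    moreover have "0 \<le> e'" if "T \<in> shift_operators 0 k" "local_order 1 T e'" for T e'
      using local_order_ge_increment[OF _ that] by (simp add: local_increment_def)
    ultimately obtain A where "A \<in> generated_algebra (cherednik k)" "T = id \<circ> A"
      using shift_operators_generated[OF _ shift_operators_id _ _ T, of 1 0] by auto
    then show "T \<in> generated_algebra (cherednik k)" by simp
  qed
qed (rule generated_algebra_subset)

lemma shift_operators_comp_nonzero:
  assumes "S \<in> shift_operators l k" "S \<noteq> (\<lambda>_. 0)" "T \<in> shift_operators l' k'" "T \<noteq> (\<lambda>_. 0)"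
  shows "S \<circ> T \<noteq> (\<lambda>_. 0)"
proof -
  obtain e e' where "local_order 1 S e" "local_order 1 T e'"
    using shift_operator_local_order[of 1] assms by metis
  from local_order_nonzero[OF _ local_order_comp[OF this]] show ?thesis by simp
qed

lemma shift_operators_comp_inj:
  assumes S: "S \<in> shift_operators l k" "S \<noteq> (\<lambda>_. 0)"
  shows "inj_on (\<lambda>A. S \<circ> A) (shift_operators 0 k)"
proof (rule inj_onI)
  fix A B assume A: "A \<in> shift_operators 0 k" and B: "B \<in> shift_operators 0 k" and "S \<circ> A = S \<circ> B"
  then have eq: "S (A f) = S (B f)" for f by (simp add: fun_eq_iff)
  let ?U = "\<lambda>f. A f + const (- 1) * B f"
  have "S \<circ> ?U = (\<lambda>_. 0)"
    by (simp add: fun_eq_iff shift_operators_linear(1,2)[OF S(1)] eq) (simp add: const_simps)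
  then have "?U = (\<lambda>_. 0)"
    using shift_operators_comp_nonzero[OF S shift_operators_add_scale[OF A B]] by blast
  then show "A = B" by (simp add: fun_eq_iff const_simps)
qed

lemma freely_generates_if_minimal:
  assumes c: "c = 1 \<or> c = - 1"
    and S: "S \<in> shift_operators l k" "local_order c S e"
    and minimal: "\<And>T e'. T \<in> shift_operators l k \<Longrightarrow> local_order c T e' \<Longrightarrow> e \<le> e'"
  shows "freely_generates S l k"
  unfolding freely_generates_def bij_betw_def
proof
  show "inj_on (\<lambda>A. S \<circ> A) (shift_operators 0 k)"
    by (rule shift_operators_comp_inj[OF S(1) local_order_nonzero[OF c S(2)]])
  show "(\<lambda>A. S \<circ> A) ` shift_operators 0 k = shift_operators l k"
  proof
    show "(\<lambda>A. S \<circ> A) ` shift_operators 0 k \<subseteq> shift_operators l k"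
      using shift_operators_comp_generated[OF _ S(1)] by (auto simp: shift_operators_0_eq)
    have "\<exists>A \<in> generated_algebra (cherednik k). T = S \<circ> A" if "T \<in> shift_operators l k" for T
      using c S minimal that by (rule shift_operators_generated)
    then show "shift_operators l k \<subseteq> (\<lambda>A. S \<circ> A) ` shift_operators 0 k"
      by (auto simp: shift_operators_0_eq)
  qed
qed

text \<open>Orders are bounded below by the increment of the parameter, so an operator of minimal order exists.\<close>

lemma freely_generates_exists:
  assumes "S \<in> shift_operators l k" "S \<noteq> (\<lambda>_. 0)"
  shows "\<exists>S. freely_generates S l k"
proof -
  have c: "(1::complex) = 1 \<or> (1::complex) = - 1" by simp
  let ?P = "\<lambda>n. \<exists>T \<in> shift_operators l k. local_order 1 T (local_increment 1 l + int n)"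
  obtain e where e: "local_order 1 S e" using shift_operator_local_order[OF c assms] .
  then have "?P (nat (e - local_increment 1 l))"
    using local_order_ge_increment[OF c assms(1) e] assms(1) by auto
  then have "?P (Least ?P)" by (rule LeastI)
  then obtain T where T: "T \<in> shift_operators l k" "local_order 1 T (local_increment 1 l + int (Least ?P))"
    by blast
  have "local_increment 1 l + int (Least ?P) \<le> e'"
    if "U \<in> shift_operators l k" "local_order 1 U e'" for U e'
  proof -
    have ge: "e' \<ge> local_increment 1 l" by (rule local_order_ge_increment[OF c that])
    then have "?P (nat (e' - local_increment 1 l))" using that by auto
    then have "Least ?P \<le> nat (e' - local_increment 1 l)" by (rule Least_le)
    then show ?thesis using ge by linarith
  qed
  then show ?thesis using freely_generates_if_minimal[OF c T] by blast
qed

section \<open>Products of the fundamental shift operators\<close>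

lemma left_prod_add: "left_prod F (m + n) = left_prod (\<lambda>i. F (i + m)) n \<circ> left_prod F m"
  by (induction n) (simp_all add: comp_assoc add.commute)

lemma left_prod_shift_operators:
  assumes "\<And>i. elementary_shift (F i) v (shift k (l + (int i * fst v, int i * snd v)))"
    and "S \<in> shift_operators l k" "S \<in> operators_le m" "S \<noteq> (\<lambda>_. 0)"
  shows "left_prod F n \<circ> S \<in> shift_operators (l + (int n * fst v, int n * snd v)) k \<and>
    left_prod F n \<circ> S \<in> operators_le (m + n) \<and> left_prod F n \<circ> S \<noteq> (\<lambda>_. 0)"
proof (induction n)
  case 0
  show ?case using assms(2-4) by (simp flip: zero_prod_def)
next
  case (Suc n)
  let ?P = "left_prod F n \<circ> S" and ?l = "l + (int n * fst v, int n * snd v)"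
  have P: "?P \<in> shift_operators ?l k" "?P \<in> operators_le (m + n)" "?P \<noteq> (\<lambda>_. 0)"
    using Suc by blast+
  have l: "?l + v = l + (int (Suc n) * fst v, int (Suc n) * snd v)"
    by (simp add: prod_eq_iff algebra_simps)
  have F: "elementary_shift (F n) v (shift k ?l)" by (rule assms(1))
  have "F n \<in> shift_operators (0 + v) (shift k ?l)"
    using elementary_shift_comp(1)[OF _ shift_operators_id operators_le_id, of "F n" v "shift k ?l"] F
    by (simp add: shift_0)
  then have "F n \<circ> ?P \<noteq> (\<lambda>_. 0)"
    by (rule shift_operators_comp_nonzero[OF _ elementary_shift_nonzero[OF F] P(1,3)])
  moreover have "left_prod F (Suc n) \<circ> S = F n \<circ> ?P" by (simp add: comp_assoc)
  ultimately show ?case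
    using elementary_shift_comp[OF F P(1,2)] unfolding l by (simp only: add_Suc_right simp_thms)
qed

text \<open>The sign \<open>e\<close> selects the direction of the shift, \<open>e (2, - 1)\<close> for the first kind and \<open>e (0, 1)\<close> for the second.\<close>

definition fundamental_1 :: "int \<Rightarrow> multiplicity \<Rightarrow> operator" where
  "fundamental_1 e = (if e = 1 then G_2_m1 else G_m2_1)"

definition fundamental_2 :: "int \<Rightarrow> multiplicity \<Rightarrow> operator" where
  "fundamental_2 e = (if e = 1 then G_0_1 else G_0_m1)"

definition product_1 :: "int \<Rightarrow> nat \<Rightarrow> multiplicity \<Rightarrow> operator" where
  "product_1 e N k = left_prod (\<lambda>i. fundamental_1 e (shift k (int i * (2 * e), int i * (- e)))) N"

definition product_2 :: "int \<Rightarrow> nat \<Rightarrow> multiplicity \<Rightarrow> operator" where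
  "product_2 e N k = left_prod (\<lambda>j. fundamental_2 e (shift k (0, int j * e))) N"

text \<open>The factors of the first kind start at \<open>k + m2 (0, 1)\<close>, where the product of the factors of the second
  kind ends.\<close>

lemma shift_generator_eq:
  fixes l k
  defines "m1 \<equiv> fst l div 2" and "m2 \<equiv> snd l + fst l div 2"
  shows "shift_generator l k =
    product_1 (sgn m1) (nat \<bar>m1\<bar>) (shift k (0, m2)) \<circ> product_2 (sgn m2) (nat \<bar>m2\<bar>) k"
proof -
  have "sgn m2 * \<bar>m2\<bar> = m2" by (rule sgn_mult_abs)
  then have "shift k (sgn m1 * int i * 2, sgn m1 * int i * - 1 + sgn m2 * int (nat \<bar>m2\<bar>)) =
      shift (shift k (0, m2)) (int i * (2 * sgn m1), int i * - sgn m1)" for i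
    unfolding shift_shift by (simp add: mult_ac)
  then show ?thesis
    unfolding shift_generator_def Let_def product_1_def product_2_def fundamental_1_def
      fundamental_2_def m1_def m2_def
    by (simp add: mult.commute cong del: if_weak_cong)
qed

lemma elementary_shift_fundamental:
  "e = 1 \<or> e = - 1 \<Longrightarrow> elementary_shift (fundamental_1 e k) (2 * e, - e) k"
  "e = 1 \<or> e = - 1 \<Longrightarrow> elementary_shift (fundamental_2 e k) (0, e) k"
  using elementary_shift_G_0_1[of k] elementary_shift_G_0_m1[of k] elementary_shift_G_2_m1[of k]
    elementary_shift_G_m2_1[of k]
  by (auto simp: fundamental_1_def fundamental_2_def)

lemma product_shift_operators:
  assumes e: "N1 = 0 \<or> e1 = 1 \<or> e1 = - 1" "N2 = 0 \<or> e2 = 1 \<or> e2 = - 1"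
  shows "product_1 e1 N1 (shift k (0, int N2 * e2)) \<circ> product_2 e2 N2 k
      \<in> shift_operators (int N1 * (2 * e1), int N2 * e2 - int N1 * e1) k"
    and "product_1 e1 N1 (shift k (0, int N2 * e2)) \<circ> product_2 e2 N2 k \<in> operators_le (N1 + N2)"
    and "product_1 e1 N1 (shift k (0, int N2 * e2)) \<circ> product_2 e2 N2 k \<noteq> (\<lambda>_. 0)"
proof -
  have id: "id \<noteq> (\<lambda>_. 0 :: ratfun)" by (metis id_apply zero_neq_one)
  define Q where "Q = product_2 e2 N2 k"
  have Q: "Q \<in> shift_operators (0, int N2 * e2) k" "Q \<in> operators_le N2" "Q \<noteq> (\<lambda>_. 0)"
  proof -
    have "Q \<in> shift_operators (0, int N2 * e2) k \<and> Q \<in> operators_le N2 \<and> Q \<noteq> (\<lambda>_. 0)"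
    proof (cases "N2 = 0")
      case True
      then show ?thesis using shift_operators_id operators_le_id id
        by (simp add: Q_def product_2_def flip: zero_prod_def)
    next
      case False
      then have "elementary_shift (fundamental_2 e2 (shift k (0, int j * e2))) (0, e2)
          (shift k (0 + (int j * fst (0, e2), int j * snd (0, e2))))" for j
        using elementary_shift_fundamental(2)[of e2] e by simp
      from left_prod_shift_operators[OF this shift_operators_id operators_le_id id, of N2]
      show ?thesis by (simp add: Q_def product_2_def)
    qed
    then show "Q \<in> shift_operators (0, int N2 * e2) k" "Q \<in> operators_le N2" "Q \<noteq> (\<lambda>_. 0)"
      by blast+
  qed
  let ?k = "shift k (0, int N2 * e2)"
  have "product_1 e1 N1 ?k \<circ> Q \<in> shift_operators (int N1 * (2 * e1), int N2 * e2 - int N1 * e1) k \<and>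
      product_1 e1 N1 ?k \<circ> Q \<in> operators_le (N1 + N2) \<and> product_1 e1 N1 ?k \<circ> Q \<noteq> (\<lambda>_. 0)"
  proof (cases "N1 = 0")
    case True
    then show ?thesis using Q by (simp add: product_1_def)
  next
    case False
    then have "elementary_shift (fundamental_1 e1 (shift ?k (int i * (2 * e1), int i * (- e1))))
        (2 * e1, - e1)
        (shift k ((0, int N2 * e2) + (int i * fst (2 * e1, - e1), int i * snd (2 * e1, - e1))))" for i
      using elementary_shift_fundamental(1)[of e1] e by (simp add: shift_shift)
    from left_prod_shift_operators[OF this Q, of N1]
    show ?thesis by (simp add: product_1_def add.commute)
  qed
  then show "product_1 e1 N1 ?k \<circ> product_2 e2 N2 k
      \<in> shift_operators (int N1 * (2 * e1), int N2 * e2 - int N1 * e1) k"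
    "product_1 e1 N1 ?k \<circ> product_2 e2 N2 k \<in> operators_le (N1 + N2)"
    "product_1 e1 N1 ?k \<circ> product_2 e2 N2 k \<noteq> (\<lambda>_. 0)"
    unfolding Q_def by blast+
qed

lemma shift_generator_shift_operators:
  assumes "even (fst l)"
  shows "shift_generator l k \<in> shift_operators l k"
    and "shift_generator l k \<in> operators_le (nat (max \<bar>fst l + snd l\<bar> \<bar>snd l\<bar>))"
    and "shift_generator l k \<noteq> (\<lambda>_. 0)"
proof -
  define m1 where "m1 = fst l div 2"
  define m2 where "m2 = snd l + fst l div 2"
  have l: "fst l = 2 * m1" "snd l = m2 - m1" using assms by (simp_all add: m1_def m2_def)
  have sg: "nat \<bar>m\<bar> = 0 \<or> sgn m = 1 \<or> sgn m = - 1" for m :: int by (auto simp: sgn_if)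
  have m: "int (nat \<bar>m\<bar>) * sgn m = m" "int (nat \<bar>m\<bar>) * (2 * sgn m) = 2 * m" for m :: int
    by (auto simp: sgn_if)
  have "(2 * m1, m2 - m1) = l" by (simp add: prod_eq_iff l)
  moreover have "nat \<bar>m1\<bar> + nat \<bar>m2\<bar> = nat (max \<bar>fst l + snd l\<bar> \<bar>snd l\<bar>)"
    unfolding l by linarith
  moreover have "shift_generator l k =
      product_1 (sgn m1) (nat \<bar>m1\<bar>) (shift k (0, m2)) \<circ> product_2 (sgn m2) (nat \<bar>m2\<bar>) k"
    unfolding m1_def m2_def by (rule shift_generator_eq)
  ultimately show "shift_generator l k \<in> shift_operators l k"
    "shift_generator l k \<in> operators_le (nat (max \<bar>fst l + snd l\<bar> \<bar>snd l\<bar>))"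
    "shift_generator l k \<noteq> (\<lambda>_. 0)"
    using product_shift_operators[OF sg[of m1] sg[of m2], of k]
    unfolding m by metis+
qed

text \<open>The parameters of the factors are shifted by what has already been applied, and with these
  shifts factors of the two kinds can be moved past each other.\<close>

lemma fundamental_commute:
  assumes "e1 = 1 \<or> e1 = - 1" "e2 = 1 \<or> e2 = - 1"
  shows "fundamental_2 e2 (shift k (2 * e1, - e1)) \<circ> fundamental_1 e1 k =
    fundamental_1 e1 (shift k (0, e2)) \<circ> fundamental_2 e2 k"
proof -
  have "theta (const (fst k)) = 0" "theta (const (snd k)) = 0"
    "reflection (const (fst k)) = const (fst k)" "reflection (const (snd k)) = const (snd k)"
    by simp_all
  note c = G_0_1_G_2_m1_commute[OF this] G_0_1_G_m2_1_commute[OF this]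
    G_0_m1_G_2_m1_commute[OF this] G_0_m1_G_m2_1_commute[OF this]
  show ?thesis using assms c
    by (auto simp: fundamental_1_def fundamental_2_def G_0_1_eq_form G_0_m1_eq_form G_2_m1_eq_form
        G_m2_1_eq_form shift_def const_plus_int)
qed

lemma product_2_fundamental_1_commute:
  assumes "e1 = 1 \<or> e1 = - 1" "e2 = 1 \<or> e2 = - 1"
  shows "product_2 e2 N (shift k (2 * e1, - e1)) \<circ> fundamental_1 e1 k =
    fundamental_1 e1 (shift k (0, int N * e2)) \<circ> product_2 e2 N k"
proof (induction N)
  case 0
  show ?case by (simp add: product_2_def shift_0)
next
  case (Suc N)
  have P: "product_2 e2 (Suc N) k' = fundamental_2 e2 (shift k' (0, int N * e2)) \<circ> product_2 e2 N k'"
    for k' by (simp add: product_2_def)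
  have s: "shift (shift k (2 * e1, - e1)) (0, int N * e2) =
      shift (shift k (0, int N * e2)) (2 * e1, - e1)"
    by (simp add: shift_shift)
  have "product_2 e2 (Suc N) (shift k (2 * e1, - e1)) \<circ> fundamental_1 e1 k =
      (fundamental_2 e2 (shift (shift k (0, int N * e2)) (2 * e1, - e1)) \<circ>
        fundamental_1 e1 (shift k (0, int N * e2))) \<circ> product_2 e2 N k"
    unfolding P s comp_assoc Suc ..
  also have "\<dots> = fundamental_1 e1 (shift (shift k (0, int N * e2)) (0, e2)) \<circ> product_2 e2 (Suc N) k"
    unfolding fundamental_commute[OF assms] P comp_assoc ..
  finally show ?case by (simp add: shift_shift algebra_simps)
qed

lemma product_commute:
  assumes "N1 = 0 \<or> e1 = 1 \<or> e1 = - 1" "N2 = 0 \<or> e2 = 1 \<or> e2 = - 1"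
  shows "product_2 e2 N2 (shift k (int N1 * (2 * e1), int N1 * - e1)) \<circ> product_1 e1 N1 k =
    product_1 e1 N1 (shift k (0, int N2 * e2)) \<circ> product_2 e2 N2 k"
proof (cases "N2 = 0")
  case True
  then show ?thesis by (simp add: product_2_def shift_0)
next
  case N2: False
  show ?thesis using assms(1)
  proof (induction N1)
    case 0
    show ?case by (simp add: product_1_def shift_0)
  next
    case (Suc N)
    then have e1: "e1 = 1 \<or> e1 = - 1" by simp
    let ?k = "shift k (int N * (2 * e1), int N * - e1)"
    have IH: "product_2 e2 N2 ?k \<circ> product_1 e1 N k =
        product_1 e1 N (shift k (0, int N2 * e2)) \<circ> product_2 e2 N2 k"
      using Suc.IH e1 by blast
    have s': "shift ?k (0, int N2 * e2) = shift (shift k (0, int N2 * e2)) (int N * (2 * e1), int N * - e1)"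
      by (simp add: shift_shift)
    have s: "shift k (int (Suc N) * (2 * e1), int (Suc N) * - e1) = shift ?k (2 * e1, - e1)"
      by (simp add: shift_shift algebra_simps)
    have P: "product_1 e1 (Suc N) k' =
        fundamental_1 e1 (shift k' (int N * (2 * e1), int N * - e1)) \<circ> product_1 e1 N k'" for k'
      by (simp add: product_1_def)
    have "product_2 e2 N2 (shift ?k (2 * e1, - e1)) \<circ> product_1 e1 (Suc N) k =
        (product_2 e2 N2 (shift ?k (2 * e1, - e1)) \<circ> fundamental_1 e1 ?k) \<circ> product_1 e1 N k"
      unfolding P by (simp only: comp_assoc)
    also have "\<dots> = fundamental_1 e1 (shift ?k (0, int N2 * e2)) \<circ>
        (product_2 e2 N2 ?k \<circ> product_1 e1 N k)"
      using product_2_fundamental_1_commute[OF e1, of e2 N2 ?k] assms(2) N2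
      by (simp only: comp_assoc simp_thms)
    also have "\<dots> = fundamental_1 e1 (shift ?k (0, int N2 * e2)) \<circ>
        (product_1 e1 N (shift k (0, int N2 * e2)) \<circ> product_2 e2 N2 k)"
      unfolding IH ..
    also have "\<dots> = product_1 e1 (Suc N) (shift k (0, int N2 * e2)) \<circ> product_2 e2 N2 k"
      unfolding P s' comp_assoc ..
    finally show ?case unfolding s .
  qed
qed

lemma product_add:
  "product_1 e (M + N) k = product_1 e N (shift k (int M * (2 * e), int M * - e)) \<circ> product_1 e M k"
  "product_2 e (M + N) k = product_2 e N (shift k (0, int M * e)) \<circ> product_2 e M k"
  by (simp_all add: product_1_def product_2_def left_prod_add shift_shift algebra_simps)

text \<open>Equal signs mean that the products for \<open>l\<close> and \<open>l'\<close> consist of the same kinds of factors. Concatenating them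
  gives the product for \<open>l + l'\<close> once the second-kind factors for \<open>l'\<close> have been moved past the
  first-kind factors for \<open>l\<close>.\<close>

lemma shift_generator_add:
  assumes even: "even (fst l)" "even (fst l')"
    and sgn1: "sgn (fst l) = sgn (fst l')"
    and sgn2: "sgn (fst l div 2 + snd l) = sgn (fst l' div 2 + snd l')"
  shows "shift_generator (l + l') k = shift_generator l' (shift k l) \<circ> shift_generator l k"
proof -
  define m1 m2 where "m1 = fst l div 2" and "m2 = snd l + fst l div 2"
  define m1' m2' where "m1' = fst l' div 2" and "m2' = snd l' + fst l' div 2"
  note m = m1_def m2_def m1'_def m2'_def
  have l: "l = (2 * m1, m2 - m1)" using even by (simp add: m prod_eq_iff)
  have "fst l = 2 * m1" "fst l' = 2 * m1'" using even by (simp_all add: m)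
  then have e1: "sgn m1' = sgn m1" using sgn1 by (simp add: sgn_mult)
  have e2: "sgn m2' = sgn m2" using sgn2 by (simp add: m add.commute)
  have sum: "fst (l + l') div 2 = m1 + m1'" "snd (l + l') + fst (l + l') div 2 = m2 + m2'"
    using even by (simp_all add: m div_plus_div_distrib_dvd_left)
  have add: "sgn (a + b) = sgn a" "nat \<bar>a + b\<bar> = nat \<bar>a\<bar> + nat \<bar>b\<bar>" if "sgn b = sgn a" for a b :: int
    using that by (auto simp: sgn_if split: if_splits)
  define N1 N2 N1' N2' where "N1 = nat \<bar>m1\<bar>" "N2 = nat \<bar>m2\<bar>" "N1' = nat \<bar>m1'\<bar>" "N2' = nat \<bar>m2'\<bar>"
  note N = this
  define s1 s2 where "s1 = sgn m1" and "s2 = sgn m2"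
  have "\<bar>m2'\<bar> * sgn m2' = m2'" by (rule abs_mult_sgn)
  then have NS: "int N1 * s1 = m1" "int N2 * s2 = m2" "int N2' * s2 = m2'"
    unfolding N s1_def s2_def e2 by (simp_all add: abs_mult_sgn)
  then have NS2: "int N1 * (2 * s1) = 2 * m1" by simp
  have "nat \<bar>m\<bar> = 0 \<or> sgn m = 1 \<or> sgn m = - 1" for m :: int by (auto simp: sgn_if)
  then have s: "N1 = 0 \<or> s1 = 1 \<or> s1 = - 1" "N2' = 0 \<or> s2 = 1 \<or> s2 = - 1"
    unfolding N s1_def s2_def e2[symmetric] by blast+
  have "shift_generator (l + l') k = product_1 s1 (N1 + N1') (shift k (0, m2 + m2')) \<circ>
      product_2 s2 (N2 + N2') k"
    unfolding shift_generator_eq unfolding sum(2)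
    unfolding sum(1) add[OF e1] add[OF e2] N s1_def s2_def ..
  also have "\<dots> = product_1 s1 N1' (shift k (2 * m1, m2 + m2' - m1)) \<circ>
      (product_1 s1 N1 (shift k (0, m2 + m2')) \<circ> product_2 s2 N2' (shift k (0, m2))) \<circ>
      product_2 s2 N2 k"
    using NS by (simp add: product_add shift_shift comp_assoc, simp only: NS2)
  also have "product_1 s1 N1 (shift k (0, m2 + m2')) \<circ> product_2 s2 N2' (shift k (0, m2)) =
      product_2 s2 N2' (shift k (2 * m1, m2 - m1)) \<circ> product_1 s1 N1 (shift k (0, m2))"
    using product_commute[OF s, of "shift k (0, m2)"] unfolding NS2
    by (simp add: shift_shift NS)
  also have "product_1 s1 N1' (shift k (2 * m1, m2 + m2' - m1)) \<circ>
      (product_2 s2 N2' (shift k (2 * m1, m2 - m1)) \<circ> product_1 s1 N1 (shift k (0, m2))) \<circ>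
      product_2 s2 N2 k = shift_generator l' (shift k l) \<circ> shift_generator l k"
  proof -
    have "shift_generator l k = product_1 s1 N1 (shift k (0, m2)) \<circ> product_2 s2 N2 k"
      unfolding shift_generator_eq N s1_def s2_def m ..
    moreover have "shift_generator l' (shift k l) =
        product_1 s1 N1' (shift (shift k l) (0, m2')) \<circ> product_2 s2 N2' (shift k l)"
      unfolding N s1_def s2_def e1[symmetric] e2[symmetric] unfolding m1'_def m2'_def
      by (rule shift_generator_eq)
    ultimately show ?thesis unfolding l by (simp add: shift_shift comp_assoc algebra_simps)
  qed
  finally show ?thesis .
qed

text \<open>The product has as many factors as the largest increment of the two parameters. At the fixed
  point where this increment occurs and does not cross, the resulting upper bound for the local order of
  the product is the lower bound for the local order of any shift operator.\<close>

lemma shift_generator_freely_generates: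
  assumes even: "even (fst l)" and nonres: "nonresonant l k"
  shows "freely_generates (shift_generator l k) l k"
proof -
  obtain c :: complex where c: "c = 1 \<or> c = - 1"
    and nc: "\<not> crosses (local_parameter c k - 1 / 2) (local_increment c l)"
    and max: "max \<bar>fst l + snd l\<bar> \<bar>snd l\<bar> = \<bar>local_increment c l\<bar>"
  proof -
    have "(1::complex) \<noteq> - 1" by simp
    then show thesis
      using nonres that[of 1] that[of "- 1"]
      by (auto simp: nonresonant_def Let_def local_parameter_def local_increment_def)
  qed
  note G = shift_generator_shift_operators[OF even, of k]
  obtain e where e: "local_order c (shift_generator l k) e"
    using shift_operator_local_order[OF c G(1,3)] .
  have "e \<le> \<bar>local_increment c l\<bar> + local_increment c l"
    using local_order_le[OF c G(1,2) e] by (simp add: max)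
  then have "e \<le> e'" if "T \<in> shift_operators l k" "local_order c T e'" for T e'
    using local_order_lower_bound[OF c that nc] by linarith
  then show ?thesis by (rule freely_generates_if_minimal[OF c G(1) e])
qed

theorem theorem4p8:
  fixes k :: multiplicity and l l' :: "int \<times> int"
  assumes "even (fst l)" and "even (fst l')"
  shows "shift_operators 0 k = generated_algebra (cherednik k) \<and>
    ((\<exists>S. freely_generates S l k) \<and>
     shift_generator l k \<in> shift_operators l k \<and>
     inj_on (\<lambda>A. shift_generator l k \<circ> A) (shift_operators 0 k) \<and>
     (nonresonant l k \<longrightarrow> freely_generates (shift_generator l k) l k)) \<and>
    (sgn (fst l) = sgn (fst l') \<and>
     sgn (fst l div 2 + snd l) = sgn (fst l' div 2 + snd l') \<longrightarrow>
       shift_generator (l + l') k = shift_generator l' (shift k l) \<circ> shift_generator l k \<and>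
       shift_generator (l + l') k = shift_generator l (shift k l') \<circ> shift_generator l' k)"
proof (intro conjI impI)
  note G = shift_generator_shift_operators[OF assms(1), of k]
  show "shift_operators 0 k = generated_algebra (cherednik k)"
    by (rule shift_operators_0_eq)
  show "\<exists>S. freely_generates S l k"
    by (rule freely_generates_exists[OF G(1,3)])
  show "shift_generator l k \<in> shift_operators l k"
    by (rule G(1))
  show "inj_on (\<lambda>A. shift_generator l k \<circ> A) (shift_operators 0 k)"
    by (rule shift_operators_comp_inj[OF G(1,3)])
  show "freely_generates (shift_generator l k) l k" if "nonresonant l k"
    by (rule shift_generator_freely_generates[OF assms(1) that])
  assume "sgn (fst l) = sgn (fst l') \<and> sgn (fst l div 2 + snd l) = sgn (fst l' div 2 + snd l')"
  then show "shift_generator (l + l') k = shift_generator l' (shift k l) \<circ> shift_generator l k"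
    and "shift_generator (l + l') k = shift_generator l (shift k l') \<circ> shift_generator l' k"
    using shift_generator_add[OF assms] shift_generator_add[OF assms(2,1)]
    by (simp_all add: add.commute)
qed

end
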